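(* Let $Y=(Y_{ij})_{1\le i,j\le n}$ have independent uniform $[0,1]$ entries, with minimum assignment cost $C_n$, and adjoin a root $o$ uniformly distributed on $\{1,\dots,n\}$ and independent of $Y$. Let $(D,U)$ be constructed from the aligned matrix $\widetilde Y$ and the shortest-path potential $q^{(o)}$ as described in the context, and put $A_i=D_i-U_i$. Then: (1) The law $\mathbb P_n^{\mathrm{can}}$ of $(D,U)$ (with the root forgotten) on $\mathbb R^n\times H_0$ has density $$\frac{n!}{n^{2n-1}}\,\mathbf 1_{\{0\le D_i\le n\ \forall i\}}\prod_{i\ne j}\rho_n(D_i+U_j-U_i)\;\mathfrak T(w),\qquad w_{ij}=\omega_n(D_i+U_j-U_i)\mathbf 1_{\{i\ne j\}},$$ with respect to $dD\,dU$. Consequently the unnormalized partition function $$Z_n^{\mathrm{can}}=\int_{H_0}\int_{[0,n]^n}\prod_{i\ne j}\rho_n(D_i+U_j-U_i)\,\mathfrak T(w)\,dD\,dU$$ equals $\dfrac{n^{2n-2}}{(n-1)!}$. (2) The translation $D_i=A_i+U_i$ has unit Jacobian, and $(A,U)$ has density $$\frac{n!}{n^{2n-1}}\,\mathbf 1_{\{0\le A_i+U_i\le n\ \forall i\}}\prod_{i\ne j}\rho_n(A_i+U_j)\;\mathfrak T\bigl((\omega_n(A_i+U_j)\mathbf 1_{\{i\ne j\}})_{ij}\bigr)$$ with respect to $dA\,dU$. (3) Almost surely, for all $i,j$, $$A_i=\min_j\{n\widetilde Y_{ij}-U_j\},\qquad U_j=\min_i\{n\widetilde Y_{ij}-A_i\},\qquad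 D_i=A_i+U_i,\qquad C_n=\frac1n\sum_iD_i=\frac1n\sum_iA_i .$$
   Context: $C_n=\min_{\sigma\in S_n}\sum_iY_{i,\sigma(i)}$. Almost surely the minimizing permutation $\Sigma$ is unique; the aligned matrix is $\widetilde Y_{ij}=Y_{i,\Sigma(j)}$, so that the identity is its optimal permutation. Put $d_i=\widetilde Y_{ii}$ and $\Delta_{ij}=\widetilde Y_{ij}-d_i$ for $i\ne j$. By optimality every directed cycle has nonnegative $\Delta$-length. For a root $o$, let $\mathrm{dist}_o(i)$ be the minimal $\Delta$-length of a directed path from $i$ to $o$ (edges $i\to j$ have length $\Delta_{ij}$; $\mathrm{dist}_o(o)=0$), and $q_i^{(o)}=-\mathrm{dist}_o(i)$. With $q=q^{(o)}$ and $\bar q=\frac1n\sum_iq_i$, set $D_i=nd_i$, $U_i=n(q_i-\bar q)$. $H_0=\{U\in\mathbb R^n:\sum_iU_i=0\}$, with reference measure $dU=dU_1\cdots dU_{n-1}$ (where $U_n=-\sum_{i<n}U_i$). With $t_+=\max(t,0)$, $$\rho_n(t)=\Bigl(1-\frac{t_+}{n}\Bigr)_+,\qquad \omega_n(t)=\begin{cases}(1-t/n)^{-1},&0\le t<n,\\0,&\text{otherwise.}\end{cases}$$ An in-arborescence toward $o$ is a directed spanning tree of $\{1,\dots,n\}$ in which every vertex other than $o$ has exactly one outgoing edge, $o$ has none, and following edges always leads to $o$; $\mathfrak T_o$ is the set of these. For a matrix $z$, $\tau_o(z)=\sum_{T\in\mathfrak T_o}\prod_{e\in T}z_e$, and $\mathfrak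 T(z)=\sum_{o=1}^n\tau_o(z)$. *)

theory Defs
  imports
    "HOL-Probability.Probability"
    "HOL-Combinatorics.Permutations"
    "Jordan_Normal_Form.Determinant"
begin

text \<open>
  The index set is \<open>{1..n}\<close>. Vectors indexed by it are elements of \<open>PiE {1..n} (\<lambda>_. UNIV)\<close>, the
  space of \<open>PiM {1..n} (\<lambda>_. lborel)\<close>; matrices are functions \<open>nat \<Rightarrow> nat \<Rightarrow> real\<close> of which only
  the entries with indices in \<open>{1..n}\<close> matter.
\<close>

section \<open>The assignment problem\<close>

definition perm_cost :: "nat \<Rightarrow> (nat \<Rightarrow> nat \<Rightarrow> real) \<Rightarrow> (nat \<Rightarrow> nat) \<Rightarrow> real" where
  "perm_cost n y \<sigma> = (\<Sum>i\<in>{1..n}. y i (\<sigma> i))"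

definition assignment_cost :: "nat \<Rightarrow> (nat \<Rightarrow> nat \<Rightarrow> real) \<Rightarrow> real" where
  "assignment_cost n y = Min (perm_cost n y ` {\<sigma>. \<sigma> permutes {1..n}})"

text \<open>
  The minimizer is almost surely unique for independent uniform entries. In case of a tie the
  choice depends only on the set of minimizers.
\<close>
definition opt_perm :: "nat \<Rightarrow> (nat \<Rightarrow> nat \<Rightarrow> real) \<Rightarrow> (nat \<Rightarrow> nat)" where
  "opt_perm n y =
     (SOME \<sigma>. \<sigma> permutes {1..n} \<and> (\<forall>\<tau>. \<tau> permutes {1..n} \<longrightarrow> perm_cost n y \<sigma> \<le> perm_cost n y \<tau>))"

definition aligned :: "nat \<Rightarrow> (nat \<Rightarrow> nat \<Rightarrow> real) \<Rightarrow> nat \<Rightarrow> nat \<Rightarrow> real" where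
  "aligned n y i j = y i (opt_perm n y j)"

definition slack :: "nat \<Rightarrow> (nat \<Rightarrow> nat \<Rightarrow> real) \<Rightarrow> nat \<Rightarrow> nat \<Rightarrow> real" where
  "slack n y i j = aligned n y i j - aligned n y i i"

section \<open>Shortest-path potentials\<close>

text \<open>A directed path is its list of pairwise distinct vertices; \<open>[i]\<close> is the path from \<open>i\<close> to \<open>i\<close>.\<close>
definition directed_paths :: "nat \<Rightarrow> nat \<Rightarrow> nat \<Rightarrow> nat list set" where
  "directed_paths n i r =
     {p. p \<noteq> [] \<and> distinct p \<and> set p \<subseteq> {1..n} \<and> hd p = i \<and> last p = r}"

definition path_length :: "(nat \<Rightarrow> nat \<Rightarrow> real) \<Rightarrow> nat list \<Rightarrow> real" where
  "path_length \<Delta> p = sum_list (map2 \<Delta> p (tl p))"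

definition dist_to :: "nat \<Rightarrow> (nat \<Rightarrow> nat \<Rightarrow> real) \<Rightarrow> nat \<Rightarrow> nat \<Rightarrow> real" where
  "dist_to n y r i = Min (path_length (slack n y) ` directed_paths n i r)"

definition potential :: "nat \<Rightarrow> (nat \<Rightarrow> nat \<Rightarrow> real) \<Rightarrow> nat \<Rightarrow> nat \<Rightarrow> real" where
  "potential n y r i = - dist_to n y r i"

definition D_vec :: "nat \<Rightarrow> (nat \<Rightarrow> nat \<Rightarrow> real) \<Rightarrow> nat \<Rightarrow> real" where
  "D_vec n y = (\<lambda>i\<in>{1..n}. real n * aligned n y i i)"

definition U_vec :: "nat \<Rightarrow> (nat \<Rightarrow> nat \<Rightarrow> real) \<Rightarrow> nat \<Rightarrow> nat \<Rightarrow> real" where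
  "U_vec n y r =
     (\<lambda>i\<in>{1..n}. real n * (potential n y r i - (\<Sum>k\<in>{1..n}. potential n y r k) / real n))"

definition A_vec :: "nat \<Rightarrow> (nat \<Rightarrow> nat \<Rightarrow> real) \<Rightarrow> nat \<Rightarrow> nat \<Rightarrow> real" where
  "A_vec n y r = (\<lambda>i\<in>{1..n}. D_vec n y i - U_vec n y r i)"

section \<open>The reference measures\<close>

definition H0 :: "nat \<Rightarrow> (nat \<Rightarrow> real) set" where
  "H0 n = {U \<in> PiE {1..n} (\<lambda>_. UNIV). (\<Sum>i\<in>{1..n}. U i) = 0}"

definition H0_param :: "nat \<Rightarrow> (nat \<Rightarrow> real) \<Rightarrow> nat \<Rightarrow> real" where
  "H0_param n u = (\<lambda>i\<in>{1..n}. if i < n then u i else - (\<Sum>k\<in>{1..<n}. u k))"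

text \<open>\<open>dU = dU\<^sub>1 \<dots> dU\<^bsub>n-1\<^esub>\<close>, as a measure with space \<open>H0 n\<close>.\<close>
definition H0_measure :: "nat \<Rightarrow> (nat \<Rightarrow> real) measure" where
  "H0_measure n =
     distr (PiM {1..<n} (\<lambda>_. lborel)) (restrict_space (PiM {1..n} (\<lambda>_. borel)) (H0 n)) (H0_param n)"

definition ref_measure :: "nat \<Rightarrow> ((nat \<Rightarrow> real) \<times> (nat \<Rightarrow> real)) measure" where
  "ref_measure n = PiM {1..n} (\<lambda>_. lborel) \<Otimes>\<^sub>M H0_measure n"

section \<open>Arborescences, weights and the partition function\<close>

definition rho :: "nat \<Rightarrow> real \<Rightarrow> real" where
  "rho n t = max (1 - max t 0 / real n) 0"

definition omega :: "nat \<Rightarrow> real \<Rightarrow> real" where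
  "omega n t = (if 0 \<le> t \<and> t < real n then inverse (1 - t / real n) else 0)"

definition in_arborescences :: "nat \<Rightarrow> nat \<Rightarrow> (nat \<times> nat) set set" where
  "in_arborescences n r =
     {T. T \<subseteq> {1..n} \<times> {1..n}
         \<and> (\<forall>i\<in>{1..n} - {r}. \<exists>!j. (i, j) \<in> T)
         \<and> (\<forall>j. (r, j) \<notin> T)
         \<and> (\<forall>i\<in>{1..n}. (i, r) \<in> T\<^sup>*)}"

definition tree_poly_at :: "nat \<Rightarrow> nat \<Rightarrow> (nat \<Rightarrow> nat \<Rightarrow> real) \<Rightarrow> real" where
  "tree_poly_at n r z = (\<Sum>T\<in>in_arborescences n r. \<Prod>(i, j)\<in>T. z i j)"

definition tree_poly :: "nat \<Rightarrow> (nat \<Rightarrow> nat \<Rightarrow> real) \<Rightarrow> real" where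
  "tree_poly n z = (\<Sum>r\<in>{1..n}. tree_poly_at n r z)"

definition off_diag :: "nat \<Rightarrow> (nat \<times> nat) set" where
  "off_diag n = {(i, j). i \<in> {1..n} \<and> j \<in> {1..n} \<and> i \<noteq> j}"

text \<open>The integrand is nonnegative, so the integrals are taken in \<open>[0, \<infinity>]\<close>.\<close>
definition Z_can :: "nat \<Rightarrow> ennreal" where
  "Z_can n =
     (\<integral>\<^sup>+U. (\<integral>\<^sup>+D\<in>PiE {1..n} (\<lambda>_. {0..real n}).
         ennreal ((\<Prod>(i, j)\<in>off_diag n. rho n (D i + U j - U i)) *
           tree_poly n (\<lambda>i j. if i \<noteq> j then omega n (D i + U j - U i) else 0))
       \<partial>PiM {1..n} (\<lambda>_. lborel)) \<partial>H0_measure n)"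

section \<open>The change of variables from \<open>A\<close> to \<open>D\<close>\<close>

definition translation ::
    "nat \<Rightarrow> (nat \<Rightarrow> real) \<times> (nat \<Rightarrow> real) \<Rightarrow> (nat \<Rightarrow> real) \<times> (nat \<Rightarrow> real)" where
  "translation n = (\<lambda>(A, U). (\<lambda>i\<in>{1..n}. A i + U i, U))"

text \<open>
  Coordinates on \<open>\<real>\<^sup>n \<times> H0 n\<close>: position \<open>k < n\<close> holds the \<open>(k+1)\<close>-st entry of the first vector, and
  position \<open>n + k\<close> with \<open>k < n - 1\<close> holds the \<open>(k+1)\<close>-st entry of the second, whose last entry
  is determined by the others.
\<close>
definition from_coords :: "nat \<Rightarrow> (nat \<Rightarrow> real) \<Rightarrow> (nat \<Rightarrow> real) \<times> (nat \<Rightarrow> real)" where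
  "from_coords n x = (\<lambda>i\<in>{1..n}. x (i - 1), H0_param n (\<lambda>i. x (n + i - 1)))"

definition to_coords :: "nat \<Rightarrow> (nat \<Rightarrow> real) \<times> (nat \<Rightarrow> real) \<Rightarrow> nat \<Rightarrow> real" where
  "to_coords n = (\<lambda>(V, U) k. if k < n then V (k + 1) else U (k - n + 1))"

definition jacobian_matrix ::
    "nat \<Rightarrow> ((nat \<Rightarrow> real) \<Rightarrow> nat \<Rightarrow> real) \<Rightarrow> (nat \<Rightarrow> real) \<Rightarrow> real mat" where
  "jacobian_matrix N F x = mat N N (\<lambda>(k, l). deriv (\<lambda>t. F (x(l := t)) k) (x l))"

end

theory Submission
  imports Defs
begin

text \<open>
  Relabelling the columns by the optimal permutation makes the identity optimal, and since relabelling
  preserves the uniform law, each of the \<open>n!\<close> permutations contributes equally. It remains to integrate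
  over the matrices for which the identity is optimal, with a fixed root \<open>r\<close>.

  Such a matrix is classified by its shortest-path tree toward \<open>r\<close>. For every arborescence there is a
  unique potential \<open>q\<close> that vanishes at \<open>r\<close> and makes all tree edges tight; it depends on the
  diagonal and the tree entries only. The arborescence is called strict if every remaining entry
  satisfies \<open>y i j > y i i + q j - q i\<close> (\<open>strict_tree\<close>). Strictness alone forces the identity to be the
  unique optimum and \<open>- q\<close> to be the distance to the root (\<open>strict_tree_certificate\<close>). If the identity is
  optimal, a tree of maximal total potential satisfies the weak inequalities, because a violated one would
  allow an exchange of edges that raises the potential or a cycle that lowers the cost
  (\<open>ex_feasible_tree\<close>). Equality in one of them puts the matrix on the graph of a function of the other
  entries, which is a null set.
  Hence almost surely exactly one permutation and one tree are strict (\<open>AE_ex_strict_tree\<close>,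
  \<open>strict_tree_unique\<close>), and the law of \<open>(D, U)\<close> is a finite sum over trees.

  For one tree the integral is explicit (\<open>nn_integral_strict_tree\<close>). Given diagonal and potential, each
  remaining entry has to exceed its threshold inside the unit interval, which gives the factors \<open>rho\<close>. The
  tree entries are exchanged for the potential by a triangular substitution of constant slope
  (\<open>nn_integral_tree_entries\<close>), and the indicator that they lie in \<open>[0, 1)\<close> is \<open>rho * omega\<close>. The integrand
  depends on potential differences only, so potentials vanishing at \<open>r\<close> may be replaced by vectors of
  sum zero at the cost of a factor \<open>n\<close> that is the same for every root
  (\<open>nn_integral_change_of_transversal\<close>). Summing over trees gives the tree polynomial and averaging
  over the root gives the density; its total mass one determines the partition function. The passage to
  \<open>A\<close> is a translation for fixed \<open>U\<close>, and the minimum formulas are feasibility of the potential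
  together with tightness on the diagonal.
\<close>

section \<open>Changes of variables on finite products of Lebesgue measure\<close>

abbreviation lborel_on :: "'i set \<Rightarrow> ('i \<Rightarrow> real) measure" where
  "lborel_on J \<equiv> PiM J (\<lambda>_. lborel)"

abbreviation cells :: "nat \<Rightarrow> (nat \<times> nat) set" where
  "cells n \<equiv> {1..n} \<times> {1..n}"

lemma product_sigma_finite_lborel: "product_sigma_finite (\<lambda>_. lborel :: real measure)"
  by standard

lemmas nn_integral_lborel_on_insert =
  product_sigma_finite.product_nn_integral_insert[OF product_sigma_finite_lborel]
lemmas nn_integral_lborel_on_insert_rev =
  product_sigma_finite.product_nn_integral_insert_rev[OF product_sigma_finite_lborel]

lemma sigma_finite_lborel_on: "finite J \<Longrightarrow> sigma_finite_measure (lborel_on J)"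
  by (rule product_sigma_finite.sigma_finite[OF product_sigma_finite_lborel])

lemma borel_measurable_lborel_on_component [measurable (raw)]:
  "i \<in> J \<Longrightarrow> (\<lambda>x. x i) \<in> borel_measurable (lborel_on J)"
  using measurable_component_singleton[of i J "\<lambda>_. lborel"] by simp

text \<open>
  The building block of the affine changes of variables: the map is affine in one coordinate once the
  others are frozen, and Fubini separates that coordinate from the rest.
\<close>
lemma nn_integral_substitute_coordinate:
  fixes c :: real
  assumes J: "finite J" "k \<in> J" and c: "c \<noteq> 0"
    and G [measurable]: "G \<in> borel_measurable (lborel_on J)"
    and \<phi> [measurable]: "\<phi> \<in> borel_measurable (lborel_on J)"
    and dep: "\<And>x v. \<phi> (x(k := v)) = \<phi> x"
  shows "(\<integral>\<^sup>+x. G x \<partial>lborel_on J) = ennreal \<bar>c\<bar> * (\<integral>\<^sup>+x. G (x(k := \<phi> x + c * x k)) \<partial>lborel_on J)"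
proof -
  have sub [measurable]: "(\<lambda>x. x(k := \<phi> x + c * x k)) \<in> measurable (lborel_on J) (lborel_on J)"
    using J by (intro measurable_fun_upd[where J=J]) auto
  have upd: "(\<lambda>v. x(k := v)) \<in> measurable borel (lborel_on J)"
    if "x \<in> space (lborel_on (J - {k}))" for x
    using measurable_component_update[OF that, of k] J by (simp add: insert_absorb)
  have "(\<integral>\<^sup>+x. G x \<partial>lborel_on J) = (\<integral>\<^sup>+x. \<integral>\<^sup>+v. G (x(k := v)) \<partial>lborel \<partial>lborel_on (J - {k}))"
    using nn_integral_lborel_on_insert[of "J - {k}" k G] J G by (simp add: insert_absorb)
  also have "\<dots> = (\<integral>\<^sup>+x. \<integral>\<^sup>+v. ennreal \<bar>c\<bar> * G (x(k := \<phi> x + c * v)) \<partial>lborel \<partial>lborel_on (J - {k}))"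
  proof (rule nn_integral_cong)
    fix x assume x: "x \<in> space (lborel_on (J - {k}))"
    note [measurable] = measurable_compose[OF upd[OF x] G]
    show "(\<integral>\<^sup>+v. G (x(k := v)) \<partial>lborel) = (\<integral>\<^sup>+v. ennreal \<bar>c\<bar> * G (x(k := \<phi> x + c * v)) \<partial>lborel)"
      by (subst nn_integral_cmult)
        (auto intro!: nn_integral_real_affine c)
  qed
  also have "\<dots> = (\<integral>\<^sup>+x. ennreal \<bar>c\<bar> * G (x(k := \<phi> x + c * x k)) \<partial>lborel_on J)"
    using nn_integral_lborel_on_insert[of "J - {k}" k "\<lambda>x. ennreal \<bar>c\<bar> * G (x(k := \<phi> x + c * x k))"] J
    by (simp add: insert_absorb dep)
  also have "\<dots> = ennreal \<bar>c\<bar> * (\<integral>\<^sup>+x. G (x(k := \<phi> x + c * x k)) \<partial>lborel_on J)"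
    by (intro nn_integral_cmult) measurable
  finally show ?thesis .
qed

text \<open>
  A rank on the indices makes the map triangular with constant diagonal, and the coordinates may be
  substituted one at a time in order of increasing rank. A coordinate that has already been
  substituted only refers to coordinates of smaller rank, so later steps leave it alone.
\<close>
lemma nn_integral_triangular_affine:
  fixes c :: real and h :: "'i \<Rightarrow> nat"
  assumes J: "finite J" and c: "c \<noteq> 0"
    and G: "G \<in> borel_measurable (lborel_on J)"
    and \<phi> [measurable]: "\<And>i. i \<in> J \<Longrightarrow> \<phi> i \<in> borel_measurable (lborel_on J)"
    and dep: "\<And>i j x v. i \<in> J \<Longrightarrow> j \<in> J \<Longrightarrow> h i \<le> h j \<Longrightarrow> \<phi> i (x(j := v)) = \<phi> i x"
  shows "(\<integral>\<^sup>+x. G x \<partial>lborel_on J) =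
    ennreal (\<bar>c\<bar> ^ card J) * (\<integral>\<^sup>+x. G (\<lambda>i\<in>J. \<phi> i x + c * x i) \<partial>lborel_on J)"
proof -
  define \<Phi> where "\<Phi> K x = (\<lambda>i\<in>J. if i \<in> K then \<phi> i x + c * x i else x i)" for K x
  have meas [measurable]: "\<Phi> K \<in> measurable (lborel_on J) (lborel_on J)" for K
    unfolding \<Phi>_def by (intro measurable_restrict) auto
  have "K \<subseteq> J \<longrightarrow>
      (\<integral>\<^sup>+x. G x \<partial>lborel_on J) = ennreal (\<bar>c\<bar> ^ card K) * (\<integral>\<^sup>+x. G (\<Phi> K x) \<partial>lborel_on J)"
    if "finite K" for K
    using that
  proof (induction rule: finite_ranking_induct[where f = h])
    case empty
    have "\<Phi> {} x = x" if "x \<in> space (lborel_on J)" for x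
      using that by (auto simp: \<Phi>_def space_PiM PiE_iff extensional_def fun_eq_iff)
    then show ?case
      by (auto intro!: nn_integral_cong arg_cong[where f = G])
  next
    case (insert k K)
    show ?case
    proof (cases "k \<in> K")
      case True
      then show ?thesis using insert.IH by (simp add: insert_absorb)
    next
      case False
      show ?thesis
      proof
        assume sub: "insert k K \<subseteq> J"
        note [measurable] = G
        have "(\<integral>\<^sup>+x. G x \<partial>lborel_on J) = ennreal (\<bar>c\<bar> ^ card K) * (\<integral>\<^sup>+x. G (\<Phi> K x) \<partial>lborel_on J)"
          using insert.IH sub by simp
        also have "(\<integral>\<^sup>+x. G (\<Phi> K x) \<partial>lborel_on J)
            = ennreal \<bar>c\<bar> * (\<integral>\<^sup>+x. G (\<Phi> K (x(k := \<phi> k x + c * x k))) \<partial>lborel_on J)"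
        proof (rule nn_integral_substitute_coordinate[OF J _ c])
          show "k \<in> J" using sub by simp
          show "(\<lambda>x. G (\<Phi> K x)) \<in> borel_measurable (lborel_on J)" by measurable
          show "\<phi> k \<in> borel_measurable (lborel_on J)" using sub by (intro \<phi>) simp
          show "\<phi> k (x(k := v)) = \<phi> k x" for x v using sub by (intro dep) simp_all
        qed
        also have "(\<integral>\<^sup>+x. G (\<Phi> K (x(k := \<phi> k x + c * x k))) \<partial>lborel_on J)
            = (\<integral>\<^sup>+x. G (\<Phi> (insert k K) x) \<partial>lborel_on J)"
        proof (intro nn_integral_cong arg_cong[where f = G])
          fix x
          have "\<phi> i (x(k := v)) = \<phi> i x" if "i \<in> K" for i v
            using sub that insert.hyps by (intro dep) auto
          then show "\<Phi> K (x(k := \<phi> k x + c * x k)) = \<Phi> (insert k K) x"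
            using False by (auto simp: \<Phi>_def fun_eq_iff)
        qed
        finally show "(\<integral>\<^sup>+x. G x \<partial>lborel_on J)
            = ennreal (\<bar>c\<bar> ^ card (insert k K)) * (\<integral>\<^sup>+x. G (\<Phi> (insert k K) x) \<partial>lborel_on J)"
          using False \<open>finite K\<close> by (simp add: ennreal_mult mult_ac)
      qed
    qed
  qed
  from this[OF J] show ?thesis
    by (simp add: \<Phi>_def cong: restrict_cong)
qed

lemma nn_integral_lborel_on_affine:
  fixes c :: real
  assumes J: "finite J" and c: "c \<noteq> 0" and G: "G \<in> borel_measurable (lborel_on J)"
  shows "(\<integral>\<^sup>+x. G x \<partial>lborel_on J) =
    ennreal (\<bar>c\<bar> ^ card J) * (\<integral>\<^sup>+x. G (\<lambda>i\<in>J. a i + c * x i) \<partial>lborel_on J)"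
  using assms by (intro nn_integral_triangular_affine[where \<phi> = "\<lambda>i _. a i" and h = "\<lambda>_. 0"]) auto

lemma nn_integral_lborel_on_translate:
  assumes J: "finite J" and G: "G \<in> borel_measurable (lborel_on J)"
  shows "(\<integral>\<^sup>+x. G (\<lambda>i\<in>J. x i + a i) \<partial>lborel_on J) = (\<integral>\<^sup>+x. G x \<partial>lborel_on J)"
  using nn_integral_lborel_on_affine[OF J _ G, of 1 a] by (simp add: add.commute cong: restrict_cong)

lemma distr_lborel_on_reindex:
  assumes fin: "finite K" and f: "bij_betw f K J"
  shows "distr (lborel_on J) (lborel_on K) (\<lambda>x. \<lambda>k\<in>K. x (f k)) = lborel_on K"
proof (rule product_sigma_finite.PiM_eqI[OF product_sigma_finite_lborel fin])
  have finJ: "finite J" using fin f bij_betw_finite by blast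
  have fK: "f k \<in> J" if "k \<in> K" for k using f that by (auto simp: bij_betw_def)
  have [measurable]: "(\<lambda>x. \<lambda>k\<in>K. x (f k)) \<in> measurable (lborel_on J) (lborel_on K)"
    using fK by (intro measurable_restrict) auto
  fix A :: "'a \<Rightarrow> real set" assume A: "\<And>i. i \<in> K \<Longrightarrow> A i \<in> sets lborel"
  let ?g = "the_inv_into K f"
  have g: "?g j \<in> K" "f (?g j) = j" if "j \<in> J" for j
    using f that by (auto simp: bij_betw_def the_inv_into_into f_the_inv_into_f)
  have gf: "?g (f k) = k" if "k \<in> K" for k
    using f that by (auto simp: bij_betw_def the_inv_into_f_f)
  have pre: "(\<lambda>x. \<lambda>k\<in>K. x (f k)) -` (Pi\<^sub>E K A) \<inter> space (lborel_on J) = Pi\<^sub>E J (\<lambda>j. A (?g j))"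
  proof (intro equalityI subsetI)
    fix x assume "x \<in> (\<lambda>x. \<lambda>k\<in>K. x (f k)) -` (Pi\<^sub>E K A) \<inter> space (lborel_on J)"
    then have x: "\<And>k. k \<in> K \<Longrightarrow> x (f k) \<in> A k" "x \<in> extensional J"
      by (auto simp: space_PiM PiE_iff)
    show "x \<in> Pi\<^sub>E J (\<lambda>j. A (?g j))"
      using x(1)[OF g(1)] x(2) g(2) by (auto simp: PiE_iff)
  next
    fix x assume "x \<in> Pi\<^sub>E J (\<lambda>j. A (?g j))"
    then show "x \<in> (\<lambda>x. \<lambda>k\<in>K. x (f k)) -` (Pi\<^sub>E K A) \<inter> space (lborel_on J)"
      using fK gf by (fastforce simp: space_PiM PiE_iff)
  qed
  have "emeasure (distr (lborel_on J) (lborel_on K) (\<lambda>x. \<lambda>k\<in>K. x (f k))) (Pi\<^sub>E K A)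
      = emeasure (lborel_on J) (Pi\<^sub>E J (\<lambda>j. A (?g j)))"
    using A fin by (subst emeasure_distr) (auto simp: pre intro!: sets_PiM_I_finite)
  also have "\<dots> = (\<Prod>j\<in>J. emeasure lborel (A (?g j)))"
    using A g finJ
    by (intro product_sigma_finite.emeasure_PiM[OF product_sigma_finite_lborel]) auto
  also have "\<dots> = (\<Prod>k\<in>K. emeasure lborel (A k))"
    using gf by (subst prod.reindex_bij_betw[OF f, symmetric]) (auto intro!: prod.cong)
  finally show "emeasure (distr (lborel_on J) (lborel_on K) (\<lambda>x. \<lambda>k\<in>K. x (f k))) (Pi\<^sub>E K A)
      = (\<Prod>k\<in>K. emeasure lborel (A k))" .
qed simp

text \<open>
  The graph of a function of the other coordinates is a null set, because each fibre is a point. This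
  is the only source of almost sure uniqueness in the argument.
\<close>
lemma AE_lborel_on_coordinate_neq:
  fixes \<phi> :: "('i \<Rightarrow> real) \<Rightarrow> real"
  assumes J: "finite J" "k \<in> J" and \<phi> [measurable]: "\<phi> \<in> borel_measurable (lborel_on J)"
    and dep: "\<And>x v. \<phi> (x(k := v)) = \<phi> x"
  shows "AE x in lborel_on J. x k \<noteq> \<phi> x"
proof -
  have M: "{x \<in> space (lborel_on J). x k = \<phi> x} \<in> sets (lborel_on J)"
    by (intro borel_measurable_eq \<phi> borel_measurable_lborel_on_component J)
  have "(\<integral>\<^sup>+x. indicator {x \<in> space (lborel_on J). x k = \<phi> x} x \<partial>lborel_on J)
     = (\<integral>\<^sup>+x. \<integral>\<^sup>+v. indicator {x \<in> space (lborel_on J). x k = \<phi> x} (x(k := v)) \<partial>lborel \<partial>lborel_on (J - {k}))"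
    using nn_integral_lborel_on_insert[of "J - {k}" k "indicator {x \<in> space (lborel_on J). x k = \<phi> x}"] J M
    by (simp add: insert_absorb)
  also have "\<dots> = (\<integral>\<^sup>+x. \<integral>\<^sup>+v. indicator {\<phi> x} v \<partial>lborel \<partial>lborel_on (J - {k}))"
  proof (intro nn_integral_cong)
    fix x v assume "x \<in> space (lborel_on (J - {k}))"
    then have "x(k := v) \<in> space (lborel_on J)"
      using J by (auto simp: space_PiM PiE_iff extensional_def)
    then show "indicator {x \<in> space (lborel_on J). x k = \<phi> x} (x(k := v)) = (indicator {\<phi> x} v :: ennreal)"
      by (simp add: indicator_def dep)
  qed
  also have "\<dots> = 0" by simp
  finally have "emeasure (lborel_on J) {x \<in> space (lborel_on J). x k = \<phi> x} = 0"
    using M by simp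
  then show ?thesis
    using M by (subst AE_iff_measurable[OF _ refl]) auto
qed


section \<open>The reference measure on vectors of sum zero\<close>

lemma sum_H0_param: "(\<Sum>i\<in>{1..n}. H0_param n u i) = 0" if "n \<ge> 1"
proof -
  have "{1..n} = insert n {1..<n}" using that by auto
  then show ?thesis by (simp add: H0_param_def)
qed

lemma measurable_H0_param:
  "H0_param n \<in> measurable (lborel_on {1..<n}) (restrict_space (PiM {1..n} (\<lambda>_. borel)) (H0 n))"
  if n: "n \<ge> 1"
proof (rule measurable_restrict_space2)
  show "H0_param n \<in> space (lborel_on {1..<n}) \<rightarrow> H0 n"
    using sum_H0_param[OF n] by (auto simp: H0_def H0_param_def)
  show "H0_param n \<in> measurable (lborel_on {1..<n}) (PiM {1..n} (\<lambda>_. borel))"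
    unfolding H0_param_def
  proof (rule measurable_restrict)
    fix i assume "i \<in> {1..n}"
    then show "(\<lambda>u. if i < n then u i else - (\<Sum>k\<in>{1..<n}. u k)) \<in> borel_measurable (lborel_on {1..<n})"
      by (cases "i < n") (simp, simp only: if_False, measurable)
  qed
qed

lemma space_H0_measure: "space (H0_measure n) = H0 n"
  by (auto simp: H0_measure_def space_restrict_space space_PiM H0_def)

lemma sets_H0_measure [measurable_cong]:
  "sets (H0_measure n) = sets (restrict_space (PiM {1..n} (\<lambda>_. borel)) (H0 n))"
  by (simp add: H0_measure_def)

lemma measurable_H0_measure_embed:
  "F \<in> measurable (PiM {1..n} (\<lambda>_. borel)) N \<Longrightarrow> F \<in> measurable (H0_measure n) N"
  unfolding H0_measure_def by (simp add: measurable_restrict_space1)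

lemma nn_integral_H0_measure:
  assumes "n \<ge> 1" and "F \<in> borel_measurable (PiM {1..n} (\<lambda>_. borel))"
  shows "(\<integral>\<^sup>+U. F U \<partial>H0_measure n) = (\<integral>\<^sup>+u. F (H0_param n u) \<partial>lborel_on {1..<n})"
  unfolding H0_measure_def
  using assms by (subst nn_integral_distr[OF measurable_H0_param]) (simp_all add: measurable_restrict_space1)

text \<open>
  Restriction to the first \<open>n - 1\<close> coordinates inverts the parametrization and pushes the reference
  measure to a sigma-finite one.
\<close>
lemma sigma_finite_H0_measure:
  assumes n: "n \<ge> 1"
  shows "sigma_finite_measure (H0_measure n)"
proof (rule sigma_finite_measure_distr)
  let ?r = "\<lambda>U::nat \<Rightarrow> real. \<lambda>i\<in>{1..<n}. U i"
  have "?r \<in> measurable (PiM {1..n} (\<lambda>_. borel)) (lborel_on {1..<n})"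
  proof (intro measurable_restrict)
    fix i assume "i \<in> {1..<n}"
    then have "(\<lambda>x. x i) \<in> measurable (PiM {1..n} (\<lambda>_. borel :: real measure)) borel"
      by (intro measurable_component_singleton) auto
    then show "(\<lambda>x. x i) \<in> measurable (PiM {1..n} (\<lambda>_. borel :: real measure)) lborel" by simp
  qed
  then show r: "?r \<in> measurable (H0_measure n) (lborel_on {1..<n})"
    by (rule measurable_H0_measure_embed)
  have "distr (H0_measure n) (lborel_on {1..<n}) ?r
      = distr (lborel_on {1..<n}) (lborel_on {1..<n}) (\<lambda>u. ?r (H0_param n u))"
    using measurable_H0_param[OF n] r unfolding H0_measure_def by (subst distr_distr) (auto simp: comp_def)
  also have "\<dots> = distr (lborel_on {1..<n}) (lborel_on {1..<n}) (\<lambda>u. u)"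
    by (intro distr_cong) (auto simp: H0_param_def space_PiM PiE_iff extensional_def fun_eq_iff)
  also have "\<dots> = lborel_on {1..<n}" by (simp add: distr_id2)
  finally show "sigma_finite_measure (distr (H0_measure n) (lborel_on {1..<n}) ?r)"
    using sigma_finite_lborel_on by auto
qed

text \<open>
  A shift-invariant \<open>F\<close> is a function on the quotient by constant vectors, and both sides integrate
  it over a transversal of the quotient: the vectors vanishing at \<open>r\<close>, respectively those of sum
  zero. Both integrals are compared with the integral of \<open>F\<close> over all vectors whose sum lies in
  \<open>[0, 1]\<close>. Splitting off the coordinate \<open>r\<close> and shifting by it turns the sum into \<open>n s + \<dots>\<close>, which
  costs the factor \<open>1 / n\<close>; splitting off the sum itself costs nothing.
\<close>
lemma nn_integral_change_of_transversal:
  fixes F :: "(nat \<Rightarrow> real) \<Rightarrow> ennreal"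
  assumes n: "n \<ge> 1" and r: "r \<in> {1..n}"
    and F [measurable]: "F \<in> borel_measurable (lborel_on {1..n})"
    and shift: "\<And>x s. F (\<lambda>i\<in>{1..n}. x i + s) = F (\<lambda>i\<in>{1..n}. x i)"
  shows "(\<integral>\<^sup>+z. F (z(r := 0)) \<partial>lborel_on ({1..n} - {r})) = ennreal (real n) * (\<integral>\<^sup>+U. F U \<partial>H0_measure n)"
proof -
  \<comment> \<open>any weight of total mass one would do\<close>
  define h :: "real \<Rightarrow> ennreal" where "h = indicator {0..1}"
  have h_meas [measurable]: "h \<in> borel_measurable borel" by (simp add: h_def)
  have h_int: "(\<integral>\<^sup>+s. h s \<partial>lborel) = 1" by (simp add: h_def)
  define W where "W = (\<integral>\<^sup>+x. F x * h (\<Sum>i\<in>{1..n}. x i) \<partial>lborel_on {1..n})"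
  have integrand [measurable]: "(\<lambda>x. F x * h (\<Sum>i\<in>{1..n}. x i)) \<in> borel_measurable (lborel_on {1..n})"
    by measurable
  have shift': "F x = F y" if "x \<in> extensional {1..n}" "y \<in> extensional {1..n}"
    "\<And>i. i \<in> {1..n} \<Longrightarrow> x i = y i + s" for x y s
  proof -
    have "x = (\<lambda>i\<in>{1..n}. y i + s)" using that by (auto simp: extensional_def fun_eq_iff)
    moreover have "y = (\<lambda>i\<in>{1..n}. y i)" using that by (auto simp: extensional_def fun_eq_iff)
    ultimately show ?thesis using shift[of y s] by simp
  qed
  have psf: "pair_sigma_finite (lborel_on K) lborel" if "finite K" for K :: "nat set"
    using sigma_finite_lborel_on[OF that]
    by (simp add: pair_sigma_finite_def sigma_finite_lborel)

  have "ennreal (real n) * W = (\<integral>\<^sup>+z. F (z(r := 0)) \<partial>lborel_on ({1..n} - {r}))"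
  proof -
    let ?J = "{1..n} - {r}"
    have ins: "insert r ?J = {1..n}" using r by auto
    have upd: "(\<lambda>z. z(r := c)) \<in> measurable (lborel_on ?J) (lborel_on {1..n})" for c
      using r by (intro measurable_fun_upd[where J = ?J]) auto
    note [measurable] = measurable_compose[OF upd[of 0] F]
    have "W = (\<integral>\<^sup>+y. \<integral>\<^sup>+z. F (z(r := y)) * h (\<Sum>i\<in>{1..n}. (z(r := y)) i) \<partial>lborel_on ?J \<partial>lborel)"
      unfolding W_def
      using nn_integral_lborel_on_insert_rev[of ?J r "\<lambda>x. F x * h (\<Sum>i\<in>{1..n}. x i)"] integrand
      unfolding ins by simp
    also have "\<dots> = (\<integral>\<^sup>+y. \<integral>\<^sup>+z. F (z(r := 0)) * h ((\<Sum>i\<in>?J. z i) + real n * y) \<partial>lborel_on ?J \<partial>lborel)"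
    proof (rule nn_integral_cong)
      fix y :: real
      let ?G = "\<lambda>z. F (z(r := y)) * h (\<Sum>i\<in>{1..n}. (z(r := y)) i)"
      have "?G \<in> borel_measurable (lborel_on ?J)"
        using measurable_compose[OF upd integrand] by simp
      then have "(\<integral>\<^sup>+z. ?G z \<partial>lborel_on ?J) = (\<integral>\<^sup>+z. ?G (\<lambda>i\<in>?J. z i + y) \<partial>lborel_on ?J)"
        by (intro nn_integral_lborel_on_translate[symmetric]) auto
      also have "\<dots> = (\<integral>\<^sup>+z. F (z(r := 0)) * h ((\<Sum>i\<in>?J. z i) + real n * y) \<partial>lborel_on ?J)"
      proof (intro nn_integral_cong arg_cong2[where f = "(*)"] arg_cong[where f = h])
        fix z assume z: "z \<in> space (lborel_on ?J)"
        show "F ((\<lambda>i\<in>?J. z i + y)(r := y)) = F (z(r := 0))"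
          using z r by (intro shift'[where s = y]) (auto simp: space_PiM PiE_iff extensional_def)
        have "(\<Sum>i\<in>{1..n}. ((\<lambda>i\<in>?J. z i + y)(r := y)) i) = y + (\<Sum>i\<in>?J. z i + y)"
          by (subst ins[symmetric], subst sum.insert) (auto intro!: sum.cong)
        also have "\<dots> = (\<Sum>i\<in>?J. z i) + real n * y"
          using n r by (simp add: sum.distrib of_nat_diff algebra_simps)
        finally show "(\<Sum>i\<in>{1..n}. ((\<lambda>i\<in>?J. z i + y)(r := y)) i) = (\<Sum>i\<in>?J. z i) + real n * y" .
      qed
      finally show "(\<integral>\<^sup>+z. ?G z \<partial>lborel_on ?J)
        = (\<integral>\<^sup>+z. F (z(r := 0)) * h ((\<Sum>i\<in>?J. z i) + real n * y) \<partial>lborel_on ?J)" .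
    qed
    also have "\<dots> = (\<integral>\<^sup>+z. \<integral>\<^sup>+y. F (z(r := 0)) * h ((\<Sum>i\<in>?J. z i) + real n * y) \<partial>lborel \<partial>lborel_on ?J)"
      by (rule pair_sigma_finite.Fubini'[OF psf]) (simp, measurable)
    also have "\<dots> = (\<integral>\<^sup>+z. F (z(r := 0)) * (\<integral>\<^sup>+y. h ((\<Sum>i\<in>?J. z i) + real n * y) \<partial>lborel) \<partial>lborel_on ?J)"
      by (intro nn_integral_cong nn_integral_cmult) measurable
    finally have W: "W = \<dots>" .
    have "ennreal (real n) * (\<integral>\<^sup>+y. h (t + real n * y) \<partial>lborel) = 1" for t
      using nn_integral_real_affine[OF h_meas, of "real n" t] n h_int by simp
    note scale = this
    have m: "(\<lambda>z. F (z(r := 0)) * (\<integral>\<^sup>+y. h ((\<Sum>i\<in>?J. z i) + real n * y) \<partial>lborel))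
        \<in> borel_measurable (lborel_on ?J)" by measurable
    show ?thesis
      unfolding W nn_integral_cmult[OF m, symmetric]
      by (intro nn_integral_cong) (subst mult.left_commute, subst scale, rule mult_1_right)
  qed
  moreover have "W = (\<integral>\<^sup>+U. F U \<partial>H0_measure n)"
  proof -
    let ?J = "{1..<n}"
    have ins: "insert n ?J = {1..n}" using n by auto
    have upd2: "(\<lambda>(z, y). z(n := y)) \<in> measurable (lborel_on ?J \<Otimes>\<^sub>M lborel) (lborel_on {1..n})"
      using measurable_add_dim[of n ?J "\<lambda>_. lborel :: real measure"] by (simp only: ins)
    have last: "(\<lambda>(z, y). F (z(n := y - (\<Sum>i\<in>?J. z i))))
        \<in> borel_measurable (lborel_on ?J \<Otimes>\<^sub>M lborel)"
    proof -
      have "(\<lambda>(z, y). (z, y - (\<Sum>i\<in>?J. z i)))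
          \<in> measurable (lborel_on ?J \<Otimes>\<^sub>M lborel) (lborel_on ?J \<Otimes>\<^sub>M lborel)" by measurable
      from measurable_compose[OF measurable_compose[OF this upd2] F]
      show ?thesis by (simp add: case_prod_unfold)
    qed
    have "W = (\<integral>\<^sup>+z. \<integral>\<^sup>+y. F (z(n := y)) * h (\<Sum>i\<in>{1..n}. (z(n := y)) i) \<partial>lborel \<partial>lborel_on ?J)"
      unfolding W_def
      using nn_integral_lborel_on_insert[of ?J n "\<lambda>x. F x * h (\<Sum>i\<in>{1..n}. x i)"] integrand
      unfolding ins by simp
    also have "\<dots> = (\<integral>\<^sup>+z. \<integral>\<^sup>+y. h y * F (z(n := y - (\<Sum>i\<in>?J. z i))) \<partial>lborel \<partial>lborel_on ?J)"
    proof (rule nn_integral_cong)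
      fix z assume z: "z \<in> space (lborel_on ?J)"
      have sum: "(\<Sum>i\<in>{1..n}. (z(n := y)) i) = (\<Sum>i\<in>?J. z i) + y" for y
        by (subst ins[symmetric], subst sum.insert) (auto intro!: sum.cong)
      have "(\<lambda>y. z(n := y)) \<in> measurable lborel (lborel_on {1..n})"
        using measurable_component_update[OF z, of n] unfolding ins by simp
      note [measurable] = measurable_compose[OF this F, simplified]
      show "(\<integral>\<^sup>+y. F (z(n := y)) * h (\<Sum>i\<in>{1..n}. (z(n := y)) i) \<partial>lborel)
        = (\<integral>\<^sup>+y. h y * F (z(n := y - (\<Sum>i\<in>?J. z i))) \<partial>lborel)"
        unfolding sum
        by (subst nn_integral_real_affine[where c = 1 and t = "- (\<Sum>i\<in>?J. z i)"])
          (auto simp: mult.commute intro!: nn_integral_cong arg_cong2[where f = "(*)"])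
    qed
    also have "\<dots> = (\<integral>\<^sup>+y. \<integral>\<^sup>+z. h y * F (z(n := y - (\<Sum>i\<in>?J. z i))) \<partial>lborel_on ?J \<partial>lborel)"
    proof (rule pair_sigma_finite.Fubini'[OF psf, symmetric])
      have "(\<lambda>w. h (snd w) * (\<lambda>(z, y). F (z(n := y - (\<Sum>i\<in>?J. z i)))) w)
          \<in> borel_measurable (lborel_on ?J \<Otimes>\<^sub>M lborel)"
        by (intro borel_measurable_times_ennreal last measurable_compose[OF _ h_meas]) simp
      then show "(\<lambda>(z, y). h y * F (z(n := y - (\<Sum>i\<in>?J. z i))))
          \<in> borel_measurable (lborel_on ?J \<Otimes>\<^sub>M lborel)"
        by (simp add: case_prod_unfold)
    qed simp
    also have "\<dots> = (\<integral>\<^sup>+y. h y * (\<integral>\<^sup>+z. F (H0_param n z) \<partial>lborel_on ?J) \<partial>lborel)"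
    proof (rule nn_integral_cong)
      fix y :: real
      let ?G = "\<lambda>z. F (z(n := y - (\<Sum>i\<in>?J. z i)))"
      have G: "?G \<in> borel_measurable (lborel_on ?J)"
        using measurable_compose[OF measurable_Pair2'[of y lborel "lborel_on ?J"] last] by simp
      have "(\<integral>\<^sup>+z. h y * ?G z \<partial>lborel_on ?J) = h y * (\<integral>\<^sup>+z. ?G z \<partial>lborel_on ?J)"
        using G by (rule nn_integral_cmult)
      also have "(\<integral>\<^sup>+z. ?G z \<partial>lborel_on ?J) = (\<integral>\<^sup>+z. ?G (\<lambda>i\<in>?J. z i + y / real n) \<partial>lborel_on ?J)"
        using G by (intro nn_integral_lborel_on_translate[symmetric]) auto
      also have "\<dots> = (\<integral>\<^sup>+z. F (H0_param n z) \<partial>lborel_on ?J)"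
      proof (intro nn_integral_cong shift'[where s = "y / real n"])
        fix z i assume "z \<in> space (lborel_on ?J)" and i: "i \<in> {1..n}"
        have "(\<Sum>i\<in>?J. (\<lambda>i\<in>?J. z i + y / real n) i) = (\<Sum>i\<in>?J. z i) + (real n - 1) * (y / real n)"
          using n by (simp add: sum.distrib of_nat_diff)
        moreover have "(real n - 1) * (y / real n) = y - y / real n"
          using n by (simp add: field_simps)
        ultimately show "((\<lambda>i\<in>?J. z i + y / real n)(n := y - (\<Sum>i\<in>?J. (\<lambda>i\<in>?J. z i + y / real n) i))) i
            = H0_param n z i + y / real n"
          using i by (auto simp: H0_param_def)
      qed (use n in \<open>auto simp: H0_param_def extensional_def\<close>)
      finally show "(\<integral>\<^sup>+z. h y * ?G z \<partial>lborel_on ?J) = h y * (\<integral>\<^sup>+z. F (H0_param n z) \<partial>lborel_on ?J)" .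
    qed
    also have "\<dots> = (\<integral>\<^sup>+z. F (H0_param n z) \<partial>lborel_on ?J)"
      by (subst nn_integral_multc) (simp_all add: h_int)
    also have "\<dots> = (\<integral>\<^sup>+U. F U \<partial>H0_measure n)"
      using F by (subst nn_integral_H0_measure[OF n]) (simp_all cong: measurable_cong_sets sets_PiM_cong)
    finally show ?thesis .
  qed
  ultimately show ?thesis by simp
qed

section \<open>Arborescences as parent maps\<close>

text \<open>
  An arborescence toward \<open>r\<close> is stored as the map sending a vertex to the head of its outgoing edge. The
  root is made a fixed point so that tree paths are orbits of the map.
\<close>
definition parent_maps :: "nat \<Rightarrow> nat \<Rightarrow> (nat \<Rightarrow> nat) set" where
  "parent_maps n r = {p \<in> {1..n} \<rightarrow>\<^sub>E {1..n}. p r = r \<and> (\<forall>i\<in>{1..n}. \<exists>k. (p ^^ k) i = r)}"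

lemma parent_mapsD:
  assumes "p \<in> parent_maps n r"
  shows "p r = r" "i \<in> {1..n} \<Longrightarrow> p i \<in> {1..n}" "i \<notin> {1..n} \<Longrightarrow> p i = undefined"
    "i \<in> {1..n} \<Longrightarrow> \<exists>k. (p ^^ k) i = r"
  using assms by (auto simp: parent_maps_def PiE_iff extensional_def)

lemma finite_parent_maps: "finite (parent_maps n r)"
  by (rule finite_subset[OF _ finite_PiE[of "{1..n}" "\<lambda>_. {1..n}"]]) (auto simp: parent_maps_def)

lemma parent_maps_nonempty:
  assumes "r \<in> {1..n}"
  shows "parent_maps n r \<noteq> {}"
proof -
  have "(\<lambda>i\<in>{1..n}. r) \<in> parent_maps n r"
    using assms by (auto simp: parent_maps_def intro!: exI[of _ "Suc 0"])
  then show ?thesis by blast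
qed

lemma parent_induct [consumes 2, case_names root step]:
  assumes p: "p \<in> parent_maps n r" and i: "i \<in> {1..n}"
    and root: "P r"
    and step: "\<And>i. i \<in> {1..n} \<Longrightarrow> i \<noteq> r \<Longrightarrow> P (p i) \<Longrightarrow> P i"
  shows "P i"
proof -
  have "i \<in> {1..n} \<Longrightarrow> (p ^^ k) i = r \<Longrightarrow> P i" for k
  proof (induction k arbitrary: i)
    case 0
    then show ?case using root by simp
  next
    case (Suc k)
    show ?case
    proof (cases "i = r")
      case False
      have "(p ^^ k) (p i) = r" using Suc.prems(2) by (simp add: funpow_swap1)
      then show ?thesis
        using Suc.IH[of "p i"] parent_mapsD(2)[OF p] Suc.prems(1) False step by blast
    qed (use root in simp)
  qed
  then show ?thesis using parent_mapsD(4)[OF p i] i by blast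
qed

text \<open>
  The number of steps to the root. It orders the triangular substitution along a tree and shows that
  tree paths do not repeat vertices.
\<close>
lemma parent_rank:
  assumes p: "p \<in> parent_maps n r"
  obtains h :: "nat \<Rightarrow> nat" where "\<And>i. i \<in> {1..n} \<Longrightarrow> i \<noteq> r \<Longrightarrow> h (p i) < h i"
proof
  fix i assume i: "i \<in> {1..n}" "i \<noteq> r"
  define h where "h i = (LEAST k. (p ^^ k) i = r)" for i
  have h: "(p ^^ h i) i = r"
    unfolding h_def using parent_mapsD(4)[OF p i(1)] by (rule LeastI_ex)
  then obtain k where k: "h i = Suc k" using i by (cases "h i") auto
  then have "(p ^^ k) (p i) = r" using h by (simp add: funpow_swap1)
  then have "h (p i) \<le> k" unfolding h_def by (rule Least_le)
  then show "(LEAST k. (p ^^ k) (p i) = r) < (LEAST k. (p ^^ k) i = r)"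
    using k by (simp add: h_def)
qed

lemma parent_neq:
  assumes "p \<in> parent_maps n r" "i \<in> {1..n}" "i \<noteq> r"
  shows "p i \<noteq> i"
  using parent_rank[OF assms(1)] assms(2,3) by (metis less_irrefl)

lemma funpow_parent_root: "p \<in> parent_maps n r \<Longrightarrow> (p ^^ k) r = r"
  by (induction k) (auto simp: parent_mapsD(1))

lemma ex_common_height:
  assumes p: "p \<in> parent_maps n r"
  shows "\<exists>N. \<forall>i\<in>{1..n}. (p ^^ N) i = r"
proof -
  obtain k where k: "\<And>i. i \<in> {1..n} \<Longrightarrow> (p ^^ k i) i = r"
    using parent_mapsD(4)[OF p] by metis
  define N where "N = (\<Sum>i\<in>{1..n}. k i)"
  have "(p ^^ N) i = r" if i: "i \<in> {1..n}" for i
  proof -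
    have "k i \<le> N" unfolding N_def using i by (intro member_le_sum) auto
    then have "N = (N - k i) + k i" by simp
    then have "(p ^^ N) i = (p ^^ (N - k i)) ((p ^^ k i) i)" by (metis comp_apply funpow_add)
    then show ?thesis using k[OF i] funpow_parent_root[OF p] by simp
  qed
  then show ?thesis by blast
qed

lemma bij_betw_parent_maps_in_arborescences:
  assumes r: "r \<in> {1..n}"
  shows "bij_betw (\<lambda>p. (\<lambda>i. (i, p i)) ` ({1..n} - {r})) (parent_maps n r) (in_arborescences n r)"
    (is "bij_betw ?G _ _")
proof (rule bij_betw_imageI)
  show "inj_on ?G (parent_maps n r)"
  proof (rule inj_onI, rule ext)
    fix p q i assume p: "p \<in> parent_maps n r" and q: "q \<in> parent_maps n r" and eq: "?G p = ?G q"
    consider "i \<in> {1..n} - {r}" | "i = r" | "i \<notin> {1..n}" by blast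
    then show "p i = q i"
    proof cases
      case 1
      then have "(i, p i) \<in> ?G q" unfolding eq[symmetric] by blast
      then show ?thesis by auto
    qed (use parent_mapsD[OF p] parent_mapsD[OF q] in auto)
  qed
  show "?G ` parent_maps n r = in_arborescences n r"
  proof (intro equalityI subsetI)
    fix T assume "T \<in> ?G ` parent_maps n r"
    then obtain p where p: "p \<in> parent_maps n r" and T: "T = ?G p" by blast
    have "(i, r) \<in> T\<^sup>*" if "i \<in> {1..n}" for i
      using p that
    proof (induction rule: parent_induct)
      case (step i)
      then have "(i, p i) \<in> T" by (auto simp: T)
      then show ?case using step.IH by (rule converse_rtrancl_into_rtrancl)
    qed simp
    then show "T \<in> in_arborescences n r"
      using parent_mapsD(2)[OF p] by (auto simp: in_arborescences_def T)
  next
    fix T assume "T \<in> in_arborescences n r"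
    then have T: "T \<subseteq> cells n" "\<And>i. i \<in> {1..n} - {r} \<Longrightarrow> \<exists>!j. (i, j) \<in> T"
        "\<And>j. (r, j) \<notin> T" "\<And>i. i \<in> {1..n} \<Longrightarrow> (i, r) \<in> T\<^sup>*"
      by (auto simp: in_arborescences_def)
    define p where "p = (\<lambda>i\<in>{1..n}. if i = r then r else THE j. (i, j) \<in> T)"
    have p_edge: "(i, p i) \<in> T" if "i \<in> {1..n} - {r}" for i
      using theI'[OF T(2)[OF that]] that by (simp add: p_def)
    have p_unique: "j = p i" if "(i, j) \<in> T" for i j
    proof -
      have "i \<in> {1..n} - {r}" using that T(1,3) by auto
      then show ?thesis using T(2) p_edge that by blast
    qed
    have "\<exists>k. (p ^^ k) i = r" if "i \<in> {1..n}" for i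
      using T(4)[OF that]
    proof (induction rule: converse_rtrancl_induct)
      case base
      show ?case by (rule exI[of _ 0]) simp
    next
      case (step i j)
      then obtain k where "(p ^^ k) j = r" by blast
      then have "(p ^^ Suc k) i = r" using p_unique[OF step.hyps(1)] by (simp add: funpow_swap1)
      then show ?case by blast
    qed
    moreover have "p i \<in> {1..n}" if "i \<in> {1..n}" for i
      using p_edge[of i] T(1) that r by (cases "i = r") (auto simp: p_def)
    ultimately have "p \<in> parent_maps n r"
      using r by (auto simp: parent_maps_def PiE_iff p_def extensional_def)
    moreover have "T = ?G p"
    proof (intro equalityI subsetI)
      fix e assume e: "e \<in> T"
      obtain i j where ij: "e = (i, j)" by fastforce
      then have "i \<in> {1..n} - {r}" using e T(1,3) by auto
      then show "e \<in> ?G p" using p_unique[of i j] e ij by blast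
    qed (use p_edge in blast)
    ultimately show "T \<in> ?G ` parent_maps n r" by blast
  qed
qed

lemma tree_poly_at_parent_maps:
  assumes "r \<in> {1..n}"
  shows "tree_poly_at n r z = (\<Sum>p\<in>parent_maps n r. \<Prod>i\<in>{1..n} - {r}. z i (p i))"
  unfolding tree_poly_at_def
  by (subst sum.reindex_bij_betw[OF bij_betw_parent_maps_in_arborescences[OF assms], symmetric])
    (auto intro!: sum.cong simp: prod.reindex inj_on_def)

section \<open>Tree potentials and optimality\<close>

definition tree_height :: "nat \<Rightarrow> nat \<Rightarrow> (nat \<Rightarrow> nat) \<Rightarrow> nat" where
  "tree_height n r p = (LEAST N. \<forall>i\<in>{1..n}. (p ^^ N) i = r)"

text \<open>
  The potential that makes every tree edge tight and vanishes at the root. A vertex that has reached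
  the root stays there at no cost, so all tree paths may be followed for the same number of steps.
\<close>
definition tree_potential ::
    "nat \<Rightarrow> nat \<Rightarrow> (nat \<Rightarrow> nat) \<Rightarrow> (nat \<Rightarrow> nat \<Rightarrow> real) \<Rightarrow> nat \<Rightarrow> real" where
  "tree_potential n r p y i =
     (\<Sum>k<tree_height n r p. y ((p ^^ k) i) ((p ^^ k) i) - y ((p ^^ k) i) ((p ^^ Suc k) i))"

lemma tree_potential_root: "p \<in> parent_maps n r \<Longrightarrow> tree_potential n r p y r = 0"
  using funpow_parent_root[of p n r] by (simp add: tree_potential_def parent_mapsD(1) del: funpow.simps)

lemma tree_potential_step:
  assumes p: "p \<in> parent_maps n r" and i: "i \<in> {1..n}"
  shows "tree_potential n r p y i = y i i - y i (p i) + tree_potential n r p y (p i)"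
proof -
  define a where "a v = y v v - y v (p v)" for v
  let ?N = "tree_height n r p"
  have N: "(p ^^ ?N) i = r"
    unfolding tree_height_def using LeastI_ex[OF ex_common_height[OF p]] i by blast
  have pot: "tree_potential n r p y j = (\<Sum>k<?N. a ((p ^^ k) j))" for j
    by (simp add: tree_potential_def a_def)
  have "tree_potential n r p y i + a ((p ^^ ?N) i) = (\<Sum>k<Suc ?N. a ((p ^^ k) i))"
    by (simp add: pot)
  also have "\<dots> = a i + (\<Sum>k<?N. a ((p ^^ Suc k) i))"
    by (subst sum.lessThan_Suc_shift) simp
  also have "(\<Sum>k<?N. a ((p ^^ Suc k) i)) = tree_potential n r p y (p i)"
    by (simp add: pot funpow_swap1)
  finally show ?thesis using N by (simp add: a_def parent_mapsD(1)[OF p])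
qed

lemma tree_potential_unique:
  assumes p: "p \<in> parent_maps n r" and "q r = 0"
    and step: "\<And>i. i \<in> {1..n} \<Longrightarrow> i \<noteq> r \<Longrightarrow> q i = y i i - y i (p i) + q (p i)"
    and i: "i \<in> {1..n}"
  shows "q i = tree_potential n r p y i"
  using p i
proof (induction rule: parent_induct)
  case root
  show ?case using assms(2) tree_potential_root[OF p] by simp
next
  case (step i)
  then show ?case using assms(3)[of i] tree_potential_step[OF p, of i y] by simp
qed

text \<open>
  Feasibility in the dual of the assignment problem, where tightness on the diagonal has been used to
  eliminate the row variables.
\<close>
definition feasible :: "nat \<Rightarrow> (nat \<Rightarrow> real) \<Rightarrow> (nat \<Rightarrow> nat \<Rightarrow> real) \<Rightarrow> bool" where
  "feasible n q y \<longleftrightarrow> (\<forall>i\<in>{1..n}. \<forall>j\<in>{1..n}. q j - q i \<le> y i j - y i i)"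

text \<open>
  The only tight entries are those of the diagonal and the tree. Once an optimal permutation has become
  the identity this holds almost surely for the shortest-path tree, and it identifies both the optimal
  permutation and the tree.
\<close>
definition strict_tree :: "nat \<Rightarrow> nat \<Rightarrow> (nat \<Rightarrow> nat) \<Rightarrow> (nat \<Rightarrow> nat \<Rightarrow> real) \<Rightarrow> bool" where
  "strict_tree n r p y \<longleftrightarrow> (\<forall>i\<in>{1..n}. \<forall>j\<in>{1..n}. j \<noteq> i \<longrightarrow> j \<noteq> p i \<longrightarrow>
     tree_potential n r p y j - tree_potential n r p y i < y i j - y i i)"

lemma strict_tree_feasible:
  assumes p: "p \<in> parent_maps n r" and s: "strict_tree n r p y"
  shows "feasible n (tree_potential n r p y) y"
  unfolding feasible_def
proof (intro ballI)
  fix i j assume ij: "i \<in> {1..n}" "j \<in> {1..n}"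
  consider "j = i" | "j = p i" | "j \<noteq> i" "j \<noteq> p i" by blast
  then show "tree_potential n r p y j - tree_potential n r p y i \<le> y i j - y i i"
  proof cases
    case 2
    then show ?thesis using tree_potential_step[OF p ij(1), of y] by simp
  next
    case 3
    then show ?thesis using s ij by (auto simp: strict_tree_def less_imp_le)
  qed simp
qed

text \<open>Summed over a permutation, the potential differences cancel.\<close>
lemma perm_cost_reduced:
  assumes "\<sigma> permutes {1..n}"
  shows "perm_cost n y \<sigma> = perm_cost n y id + (\<Sum>i\<in>{1..n}. y i (\<sigma> i) - y i i - (q (\<sigma> i) - q i))"
  using sum.permute[OF assms, of q]
  by (simp add: perm_cost_def sum_subtractf comp_def)

text \<open>
  A permutation that costs no more than the identity uses only tight edges, which are fixed points and
  tree edges. Going up the tree from the root, every vertex is then seen to be fixed: a vertex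
  cannot be mapped to its parent, because the parent is its own preimage.
\<close>
lemma strict_tree_unique_optimum:
  assumes p: "p \<in> parent_maps n r" and s: "strict_tree n r p y"
    and \<sigma>: "\<sigma> permutes {1..n}" and le: "perm_cost n y \<sigma> \<le> perm_cost n y id"
  shows "\<sigma> = id"
proof -
  let ?q = "tree_potential n r p y"
  let ?t = "\<lambda>i. y i (\<sigma> i) - y i i - (?q (\<sigma> i) - ?q i)"
  have \<sigma>_in: "\<sigma> i \<in> {1..n}" if "i \<in> {1..n}" for i using permutes_in_image[OF \<sigma>] that by blast
  have nonneg: "?t i \<ge> 0" if "i \<in> {1..n}" for i
    using strict_tree_feasible[OF p s] that \<sigma>_in[OF that] by (auto simp: feasible_def)
  have "(\<Sum>i\<in>{1..n}. ?t i) \<le> 0" using perm_cost_reduced[OF \<sigma>, of y ?q] le by simp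
  moreover have "0 \<le> (\<Sum>i\<in>{1..n}. ?t i)" by (rule sum_nonneg) (rule nonneg)
  ultimately have "(\<Sum>i\<in>{1..n}. ?t i) = 0" by (rule order_antisym)
  then have tight: "?t i = 0" if "i \<in> {1..n}" for i
    using sum_nonneg_0[of "{1..n}" ?t i] nonneg that by blast
  have edge: "\<sigma> i = i \<or> \<sigma> i = p i" if "i \<in> {1..n}" for i
  proof (rule ccontr)
    assume "\<not> (\<sigma> i = i \<or> \<sigma> i = p i)"
    then have "?q (\<sigma> i) - ?q i < y i (\<sigma> i) - y i i"
      using s that \<sigma>_in[OF that] unfolding strict_tree_def by blast
    then show False using tight[OF that] by linarith
  qed
  have "\<sigma> i = i" if "i \<in> {1..n}" for i
    using p that
  proof (induction rule: parent_induct)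
    case root
    show ?case
      using edge[of r] parent_mapsD(1)[OF p] permutes_not_in[OF \<sigma>, of r] by argo
  next
    case (step i)
    show ?case
    proof (rule ccontr)
      assume "\<sigma> i \<noteq> i"
      then have "\<sigma> i = \<sigma> (p i)" using edge[OF step.hyps(1)] step.IH by argo
      then have "i = p i" by (rule injD[OF permutes_inj[OF \<sigma>]])
      then show False using step.IH \<open>\<sigma> i \<noteq> i\<close> by argo
    qed
  qed
  then show ?thesis using permutes_not_in[OF \<sigma>] by (auto simp: fun_eq_iff)
qed

text \<open>
  Among all trees one of maximal total potential is feasible. A violated edge \<open>i \<rightarrow> j\<close> either closes
  a cycle with the tree path from \<open>j\<close>, and rotating along this cycle is a cheaper permutation, or it
  can replace the tree edge out of \<open>i\<close>, which raises the potential.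
\<close>
lemma ex_feasible_tree:
  assumes r: "r \<in> {1..n}"
    and opt: "\<And>\<sigma>. \<sigma> permutes {1..n} \<Longrightarrow> perm_cost n y id \<le> perm_cost n y \<sigma>"
  shows "\<exists>p\<in>parent_maps n r. feasible n (tree_potential n r p y) y"
proof -
  define S where "S p = (\<Sum>i\<in>{1..n}. tree_potential n r p y i)" for p
  have "Max (S ` parent_maps n r) \<in> S ` parent_maps n r"
    using finite_parent_maps parent_maps_nonempty[OF r] by (intro Max_in) auto
  then obtain p where p: "p \<in> parent_maps n r" and "S p = Max (S ` parent_maps n r)" by force
  then have max: "S p' \<le> S p" if "p' \<in> parent_maps n r" for p'
    using that finite_parent_maps by simp
  define q where "q = tree_potential n r p y"
  have q_step: "q i = y i i - y i (p i) + q (p i)" if "i \<in> {1..n}" for i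
    unfolding q_def using tree_potential_step[OF p that] .
  have "q j - q i \<le> y i j - y i i" if ij: "i \<in> {1..n}" "j \<in> {1..n}" for i j
  proof (rule ccontr)
    assume "\<not> q j - q i \<le> y i j - y i i"
    then have viol: "y i j - y i i < q j - q i" by simp
    show False
    proof (cases "\<exists>m. (p ^^ m) j = i")
      case True
      define m where "m = (LEAST m. (p ^^ m) j = i)"
      have m: "(p ^^ m) j = i" unfolding m_def by (rule LeastI_ex[OF True])
      have before: "(p ^^ k) j \<noteq> i" if "k < m" for k
        using that not_less_Least unfolding m_def by blast
      \<comment> \<open>\<open>C\<close> is the vertex set of the cycle, and \<open>\<sigma>\<close> rotates it by one step along its edges\<close>
      define C where "C = (\<lambda>k. (p ^^ k) j) ` {..m}"
      define \<sigma> where "\<sigma> v = (if v = i then j else if v \<in> C then p v else v)" for v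
      have iC: "i \<in> C" and jC: "j \<in> C"
        using m by (auto simp: C_def image_iff intro: bexI[of _ m] bexI[of _ 0])
      have C_V: "C \<subseteq> {1..n}"
      proof -
        have "(p ^^ k) j \<in> {1..n}" for k
          using ij(2) parent_mapsD(2)[OF p] by (induction k) auto
        then show ?thesis by (auto simp: C_def)
      qed
      have into: "\<sigma> v \<in> C" if v: "v \<in> C" for v
      proof (cases "v = i")
        case False
        obtain k where k: "k \<le> m" "v = (p ^^ k) j" using v by (auto simp: C_def)
        then have "k < m" using False m by (cases "k = m") auto
        then have "p v \<in> C" using k by (auto simp: C_def image_iff intro!: bexI[of _ "Suc k"])
        then show ?thesis using False v by (simp add: \<sigma>_def)
      qed (simp add: \<sigma>_def jC)
      have onto: "w \<in> \<sigma> ` C" if w: "w \<in> C" for w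
      proof -
        obtain k where k: "k \<le> m" "w = (p ^^ k) j" using w by (auto simp: C_def)
        show ?thesis
        proof (cases k)
          case 0
          then have "w = \<sigma> i" using k by (simp add: \<sigma>_def)
          then show ?thesis using iC by blast
        next
          case (Suc l)
          then have "(p ^^ l) j \<in> C" "(p ^^ l) j \<noteq> i" using k before[of l] by (auto simp: C_def)
          moreover from this have "w = \<sigma> ((p ^^ l) j)" using k Suc by (simp add: \<sigma>_def)
          ultimately show ?thesis by blast
        qed
      qed
      have img: "\<sigma> ` C = C" using into onto by blast
      have "finite C" by (simp add: C_def)
      then have "inj_on \<sigma> C" by (rule eq_card_imp_inj_on) (simp add: img)
      then have "\<sigma> permutes C"
        using img iC by (intro bij_imp_permutes) (auto simp: bij_betw_def \<sigma>_def)
      then have \<sigma>: "\<sigma> permutes {1..n}" using C_V by (rule permutes_subset)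
      have "(\<Sum>v\<in>{1..n}. y v (\<sigma> v) - y v v - (q (\<sigma> v) - q v))
          = (\<Sum>v\<in>{1..n}. if v = i then y i j - y i i - (q j - q i) else 0)"
      proof (rule sum.cong)
        fix v assume v: "v \<in> {1..n}"
        show "y v (\<sigma> v) - y v v - (q (\<sigma> v) - q v) = (if v = i then y i j - y i i - (q j - q i) else 0)"
        proof (cases "v = i")
          case False
          then show ?thesis using q_step[OF v] by (simp add: \<sigma>_def)
        qed (simp add: \<sigma>_def)
      qed simp
      also have "\<dots> = y i j - y i i - (q j - q i)" using ij by simp
      finally show False using perm_cost_reduced[OF \<sigma>, of y q] opt[OF \<sigma>] viol by simp
    next
      case False
      have ir: "i \<noteq> r" using False parent_mapsD(4)[OF p ij(2)] by auto
      define p' where "p' = p(i := j)"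
      have orbit: "(p' ^^ k) j = (p ^^ k) j" for k
        using False by (induction k) (auto simp: p'_def)
      have "\<exists>k. (p' ^^ k) v = r" if "v \<in> {1..n}" for v
        using p that
      proof (induction rule: parent_induct)
        case root
        show ?case by (rule exI[of _ 0]) simp
      next
        case (step v)
        have "\<exists>k. (p' ^^ k) (p' v) = r"
        proof (cases "v = i")
          case True
          then show ?thesis using orbit parent_mapsD(4)[OF p ij(2)] by (auto simp: p'_def)
        next
          case False
          then have "p' v = p v" by (simp add: p'_def)
          then show ?thesis using step.IH by simp
        qed
        then obtain k where "(p' ^^ k) (p' v) = r" by blast
        then have "(p' ^^ Suc k) v = r" by (simp add: funpow_swap1)
        then show ?case by blast
      qed
      then have p': "p' \<in> parent_maps n r"
        using p ij ir by (auto simp: parent_maps_def p'_def PiE_iff extensional_def)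
      let ?q' = "tree_potential n r p' y"
      have ge: "q v \<le> ?q' v" if "v \<in> {1..n}" for v
        using p' that
      proof (induction rule: parent_induct)
        case root
        show ?case using tree_potential_root[OF p] tree_potential_root[OF p'] by (simp add: q_def)
      next
        case (step v)
        have "q v \<le> y v v - y v (p' v) + q (p' v)"
          using q_step[OF step.hyps(1)] viol by (cases "v = i") (auto simp: p'_def)
        then show ?case using tree_potential_step[OF p' step.hyps(1), of y] step.IH by simp
      qed
      have "q i < ?q' i"
        using tree_potential_step[OF p' ij(1), of y] ge[OF ij(2)] viol by (simp add: p'_def)
      then have "S p < S p'"
        unfolding S_def q_def[symmetric] using ge ij(1) by (intro sum_strict_mono_ex1) auto
      then show False using max[OF p'] by simp
    qed
  qed
  then show ?thesis using p unfolding feasible_def q_def by blast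
qed

section \<open>Shortest paths along a strict tree\<close>

lemma path_length_Cons: "path_length \<Delta> (a # b # w) = \<Delta> a b + path_length \<Delta> (b # w)"
  by (simp add: path_length_def)

lemma path_length_ge:
  assumes "\<And>i j. i \<in> {1..n} \<Longrightarrow> j \<in> {1..n} \<Longrightarrow> q j - q i \<le> \<Delta> i j"
    and "w \<noteq> []" "set w \<subseteq> {1..n}"
  shows "q (last w) - q (hd w) \<le> path_length \<Delta> w"
  using assms(2,3)
proof (induction w)
  case (Cons a w)
  show ?case
  proof (cases w)
    case Nil
    then show ?thesis by (simp add: path_length_def)
  next
    case (Cons b w')
    then show ?thesis
      using Cons.IH Cons.prems assms(1)[of a b] by (auto simp: path_length_Cons)
  qed
qed simp

lemma finite_directed_paths: "finite (directed_paths n i r)"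
proof (rule finite_subset)
  show "directed_paths n i r \<subseteq> {w. set w \<subseteq> {1..n} \<and> length w \<le> n}"
  proof
    fix w assume "w \<in> directed_paths n i r"
    then have "distinct w" "set w \<subseteq> {1..n}" by (auto simp: directed_paths_def)
    then show "w \<in> {w. set w \<subseteq> {1..n} \<and> length w \<le> n}"
      using card_mono[of "{1..n}" "set w"] distinct_card[of w] by simp
  qed
qed (rule finite_lists_length_le, simp)

text \<open>
  Telescoping a feasible potential bounds every path length from below, and the path along a tight tree
  attains the bound. The rank is carried through the induction to keep that path free of repetitions.
\<close>
lemma dist_to_tight_tree:
  assumes p: "p \<in> parent_maps n r" and i: "i \<in> {1..n}" and q0: "q r = 0" and r: "r \<in> {1..n}"
    and feas: "\<And>i j. i \<in> {1..n} \<Longrightarrow> j \<in> {1..n} \<Longrightarrow> q j - q i \<le> slack n y i j"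
    and tight: "\<And>i. i \<in> {1..n} \<Longrightarrow> slack n y i (p i) = q (p i) - q i"
  shows "dist_to n y r i = - q i"
proof -
  obtain h :: "nat \<Rightarrow> nat" where h: "\<And>i. i \<in> {1..n} \<Longrightarrow> i \<noteq> r \<Longrightarrow> h (p i) < h i"
    using parent_rank[OF p] by blast
  have "\<exists>w\<in>directed_paths n i r. path_length (slack n y) w = - q i \<and> (\<forall>v\<in>set w. h v \<le> h i)"
    using p i
  proof (induction rule: parent_induct)
    case root
    show ?case
      using r q0 by (intro bexI[of _ "[r]"]) (auto simp: directed_paths_def path_length_def)
  next
    case (step i)
    then obtain w where w: "w \<in> directed_paths n (p i) r" "path_length (slack n y) w = - q (p i)"
      "\<forall>v\<in>set w. h v \<le> h (p i)" by blast
    obtain w' where w': "w = p i # w'" using w(1) by (cases w) (auto simp: directed_paths_def)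
    have "h v < h i" if "v \<in> set w" for v using w(3) h[OF step.hyps] that by fastforce
    then have "i # w \<in> directed_paths n i r" "\<forall>v\<in>set (i # w). h v \<le> h i"
      using w(1) step.hyps by (auto simp: directed_paths_def less_imp_le)
    moreover have "path_length (slack n y) (i # w) = - q i"
      using w(2) tight[OF step.hyps(1)] by (simp add: w' path_length_Cons)
    ultimately show ?case by blast
  qed
  then have "- q i \<in> path_length (slack n y) ` directed_paths n i r" by force
  moreover have "- q i \<le> l" if "l \<in> path_length (slack n y) ` directed_paths n i r" for l
    using that path_length_ge[of n q "slack n y", OF feas] q0 by (force simp: directed_paths_def)
  ultimately show ?thesis
    unfolding dist_to_def by (intro Min_eqI) (auto simp: finite_directed_paths)
qed

lemma opt_perm_eqI:
  assumes \<sigma>: "\<sigma> permutes {1..n}"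
    and unique: "\<And>\<tau>. \<tau> permutes {1..n} \<Longrightarrow> perm_cost n y \<tau> \<le> perm_cost n y \<sigma> \<Longrightarrow> \<tau> = \<sigma>"
  shows "opt_perm n y = \<sigma>"
  unfolding opt_perm_def
proof (rule some_equality)
  show "\<sigma> permutes {1..n} \<and> (\<forall>\<tau>. \<tau> permutes {1..n} \<longrightarrow> perm_cost n y \<sigma> \<le> perm_cost n y \<tau>)"
    using \<sigma> unique by (metis linorder_linear)
next
  fix \<tau> assume "\<tau> permutes {1..n} \<and> (\<forall>\<pi>. \<pi> permutes {1..n} \<longrightarrow> perm_cost n y \<tau> \<le> perm_cost n y \<pi>)"
  then show "\<tau> = \<sigma>" using \<sigma> unique by blast
qed

text \<open>
  A tree that is strict after relabelling the columns by \<open>\<sigma>\<close> certifies both that \<open>\<sigma>\<close> is the unique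
  optimum and that its own potential is the shortest-path potential.
\<close>
lemma strict_tree_certificate:
  fixes y :: "nat \<Rightarrow> nat \<Rightarrow> real"
  defines "y' \<equiv> \<lambda>\<sigma> i j. y i (\<sigma> j)"
  assumes \<sigma>: "\<sigma> permutes {1..n}" and r: "r \<in> {1..n}" and p: "p \<in> parent_maps n r"
    and s: "strict_tree n r p (y' \<sigma>)"
  shows strict_tree_opt_perm: "opt_perm n y = \<sigma>"
    and strict_tree_potential: "i \<in> {1..n} \<Longrightarrow> potential n y r i = tree_potential n r p (y' \<sigma>) i"
proof -
  have cost: "perm_cost n y (\<sigma> \<circ> \<tau>) = perm_cost n (y' \<sigma>) \<tau>" for \<tau>
    by (simp add: perm_cost_def y'_def)
  show opt: "opt_perm n y = \<sigma>"
  proof (rule opt_perm_eqI[OF \<sigma>])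
    fix \<tau> assume \<tau>: "\<tau> permutes {1..n}" and le: "perm_cost n y \<tau> \<le> perm_cost n y \<sigma>"
    let ?\<pi> = "Hilbert_Choice.inv \<sigma> \<circ> \<tau>"
    have \<tau>_eq: "\<sigma> \<circ> ?\<pi> = \<tau>" using permutes_surj[OF \<sigma>] by (simp add: fun_eq_iff surj_f_inv_f)
    have "?\<pi> permutes {1..n}" using \<tau> permutes_inv[OF \<sigma>] by (rule permutes_compose)
    moreover have "perm_cost n (y' \<sigma>) ?\<pi> \<le> perm_cost n (y' \<sigma>) id"
      using le cost[of ?\<pi>] cost[of id] by (simp only: \<tau>_eq comp_id)
    ultimately have "?\<pi> = id" using strict_tree_unique_optimum[OF p s] by blast
    then show "\<tau> = \<sigma>" using \<tau>_eq by simp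
  qed
  have slack: "slack n y i j = y' \<sigma> i j - y' \<sigma> i i" for i j
    by (simp add: slack_def aligned_def opt y'_def)
  show "potential n y r i = tree_potential n r p (y' \<sigma>) i" if "i \<in> {1..n}"
    unfolding potential_def
  proof (subst dist_to_tight_tree[where q = "tree_potential n r p (y' \<sigma>)",
        OF p that tree_potential_root[OF p] r])
    show "tree_potential n r p (y' \<sigma>) j - tree_potential n r p (y' \<sigma>) i \<le> slack n y i j"
      if "i \<in> {1..n}" "j \<in> {1..n}" for i j
      using strict_tree_feasible[OF p s] that by (simp add: feasible_def slack)
    show "slack n y i (p i) = tree_potential n r p (y' \<sigma>) (p i) - tree_potential n r p (y' \<sigma>) i"
      if "i \<in> {1..n}" for i
      using tree_potential_step[OF p that, of "y' \<sigma>"] by (simp add: slack)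
  qed simp
qed

text \<open>
  The potential is determined by distances, so two strict trees have the same tight edges.
\<close>
lemma strict_tree_unique:
  assumes r: "r \<in> {1..n}" and p: "p \<in> parent_maps n r" and p': "p' \<in> parent_maps n r"
    and s: "strict_tree n r p y" and s': "strict_tree n r p' y"
  shows "p = p'"
proof
  fix i
  have same: "tree_potential n r p y v = tree_potential n r p' y v" if "v \<in> {1..n}" for v
    using strict_tree_potential[OF permutes_id r p, of y v] strict_tree_potential[OF permutes_id r p', of y v]
      s s' that by simp
  consider "i \<in> {1..n}" "i \<noteq> r" | "i = r" | "i \<notin> {1..n}" by blast
  then show "p i = p' i"
  proof cases
    case 1
    note pi = parent_mapsD(2)[OF p 1(1)]
    show ?thesis
    proof (rule ccontr)
      assume "p i \<noteq> p' i"
      then have "tree_potential n r p' y (p i) - tree_potential n r p' y i < y i (p i) - y i i"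
        using s' 1 pi parent_neq[OF p 1] by (auto simp: strict_tree_def)
      then show False
        using tree_potential_step[OF p 1(1), of y] same[OF 1(1)] same[OF pi] by simp
    qed
  qed (use parent_mapsD[OF p] parent_mapsD[OF p'] in auto)
qed

section \<open>Measurability of the potential map\<close>

lemma opt_perm_optimal:
  shows opt_perm_permutes: "opt_perm n y permutes {1..n}"
    and opt_perm_le: "\<tau> permutes {1..n} \<Longrightarrow> perm_cost n y (opt_perm n y) \<le> perm_cost n y \<tau>"
proof -
  let ?P = "{\<sigma>. \<sigma> permutes {1..n}}"
  have "finite ?P" by (intro finite_permutations) simp
  moreover have "?P \<noteq> {}" using permutes_id by blast
  ultimately have "\<exists>\<sigma>. \<sigma> permutes {1..n} \<and> (\<forall>\<tau>. \<tau> permutes {1..n} \<longrightarrow> perm_cost n y \<sigma> \<le> perm_cost n y \<tau>)"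
    using arg_min_if_finite[of ?P "perm_cost n y"] by (auto simp: not_less)
  from someI_ex[OF this] show "opt_perm n y permutes {1..n}"
    "\<tau> permutes {1..n} \<Longrightarrow> perm_cost n y (opt_perm n y) \<le> perm_cost n y \<tau>"
    unfolding opt_perm_def by blast+
qed

lemma sum_U_vec: "n \<ge> 1 \<Longrightarrow> (\<Sum>i\<in>{1..n}. U_vec n y r i) = 0"
  by (simp add: U_vec_def sum_distrib_left[symmetric] sum_subtractf)

lemma U_vec_in_H0: "n \<ge> 1 \<Longrightarrow> U_vec n y r \<in> H0 n"
  using sum_U_vec[of n y r] by (auto simp: H0_def U_vec_def)

context
  fixes n :: nat and M :: "'a measure" and Y :: "nat \<Rightarrow> nat \<Rightarrow> 'a \<Rightarrow> real"
  assumes Y: "\<And>i j. i \<in> {1..n} \<Longrightarrow> j \<in> {1..n} \<Longrightarrow> Y i j \<in> borel_measurable M"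
begin

lemma borel_measurable_perm_cost:
  assumes "\<sigma> permutes {1..n}"
  shows "(\<lambda>\<omega>. perm_cost n (\<lambda>i j. Y i j \<omega>) \<sigma>) \<in> borel_measurable M"
  unfolding perm_cost_def
  using permutes_in_image[OF assms] by (intro borel_measurable_sum Y) blast+

text \<open>The chosen optimum is a function of the random set of all optima, of which there are finitely many.\<close>
lemma measurable_opt_perm:
  "(\<lambda>\<omega>. opt_perm n (\<lambda>i j. Y i j \<omega>)) \<in> measurable M (count_space {\<sigma>. \<sigma> permutes {1..n}})"
proof -
  let ?P = "{\<sigma>. \<sigma> permutes {1..n}}"
  let ?opt = "\<lambda>\<sigma> \<omega>. \<forall>\<tau>\<in>?P. perm_cost n (\<lambda>i j. Y i j \<omega>) \<sigma> \<le> perm_cost n (\<lambda>i j. Y i j \<omega>) \<tau>"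
  have fin: "finite ?P" by (intro finite_permutations) simp
  have opt_sets: "{\<omega> \<in> space M. ?opt \<sigma> \<omega>} \<in> sets M" if "\<sigma> \<in> ?P" for \<sigma>
    using that fin
    by (intro sets.sets_Collect_finite_All borel_measurable_le borel_measurable_perm_cost) auto
  define m where "m \<omega> = {\<sigma> \<in> ?P. ?opt \<sigma> \<omega>}" for \<omega>
  have m: "m \<in> measurable M (count_space (Pow ?P))"
  proof (subst measurable_count_space_eq2)
    show "finite (Pow ?P)" using fin by simp
    have "m -` {S} \<inter> space M = {\<omega> \<in> space M. \<forall>\<sigma>\<in>?P. (\<sigma> \<in> S) = ?opt \<sigma> \<omega>}" if "S \<subseteq> ?P" for S
      using that unfolding m_def by blast
    moreover have "{\<omega> \<in> space M. \<forall>\<sigma>\<in>?P. (\<sigma> \<in> S) = ?opt \<sigma> \<omega>} \<in> sets M" for S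
    proof (intro sets.sets_Collect_finite_All fin)
      fix \<sigma> assume \<sigma>: "\<sigma> \<in> ?P"
      show "{\<omega> \<in> space M. (\<sigma> \<in> S) = ?opt \<sigma> \<omega>} \<in> sets M"
        using opt_sets[OF \<sigma>] sets.sets_Collect_neg[OF opt_sets[OF \<sigma>]]
        by (cases "\<sigma> \<in> S") simp_all
    qed
    ultimately show "m \<in> space M \<rightarrow> Pow ?P \<and> (\<forall>S\<in>Pow ?P. m -` {S} \<inter> space M \<in> sets M)"
      by (auto simp: m_def)
  qed
  define c where "c S = (SOME \<sigma>. \<sigma> \<in> S)" for S :: "(nat \<Rightarrow> nat) set"
  have eq: "opt_perm n (\<lambda>i j. Y i j \<omega>) = c (m \<omega>)" for \<omega>
    unfolding opt_perm_def c_def m_def by simp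
  have "(\<lambda>\<omega>. c (m \<omega>)) \<in> measurable M (count_space UNIV)"
    by (rule measurable_compose[OF m]) simp
  then show ?thesis
    unfolding eq[symmetric] using opt_perm_permutes
    by (simp add: measurable_def)
qed

lemma borel_measurable_aligned:
  assumes "i \<in> {1..n}" "j \<in> {1..n}"
  shows "(\<lambda>\<omega>. aligned n (\<lambda>i j. Y i j \<omega>) i j) \<in> borel_measurable M"
  unfolding aligned_def
proof (rule measurable_compose_countable'[OF _ measurable_opt_perm])
  show "countable {\<sigma>. \<sigma> permutes {1..n}}"
    by (intro countable_finite finite_permutations) simp
  show "(\<lambda>\<omega>. Y i (\<sigma> j) \<omega>) \<in> borel_measurable M" if "\<sigma> \<in> {\<sigma>. \<sigma> permutes {1..n}}" for \<sigma>
    using that assms permutes_in_image[of \<sigma> "{1..n}" j] by (intro Y) auto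
qed

lemma borel_measurable_path_length:
  "set w \<subseteq> {1..n} \<Longrightarrow> (\<lambda>\<omega>. path_length (slack n (\<lambda>i j. Y i j \<omega>)) w) \<in> borel_measurable M"
proof (induction w rule: induct_list012)
  case (3 a b w)
  then have "(\<lambda>\<omega>. slack n (\<lambda>i j. Y i j \<omega>) a b) \<in> borel_measurable M"
    unfolding slack_def by (intro borel_measurable_diff borel_measurable_aligned) auto
  then show ?case using 3 by (simp add: path_length_Cons)
qed (simp_all add: path_length_def)

lemma borel_measurable_potential:
  "(\<lambda>\<omega>. potential n (\<lambda>i j. Y i j \<omega>) r i) \<in> borel_measurable M"
  unfolding potential_def dist_to_def
  by (intro borel_measurable_uminus borel_measurable_Min finite_directed_paths borel_measurable_path_length)
    (auto simp: directed_paths_def)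

lemma measurable_D_vec: "(\<lambda>\<omega>. D_vec n (\<lambda>i j. Y i j \<omega>)) \<in> measurable M (lborel_on {1..n})"
  unfolding D_vec_def
proof (rule measurable_restrict)
  fix i assume "i \<in> {1..n}"
  from borel_measurable_aligned[OF this this]
  show "(\<lambda>\<omega>. real n * aligned n (\<lambda>i j. Y i j \<omega>) i i) \<in> measurable M lborel" by simp
qed

lemma measurable_U_vec:
  assumes n: "n \<ge> 1"
  shows "(\<lambda>\<omega>. U_vec n (\<lambda>i j. Y i j \<omega>) r) \<in> measurable M (H0_measure n)"
proof -
  have "(\<lambda>\<omega>. U_vec n (\<lambda>i j. Y i j \<omega>) r) \<in> measurable M (restrict_space (PiM {1..n} (\<lambda>_. borel)) (H0 n))"
  proof (rule measurable_restrict_space2)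
    show "(\<lambda>\<omega>. U_vec n (\<lambda>i j. Y i j \<omega>) r) \<in> measurable M (PiM {1..n} (\<lambda>_. borel))"
      unfolding U_vec_def
      by (intro measurable_restrict borel_measurable_times borel_measurable_diff borel_measurable_divide
          borel_measurable_sum borel_measurable_const borel_measurable_potential)
  qed (use U_vec_in_H0[OF n] in blast)
  then show ?thesis by (simp cong: measurable_cong_sets add: sets_H0_measure)
qed

lemma measurable_D_U:
  "n \<ge> 1 \<Longrightarrow> (\<lambda>\<omega>. (D_vec n (\<lambda>i j. Y i j \<omega>), U_vec n (\<lambda>i j. Y i j \<omega>) r)) \<in> measurable M (ref_measure n)"
  unfolding ref_measure_def by (intro measurable_Pair measurable_D_vec measurable_U_vec)

end

section \<open>Relabelling the columns of a random matrix\<close>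

definition relabel :: "nat \<Rightarrow> (nat \<Rightarrow> nat) \<Rightarrow> (nat \<times> nat \<Rightarrow> real) \<Rightarrow> nat \<times> nat \<Rightarrow> real" where
  "relabel n \<sigma> y = (\<lambda>(i, j)\<in>cells n. y (i, \<sigma> j))"

lemma relabel_alt: "relabel n \<sigma> y = (\<lambda>e\<in>cells n. y (map_prod id \<sigma> e))"
  by (auto simp: relabel_def fun_eq_iff)

lemma bij_betw_columns:
  assumes "\<sigma> permutes {1..n}"
  shows "bij_betw (map_prod id \<sigma>) (cells n) (cells n)"
  by (rule bij_betw_map_prod[OF bij_betw_id permutes_imp_bij[OF assms]])

lemma distr_relabel:
  assumes "\<sigma> permutes {1..n}"
  shows "distr (lborel_on (cells n)) (lborel_on (cells n)) (relabel n \<sigma>)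
    = lborel_on (cells n)"
  unfolding relabel_alt[abs_def]
  by (rule distr_lborel_on_reindex) (use bij_betw_columns[OF assms] in simp_all)

lemma measurable_relabel:
  assumes "\<sigma> permutes {1..n}"
  shows "relabel n \<sigma> \<in> measurable (lborel_on (cells n)) (lborel_on (cells n))"
  unfolding relabel_alt
proof (rule measurable_restrict)
  fix e assume "e \<in> cells n"
  then have "map_prod id \<sigma> e \<in> cells n"
    using bij_betw_columns[OF assms] by (auto simp: bij_betw_def)
  then show "(\<lambda>y. y (map_prod id \<sigma> e)) \<in> measurable (lborel_on (cells n)) lborel" by simp
qed

lemma funpow_parent_in: "p \<in> parent_maps n r \<Longrightarrow> i \<in> {1..n} \<Longrightarrow> (p ^^ k) i \<in> {1..n}"
  by (induction k) (auto dest: parent_mapsD(2))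

lemma tree_potential_cong:
  assumes p: "p \<in> parent_maps n r" and i: "i \<in> {1..n}"
    and eq: "\<And>i j. i \<in> {1..n} \<Longrightarrow> j \<in> {1..n} \<Longrightarrow> y i j = y' i j"
  shows "tree_potential n r p y i = tree_potential n r p y' i"
  unfolding tree_potential_def
  using funpow_parent_in[OF p i] parent_mapsD(2)[OF p] by (intro sum.cong refl) (simp add: eq)

lemma strict_tree_cong:
  assumes p: "p \<in> parent_maps n r"
    and eq: "\<And>i j. i \<in> {1..n} \<Longrightarrow> j \<in> {1..n} \<Longrightarrow> y i j = y' i j"
  shows "strict_tree n r p y \<longleftrightarrow> strict_tree n r p y'"
proof -
  have t: "tree_potential n r p y i = tree_potential n r p y' i" if "i \<in> {1..n}" for i
    using p that eq by (rule tree_potential_cong)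
  show ?thesis
    unfolding strict_tree_def by (intro ball_cong refl) (simp only: eq t)
qed

lemma borel_measurable_tree_potential:
  assumes p: "p \<in> parent_maps n r" and i: "i \<in> {1..n}"
  shows "(\<lambda>y. tree_potential n r p (curry y) i) \<in> borel_measurable (lborel_on (cells n))"
  unfolding tree_potential_def curry_def
  using funpow_parent_in[OF p i] parent_mapsD(2)[OF p]
  by (intro borel_measurable_sum borel_measurable_diff borel_measurable_lborel_on_component) auto

lemma sets_strict_tree:
  assumes p: "p \<in> parent_maps n r"
  shows "{y \<in> space (lborel_on (cells n)). strict_tree n r p (curry y)}
    \<in> sets (lborel_on (cells n))"
proof -
  let ?L = "lborel_on (cells n)"
  have S: "{y \<in> space ?L. j \<noteq> i \<longrightarrow> j \<noteq> p i \<longrightarrow>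
      tree_potential n r p (curry y) j - tree_potential n r p (curry y) i < curry y i j - curry y i i} \<in> sets ?L"
    if "i \<in> {1..n}" "j \<in> {1..n}" for i j
    unfolding curry_def
    using that borel_measurable_tree_potential[OF p, unfolded curry_def]
    by (intro sets.sets_Collect_imp sets.sets_Collect_const borel_measurable_less borel_measurable_diff
        borel_measurable_lborel_on_component) auto
  show ?thesis
    unfolding strict_tree_def by (intro sets.sets_Collect_finite_All finite_atLeastAtMost S)
qed

abbreviation has_strict_tree :: "nat \<Rightarrow> nat \<Rightarrow> (nat \<times> nat \<Rightarrow> real) \<Rightarrow> bool" where
  "has_strict_tree n r y \<equiv> \<exists>\<sigma> p. \<sigma> permutes {1..n} \<and> p \<in> parent_maps n r \<and>
     strict_tree n r p (curry (relabel n \<sigma> y))"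

text \<open>
  Almost every matrix has a strict tree after relabelling its columns by an optimal permutation:
  a feasible tree exists, and a tight edge outside the tree would fix one entry in terms of the others.
\<close>
lemma AE_ex_strict_tree:
  assumes r: "r \<in> {1..n}"
  shows "AE y in lborel_on (cells n). has_strict_tree n r y"
proof -
  let ?I = "cells n" and ?P = "{\<sigma>. \<sigma> permutes {1..n}}"
  \<comment> \<open>no edge outside a tree is tight for the potential of the tree\<close>
  define Q where "Q y \<longleftrightarrow> (\<forall>p\<in>parent_maps n r. \<forall>i\<in>{1..n}. \<forall>j\<in>{1..n} - {i, p i}.
    y (i, j) \<noteq> y (i, i) + (tree_potential n r p (curry y) j - tree_potential n r p (curry y) i))" for y
  have "AE y in lborel_on ?I. Q y"
    unfolding Q_def
  proof (intro AE_finite_allI finite_parent_maps finite_atLeastAtMost finite_Diff)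
    fix p i j assume p: "p \<in> parent_maps n r" and i: "i \<in> {1..n}" and j: "j \<in> {1..n} - {i, p i}"
    show "AE y in lborel_on ?I. y (i, j) \<noteq>
      y (i, i) + (tree_potential n r p (curry y) j - tree_potential n r p (curry y) i)"
    proof (rule AE_lborel_on_coordinate_neq)
      show "(\<lambda>y. y (i, i) + (tree_potential n r p (curry y) j - tree_potential n r p (curry y) i))
          \<in> borel_measurable (lborel_on ?I)"
        using i j by (intro borel_measurable_add borel_measurable_diff
            borel_measurable_tree_potential p borel_measurable_lborel_on_component) auto
      have same: "curry (y((i, j) := v)) a b = curry y a b" if "b = a \<or> b = p a" for y v a b
        using that j by auto
      have "tree_potential n r p (curry (y((i, j) := v))) = tree_potential n r p (curry y)" for y v
        unfolding tree_potential_def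
        by (intro ext sum.cong refl arg_cong2[where f = "(-)"] same) auto
      then show "(y((i, j) := v)) (i, i) + (tree_potential n r p (curry (y((i, j) := v))) j
            - tree_potential n r p (curry (y((i, j) := v))) i)
          = y (i, i) + (tree_potential n r p (curry y) j - tree_potential n r p (curry y) i)" for y v
        using j by simp
    qed (use i j in auto)
  qed
  then have "AE y in lborel_on ?I. Q (relabel n \<sigma> y)" if "\<sigma> \<in> ?P" for \<sigma>
    using that by (intro AE_distrD[OF measurable_relabel]) (simp_all only: distr_relabel mem_Collect_eq)
  then have "AE y in lborel_on ?I. \<forall>\<sigma>\<in>?P. Q (relabel n \<sigma> y)"
    by (intro AE_finite_allI finite_permutations) auto
  then show ?thesis
  proof (rule AE_mp, intro AE_I2 impI)
    fix y assume Q: "\<forall>\<sigma>\<in>?P. Q (relabel n \<sigma> y)"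
    let ?\<sigma> = "opt_perm n (curry y)"
    let ?y = "curry (relabel n ?\<sigma> y)"
    note \<sigma> = opt_perm_permutes[of n "curry y"]
    have cost: "perm_cost n ?y \<tau> = perm_cost n (curry y) (?\<sigma> \<circ> \<tau>)" if "\<tau> permutes {1..n}" for \<tau>
      unfolding perm_cost_def
    proof (rule sum.cong)
      fix i assume "i \<in> {1..n}"
      then show "?y i (\<tau> i) = curry y i ((?\<sigma> \<circ> \<tau>) i)"
        using permutes_in_image[OF that, of i] by (simp add: relabel_def)
    qed simp
    have "perm_cost n ?y id \<le> perm_cost n ?y \<tau>" if "\<tau> permutes {1..n}" for \<tau>
      using opt_perm_le[OF permutes_compose[OF that \<sigma>], of "curry y"] cost[OF that] cost[OF permutes_id]
      by simp
    then obtain p where p: "p \<in> parent_maps n r" and f: "feasible n (tree_potential n r p ?y) ?y"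
      using ex_feasible_tree[OF r, of ?y] by blast
    have "strict_tree n r p ?y"
      unfolding strict_tree_def
    proof (intro ballI impI)
      fix i j assume ij: "i \<in> {1..n}" "j \<in> {1..n}" "j \<noteq> i" "j \<noteq> p i"
      have "tree_potential n r p ?y j - tree_potential n r p ?y i \<le> ?y i j - ?y i i"
        using f ij by (simp add: feasible_def)
      moreover have "?y i j \<noteq> ?y i i + (tree_potential n r p ?y j - tree_potential n r p ?y i)"
      proof -
        have "Q (relabel n ?\<sigma> y)" using Q \<sigma> by blast
        then show ?thesis using p ij unfolding Q_def curry_conv by blast
      qed
      ultimately show "tree_potential n r p ?y j - tree_potential n r p ?y i < ?y i j - ?y i i" by linarith
    qed
    then show "has_strict_tree n r y"
      using \<sigma> p by blast
  qed
qed

section \<open>Splitting a matrix along a tree\<close>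

definition non_tree :: "nat \<Rightarrow> (nat \<Rightarrow> nat) \<Rightarrow> (nat \<times> nat) set" where
  "non_tree n p = {(i, j). i \<in> {1..n} \<and> j \<in> {1..n} \<and> j \<noteq> i \<and> j \<noteq> p i}"

lemma finite_non_tree: "finite (non_tree n p)"
  by (rule finite_subset[of _ "cells n"]) (auto simp: non_tree_def)

text \<open>
  Tree entries are indexed by their tail, so that the diagonal, the tree and the remaining entries range
  over three ordinary product spaces.
\<close>
definition assemble :: "nat \<Rightarrow> (nat \<Rightarrow> nat) \<Rightarrow>
    (nat \<Rightarrow> real) \<times> (nat \<Rightarrow> real) \<times> (nat \<times> nat \<Rightarrow> real) \<Rightarrow> nat \<times> nat \<Rightarrow> real" where
  "assemble n p = (\<lambda>(d, t, z). \<lambda>e\<in>cells n.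
     if snd e = fst e then d (fst e) else if snd e = p (fst e) then t (fst e) else z e)"

text \<open>
  The off-diagonal pairs consist of the tree edges and the pairs in \<open>non_tree\<close>.
\<close>
lemma prod_off_diag_split:
  fixes f :: "nat \<times> nat \<Rightarrow> 'b :: comm_monoid_mult"
  assumes p: "p \<in> parent_maps n r"
  shows "prod f (off_diag n) = (\<Prod>i\<in>{1..n} - {r}. f (i, p i)) * prod f (non_tree n p)"
proof -
  have "off_diag n = (\<lambda>i. (i, p i)) ` ({1..n} - {r}) \<union> non_tree n p"
    using parent_mapsD(1,2)[OF p] parent_neq[OF p] not_sym[OF parent_neq[OF p]]
    by (auto simp: off_diag_def non_tree_def image_iff)
  moreover have "(\<lambda>i. (i, p i)) ` ({1..n} - {r}) \<inter> non_tree n p = {}"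
    by (auto simp: non_tree_def)
  ultimately have "prod f (off_diag n) = prod f ((\<lambda>i. (i, p i)) ` ({1..n} - {r})) * prod f (non_tree n p)"
    by (simp add: prod.union_disjoint finite_non_tree)
  then show ?thesis by (simp add: prod.reindex inj_on_def)
qed

lemma prod_matrix_split:
  fixes f :: "nat \<times> nat \<Rightarrow> 'b :: comm_monoid_mult"
  assumes p: "p \<in> parent_maps n r"
  shows "prod f (cells n) =
    (\<Prod>i\<in>{1..n}. f (i, i)) * ((\<Prod>i\<in>{1..n} - {r}. f (i, p i)) * prod f (non_tree n p))"
proof -
  have "cells n = (\<lambda>i. (i, i)) ` {1..n} \<union> off_diag n"
    by (auto simp: off_diag_def)
  moreover have "(\<lambda>i. (i, i)) ` {1..n} \<inter> off_diag n = {}" by (auto simp: off_diag_def)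
  moreover have "finite (off_diag n)"
    by (rule finite_subset[of _ "cells n"]) (auto simp: off_diag_def)
  ultimately have "prod f (cells n) = prod f ((\<lambda>i. (i, i)) ` {1..n}) * prod f (off_diag n)"
    by (simp add: prod.union_disjoint)
  then show ?thesis by (simp add: prod.reindex inj_on_def prod_off_diag_split[OF p])
qed

definition tree_entries ::
    "nat \<Rightarrow> nat \<Rightarrow> (nat \<Rightarrow> nat) \<Rightarrow> (nat \<Rightarrow> real) \<Rightarrow> (nat \<Rightarrow> real) \<Rightarrow> nat \<Rightarrow> real" where
  "tree_entries n r p d x = (\<lambda>i\<in>{1..n} - {r}. d i + (x (p i) - x i) / real n)"

context
  fixes n r :: nat and p :: "nat \<Rightarrow> nat"
  assumes r: "r \<in> {1..n}" and p: "p \<in> parent_maps n r"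
begin

lemma assemble_apply:
  "i \<in> {1..n} \<Longrightarrow> assemble n p (d, t, z) (i, i) = d i"
  "i \<in> {1..n} \<Longrightarrow> i \<noteq> r \<Longrightarrow> assemble n p (d, t, z) (i, p i) = t i"
  "e \<in> non_tree n p \<Longrightarrow> assemble n p (d, t, z) e = z e"
proof -
  show "assemble n p (d, t, z) (i, i) = d i" if "i \<in> {1..n}"
    using that by (simp add: assemble_def)
  show "assemble n p (d, t, z) (i, p i) = t i" if "i \<in> {1..n}" "i \<noteq> r"
    using parent_mapsD(2)[OF p that(1)] parent_neq[OF p that] that by (simp add: assemble_def)
  show "assemble n p (d, t, z) e = z e" if "e \<in> non_tree n p"
  proof -
    obtain i j where e: "e = (i, j)" by fastforce
    show ?thesis using that by (simp add: assemble_def non_tree_def e)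
  qed
qed

abbreviation split_space where
  "split_space \<equiv> lborel_on {1..n} \<Otimes>\<^sub>M (lborel_on ({1..n} - {r}) \<Otimes>\<^sub>M lborel_on (non_tree n p))"

lemma measurable_assemble: "assemble n p \<in> measurable split_space (lborel_on (cells n))"
  unfolding assemble_def case_prod_unfold
proof (rule measurable_restrict)
  fix e :: "nat \<times> nat" assume e: "e \<in> cells n"
  let ?N = "lborel :: real measure"
  consider "snd e = fst e" | "snd e \<noteq> fst e" "snd e = p (fst e)" | "snd e \<noteq> fst e" "snd e \<noteq> p (fst e)"
    by blast
  then show "(\<lambda>x. if snd e = fst e then fst x (fst e) else if snd e = p (fst e) then fst (snd x) (fst e)
      else snd (snd x) e) \<in> measurable split_space ?N"
  proof cases
    case 1
    have "(\<lambda>x. fst x (fst e)) \<in> measurable split_space ?N"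
      using e by (intro measurable_compose[OF measurable_fst] measurable_component_singleton) auto
    then show ?thesis using 1 by simp
  next
    case 2
    then have "fst e \<in> {1..n} - {r}" using e parent_mapsD(1)[OF p] by auto
    then have "(\<lambda>x. fst (snd x) (fst e)) \<in> measurable split_space ?N"
      by (intro measurable_compose[OF measurable_compose[OF measurable_snd measurable_fst]]
          measurable_component_singleton)
    then show ?thesis using 2 by simp
  next
    case 3
    then have "e \<in> non_tree n p" using e by (auto simp: non_tree_def)
    then have "(\<lambda>x. snd (snd x) e) \<in> measurable split_space ?N"
      by (intro measurable_compose[OF measurable_compose[OF measurable_snd measurable_snd]]
          measurable_component_singleton)
    then show ?thesis using 3 by simp
  qed
qed

text \<open>
  The three blocks partition the entries, so boxes correspond to products of boxes.
\<close>
lemma distr_assemble: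
  "distr split_space (lborel_on (cells n)) (assemble n p) = lborel_on (cells n)"
proof (rule product_sigma_finite.PiM_eqI[OF product_sigma_finite_lborel])
  show "sets (distr split_space (lborel_on (cells n)) (assemble n p))
    = sets (lborel_on (cells n))" by (rule sets_distr)
  show "finite (cells n)" by (intro finite_cartesian_product finite_atLeastAtMost)
  note PiM = product_sigma_finite.emeasure_PiM[OF product_sigma_finite_lborel]
  fix E :: "nat \<times> nat \<Rightarrow> real set"
  assume E: "\<And>e. e \<in> cells n \<Longrightarrow> E e \<in> sets lborel"
  have mem: "(i, i) \<in> cells n" "(i, p i) \<in> cells n" if "i \<in> {1..n}" for i
    using that parent_mapsD(2)[OF p that] by auto
  let ?A = "Pi\<^sub>E {1..n} (\<lambda>i. E (i, i))" and ?B = "Pi\<^sub>E ({1..n} - {r}) (\<lambda>i. E (i, p i))"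
    and ?C = "Pi\<^sub>E (non_tree n p) E"
  have pre: "assemble n p -` (Pi\<^sub>E (cells n) E) \<inter> space split_space = ?A \<times> (?B \<times> ?C)"
  proof (intro equalityI subsetI)
    fix x assume x: "x \<in> assemble n p -` (Pi\<^sub>E (cells n) E) \<inter> space split_space"
    obtain d t z where dtz: "x = (d, t, z)" by (cases x) auto
    have in_E: "assemble n p (d, t, z) e \<in> E e" if "e \<in> cells n" for e
      using x that by (auto simp: dtz)
    have "d i \<in> E (i, i)" if "i \<in> {1..n}" for i
      using in_E[OF mem(1)[OF that]] assemble_apply(1)[OF that] by simp
    moreover have "t i \<in> E (i, p i)" if "i \<in> {1..n} - {r}" for i
    proof -
      have i: "i \<in> {1..n}" "i \<noteq> r" using that by auto
      show ?thesis using in_E[OF mem(2)[OF i(1)]] assemble_apply(2)[OF i] by simp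
    qed
    moreover have "z e \<in> E e" if "e \<in> non_tree n p" for e
      using in_E[of e] assemble_apply(3)[OF that] that by (auto simp: non_tree_def)
    ultimately show "x \<in> ?A \<times> (?B \<times> ?C)"
      using x by (auto simp: dtz space_pair_measure space_PiM PiE_iff)
  next
    fix x assume "x \<in> ?A \<times> (?B \<times> ?C)"
    then obtain d t z where dtz: "x = (d, t, z)" and d: "d \<in> ?A" and t: "t \<in> ?B" and z: "z \<in> ?C"
      by auto
    have "assemble n p (d, t, z) (i, j) \<in> E (i, j)" if ij: "i \<in> {1..n}" "j \<in> {1..n}" for i j
    proof -
      consider "j = i" | "j \<noteq> i" "j = p i" | "(i, j) \<in> non_tree n p"
        using ij by (auto simp: non_tree_def)
      then show ?thesis
      proof cases
        case 2
        then have "i \<in> {1..n} - {r}" using ij parent_mapsD(1)[OF p] by auto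
        then show ?thesis using assemble_apply(2) t 2 by (auto simp: PiE_iff)
      qed (use assemble_apply(1,3) d z ij in \<open>auto simp: PiE_iff\<close>)
    qed
    then show "x \<in> assemble n p -` (Pi\<^sub>E (cells n) E) \<inter> space split_space"
      using d t z by (auto simp: dtz space_pair_measure space_PiM PiE_iff assemble_def)
  qed
  have Em: "E (i, i) \<in> sets lborel" if "i \<in> {1..n}" for i
    by (rule E[OF mem(1)[OF that]])
  have Em': "E (i, p i) \<in> sets lborel" if "i \<in> {1..n} - {r}" for i
    by (rule E[OF mem(2)[OF DiffD1[OF that]]])
  have Em'': "E e \<in> sets lborel" if "e \<in> non_tree n p" for e
  proof (rule E)
    show "e \<in> cells n" using that unfolding non_tree_def by blast
  qed
  have box: "Pi\<^sub>E (cells n) E \<in> sets (lborel_on (cells n))"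
    by (intro sets_PiM_I_finite finite_cartesian_product finite_atLeastAtMost E)
  have A: "?A \<in> sets (lborel_on {1..n})"
    by (intro sets_PiM_I_finite finite_atLeastAtMost Em)
  have B: "?B \<in> sets (lborel_on ({1..n} - {r}))"
    by (intro sets_PiM_I_finite finite_Diff finite_atLeastAtMost Em')
  have C: "?C \<in> sets (lborel_on (non_tree n p))"
    by (intro sets_PiM_I_finite finite_non_tree Em'')
  have sfC: "sigma_finite_measure (lborel_on (non_tree n p))" by (rule sigma_finite_lborel_on[OF finite_non_tree])
  have "sigma_finite_measure (lborel_on ({1..n} - {r}))" by (rule sigma_finite_lborel_on) simp
  then have sfJC: "sigma_finite_measure (lborel_on ({1..n} - {r}) \<Otimes>\<^sub>M lborel_on (non_tree n p))"
    using sfC by (rule sigma_finite_pair_measure)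
  have "emeasure (distr split_space (lborel_on (cells n)) (assemble n p)) (Pi\<^sub>E (cells n) E)
      = emeasure split_space (?A \<times> (?B \<times> ?C))"
    by (simp only: emeasure_distr[OF measurable_assemble box] pre)
  also have "\<dots> = emeasure (lborel_on {1..n}) ?A *
      (emeasure (lborel_on ({1..n} - {r})) ?B * emeasure (lborel_on (non_tree n p)) ?C)"
    by (simp only: sigma_finite_measure.emeasure_pair_measure_Times[OF sfJC A pair_measureI[OF B C]]
        sigma_finite_measure.emeasure_pair_measure_Times[OF sfC B C])
  also have "\<dots> = (\<Prod>i\<in>{1..n}. emeasure lborel (E (i, i))) *
      ((\<Prod>i\<in>{1..n} - {r}. emeasure lborel (E (i, p i))) * (\<Prod>e\<in>non_tree n p. emeasure lborel (E e)))"
    by (simp only: PiM[OF finite_atLeastAtMost Em] PiM[OF finite_Diff[OF finite_atLeastAtMost] Em']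
        PiM[OF finite_non_tree Em''])
  also have "\<dots> = (\<Prod>e\<in>cells n. emeasure lborel (E e))"
    by (rule prod_matrix_split[OF p, symmetric])
  finally show "emeasure (distr split_space (lborel_on (cells n)) (assemble n p))
      (Pi\<^sub>E (cells n) E) = (\<Prod>e\<in>cells n. emeasure lborel (E e))" .
qed

lemma nn_integral_assemble:
  assumes G: "G \<in> borel_measurable (lborel_on (cells n))"
  shows "(\<integral>\<^sup>+y. G y \<partial>lborel_on (cells n)) =
    (\<integral>\<^sup>+d. \<integral>\<^sup>+t. \<integral>\<^sup>+z. G (assemble n p (d, t, z)) \<partial>lborel_on (non_tree n p)
      \<partial>lborel_on ({1..n} - {r}) \<partial>lborel_on {1..n})"
    and "d \<in> space (lborel_on {1..n}) \<Longrightarrow>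
      (\<lambda>t. \<integral>\<^sup>+z. G (assemble n p (d, t, z)) \<partial>lborel_on (non_tree n p)) \<in> borel_measurable (lborel_on ({1..n} - {r}))"
proof -
  let ?JC = "lborel_on ({1..n} - {r}) \<Otimes>\<^sub>M lborel_on (non_tree n p)"
  have sfC: "sigma_finite_measure (lborel_on (non_tree n p))" by (rule sigma_finite_lborel_on[OF finite_non_tree])
  have "sigma_finite_measure (lborel_on ({1..n} - {r}))" by (rule sigma_finite_lborel_on) simp
  then have sfJC: "sigma_finite_measure ?JC"
    using sfC by (rule sigma_finite_pair_measure)
  have GA: "(\<lambda>w. G (assemble n p w)) \<in> borel_measurable split_space"
    by (rule measurable_compose[OF measurable_assemble G])
  have Gd: "(\<lambda>w. G (assemble n p (d, w))) \<in> borel_measurable ?JC" if "d \<in> space (lborel_on {1..n})" for d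
    using measurable_Pair2[OF GA that] .
  show "(\<lambda>t. \<integral>\<^sup>+z. G (assemble n p (d, t, z)) \<partial>lborel_on (non_tree n p)) \<in> borel_measurable (lborel_on ({1..n} - {r}))"
    if "d \<in> space (lborel_on {1..n})"
    by (rule sigma_finite_measure.borel_measurable_nn_integral_fst[OF sfC Gd[OF that]])
  have "(\<integral>\<^sup>+y. G y \<partial>lborel_on (cells n)) = (\<integral>\<^sup>+w. G (assemble n p w) \<partial>split_space)"
    by (rule nn_integral_distr[OF measurable_assemble, unfolded distr_assemble, OF G])
  also have "\<dots> = (\<integral>\<^sup>+d. \<integral>\<^sup>+w. G (assemble n p (d, w)) \<partial>?JC \<partial>lborel_on {1..n})"
    by (rule sigma_finite_measure.nn_integral_fst[OF sfJC GA, symmetric])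
  also have "\<dots> = (\<integral>\<^sup>+d. \<integral>\<^sup>+t. \<integral>\<^sup>+z. G (assemble n p (d, t, z)) \<partial>lborel_on (non_tree n p)
      \<partial>lborel_on ({1..n} - {r}) \<partial>lborel_on {1..n})"
    by (intro nn_integral_cong sigma_finite_measure.nn_integral_fst[OF sfC Gd, symmetric])
  finally show "(\<integral>\<^sup>+y. G y \<partial>lborel_on (cells n)) = \<dots>" .
qed

text \<open>
  Entries on the tree are replaced by \<open>n\<close> times the potential that they produce. Each entry is an affine
  function of the new variable at its tail, with slope \<open>- 1 / n\<close> and an offset that involves only the
  new variable at the parent, so the substitution is triangular in the number of steps to the root.
\<close>
lemma nn_integral_tree_entries:
  assumes n: "n \<ge> 1" and G: "G \<in> borel_measurable (lborel_on ({1..n} - {r}))"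
  shows "(\<integral>\<^sup>+t. G t \<partial>lborel_on ({1..n} - {r})) =
    ennreal ((1 / real n) ^ (n - 1)) * (\<integral>\<^sup>+x. G (tree_entries n r p d (x(r := 0))) \<partial>lborel_on ({1..n} - {r}))"
proof -
  obtain h :: "nat \<Rightarrow> nat" where h: "\<And>i. i \<in> {1..n} \<Longrightarrow> i \<noteq> r \<Longrightarrow> h (p i) < h i"
    using parent_rank[OF p] by blast
  define \<phi> where "\<phi> i x = d i + (x(r := 0)) (p i) / real n" for i and x :: "nat \<Rightarrow> real"
  have entries: "(\<lambda>i\<in>{1..n} - {r}. \<phi> i x + - 1 / real n * x i) = tree_entries n r p d (x(r := 0))" for x
    by (auto simp: \<phi>_def tree_entries_def fun_eq_iff diff_divide_distrib)
  have "(\<integral>\<^sup>+t. G t \<partial>lborel_on ({1..n} - {r})) =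
      ennreal (\<bar>- 1 / real n\<bar> ^ card ({1..n} - {r})) *
      (\<integral>\<^sup>+x. G (\<lambda>i\<in>{1..n} - {r}. \<phi> i x + - 1 / real n * x i) \<partial>lborel_on ({1..n} - {r}))"
  proof (rule nn_integral_triangular_affine[where h = h, OF _ _ G])
    show "\<phi> i \<in> borel_measurable (lborel_on ({1..n} - {r}))" if i: "i \<in> {1..n} - {r}" for i
    proof (cases "p i = r")
      case False
      then have "p i \<in> {1..n} - {r}" using parent_mapsD(2)[OF p] i by auto
      then have "(\<lambda>x. d i + x (p i) / real n) \<in> borel_measurable (lborel_on ({1..n} - {r}))"
        by (intro borel_measurable_add borel_measurable_divide borel_measurable_const
            borel_measurable_lborel_on_component)
      then show ?thesis using False by (simp add: \<phi>_def[abs_def])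
    qed (simp add: \<phi>_def[abs_def])
    show "\<phi> i (x(j := v)) = \<phi> i x" if "i \<in> {1..n} - {r}" "j \<in> {1..n} - {r}" "h i \<le> h j" for i j x v
    proof -
      have "p i \<noteq> j" using h[of i] that by auto
      then show ?thesis using that by (simp add: \<phi>_def)
    qed
  qed (use n in auto)
  also have "\<bar>- 1 / real n\<bar> ^ card ({1..n} - {r}) = (1 / real n) ^ (n - 1)"
    using r by (simp add: card_Diff_singleton)
  finally show ?thesis by (simp only: entries)
qed

lemma tree_potential_assemble:
  assumes "n \<ge> 1" "x r = 0" "i \<in> {1..n}"
  shows "tree_potential n r p (curry (assemble n p (d, tree_entries n r p d x, z))) i = x i / real n"
proof (rule tree_potential_unique[OF p, symmetric])
  fix i assume i: "i \<in> {1..n}" "i \<noteq> r"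
  then show "x i / real n = curry (assemble n p (d, tree_entries n r p d x, z)) i i
      - curry (assemble n p (d, tree_entries n r p d x, z)) i (p i) + x (p i) / real n"
    using assemble_apply(1)[OF i(1)] assemble_apply(2)[OF i]
    by (simp add: tree_entries_def diff_divide_distrib)
qed (use assms in auto)

end

section \<open>The contribution of one tree\<close>

lemma emeasure_unit_interval_above:
  "emeasure lborel {v::real. 0 \<le> v \<and> v \<le> 1 \<and> c < v} = ennreal (rho n (real n * c))" if "n \<ge> 1"
proof (cases "c < 0")
  case True
  then have "{v::real. 0 \<le> v \<and> v \<le> 1 \<and> c < v} = {0..1}" by auto
  moreover have "rho n (real n * c) = 1"
    using True by (simp add: rho_def max_def mult_le_0_iff)
  ultimately show ?thesis by simp
next
  case False
  then have "{v::real. 0 \<le> v \<and> v \<le> 1 \<and> c < v} = {c<..1}" by auto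
  moreover have "rho n (real n * c) = max (1 - c) 0"
    using False that by (simp add: rho_def)
  moreover have "emeasure lborel {c<..1} = ennreal (max (1 - c) 0)"
    by (cases "c \<le> 1") simp_all
  ultimately show ?thesis by simp
qed

lemma rho_times_omega:
  assumes "n \<ge> 1"
  shows "rho n t * omega n t = indicator {0..<1} (t / real n)"
proof (cases "0 \<le> t \<and> t < real n")
  case True
  then have "t / real n < 1" "0 \<le> t / real n" by simp_all
  then show ?thesis using True by (simp add: rho_def omega_def)
next
  case False
  then have "\<not> (0 \<le> t / real n \<and> t / real n < 1)"
    using assms by (simp add: zero_le_divide_iff divide_less_eq_1)
  then show ?thesis using False by (auto simp: omega_def indicator_def)
qed

lemma rho_nonneg: "0 \<le> rho n t"
  by (simp add: rho_def)

lemma omega_nonneg: "0 \<le> omega n t"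
  by (auto simp: omega_def)

lemma borel_measurable_rho [measurable]: "rho n \<in> borel_measurable borel"
  unfolding rho_def[abs_def] by measurable

lemma borel_measurable_omega [measurable]: "omega n \<in> borel_measurable borel"
  unfolding omega_def[abs_def] by measurable

text \<open>
  The value of \<open>(D, U)\<close> if the given tree is the shortest-path tree and the identity is optimal.
\<close>
definition tree_point :: "nat \<Rightarrow> nat \<Rightarrow> (nat \<Rightarrow> nat) \<Rightarrow> (nat \<times> nat \<Rightarrow> real) \<Rightarrow>
    (nat \<Rightarrow> real) \<times> (nat \<Rightarrow> real)" where
  "tree_point n r p y = (\<lambda>i\<in>{1..n}. real n * y (i, i),
     \<lambda>i\<in>{1..n}. real n * (tree_potential n r p (curry y) i
       - (\<Sum>k\<in>{1..n}. tree_potential n r p (curry y) k) / real n))"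

lemma measurable_H0_measureI:
  assumes "\<And>i. i \<in> {1..n} \<Longrightarrow> (\<lambda>x. f x i) \<in> borel_measurable N"
    and "\<And>x. x \<in> space N \<Longrightarrow> f x \<in> H0 n"
  shows "f \<in> measurable N (H0_measure n)"
proof -
  have "f x = (\<lambda>i\<in>{1..n}. f x i)" if "x \<in> space N" for x
    using assms(2)[OF that] by (auto simp: H0_def PiE_iff extensional_def fun_eq_iff)
  then have "f \<in> measurable N (PiM {1..n} (\<lambda>_. borel)) \<longleftrightarrow>
      (\<lambda>x. \<lambda>i\<in>{1..n}. f x i) \<in> measurable N (PiM {1..n} (\<lambda>_. borel))"
    by (intro measurable_cong)
  then have "f \<in> measurable N (PiM {1..n} (\<lambda>_. borel))"
  proof (rule iffD2)
    show "(\<lambda>x. \<lambda>i\<in>{1..n}. f x i) \<in> measurable N (PiM {1..n} (\<lambda>_. borel))"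
      by (rule measurable_restrict) (rule assms(1))
  qed
  then have "f \<in> measurable N (restrict_space (PiM {1..n} (\<lambda>_. borel)) (H0 n))"
    using assms(2) by (intro measurable_restrict_space2) auto
  then show ?thesis by (simp cong: measurable_cong_sets add: sets_H0_measure)
qed

lemma centered_in_H0:
  "(\<lambda>i\<in>{1..n}. c * (q i - (\<Sum>k\<in>{1..n}. q k) / real n)) \<in> H0 n" if n: "n \<ge> 1"
proof -
  let ?S = "\<Sum>k\<in>{1..n}. q k"
  have "(\<Sum>i\<in>{1..n}. c * (q i - ?S / real n)) = c * (\<Sum>i\<in>{1..n}. q i - ?S / real n)"
    by (rule sum_distrib_left[symmetric])
  also have "(\<Sum>i\<in>{1..n}. q i - ?S / real n) = 0" using n by (simp add: sum_subtractf)
  finally show ?thesis by (simp add: H0_def)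
qed

lemma measurable_tree_point:
  assumes n: "n \<ge> 1" and p: "p \<in> parent_maps n r"
  shows "tree_point n r p \<in> measurable (lborel_on (cells n)) (ref_measure n)"
  unfolding ref_measure_def tree_point_def
proof (intro measurable_Pair measurable_restrict measurable_H0_measureI)
  fix i assume i: "i \<in> {1..n}"
  show "(\<lambda>y. real n * y (i, i)) \<in> measurable (lborel_on (cells n)) lborel"
  proof -
    have "(\<lambda>y. real n * y (i, i)) \<in> borel_measurable (lborel_on (cells n))"
      using i by (intro borel_measurable_times borel_measurable_const borel_measurable_lborel_on_component) auto
    then show ?thesis by simp
  qed
  have "(\<lambda>y. real n * (tree_potential n r p (curry y) i
       - (\<Sum>k\<in>{1..n}. tree_potential n r p (curry y) k) / real n)) \<in> borel_measurable (lborel_on (cells n))"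
    by (intro borel_measurable_times borel_measurable_diff borel_measurable_divide borel_measurable_sum
        borel_measurable_const borel_measurable_tree_potential p i)
  then show "(\<lambda>y. (\<lambda>i\<in>{1..n}. real n * (tree_potential n r p (curry y) i
       - (\<Sum>k\<in>{1..n}. tree_potential n r p (curry y) k) / real n)) i) \<in> borel_measurable (lborel_on (cells n))"
    using i by simp
qed (rule centered_in_H0[OF n])

text \<open>
  The summand of the density that belongs to one arborescence. For a tree edge the factor
  \<open>rho * omega\<close> is the indicator that the entry forced by the potential lies in \<open>[0, 1)\<close>.
\<close>
definition tree_weight ::
    "nat \<Rightarrow> nat \<Rightarrow> (nat \<Rightarrow> nat) \<Rightarrow> (nat \<Rightarrow> real) \<Rightarrow> (nat \<Rightarrow> real) \<Rightarrow> real" where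
  "tree_weight n r p D U = of_bool (\<forall>i\<in>{1..n}. 0 \<le> D i \<and> D i \<le> real n)
     * (\<Prod>(i, j)\<in>off_diag n. rho n (D i + U j - U i))
     * (\<Prod>i\<in>{1..n} - {r}. omega n (D i + U (p i) - U i))"

lemma tree_weight_nonneg: "0 \<le> tree_weight n r p D U"
  unfolding tree_weight_def
  by (intro mult_nonneg_nonneg prod_nonneg) (auto simp: rho_nonneg omega_nonneg split: prod.split)

abbreviation tree_mass ::
    "nat \<Rightarrow> nat \<Rightarrow> (nat \<Rightarrow> nat) \<Rightarrow> ((nat \<Rightarrow> real) \<times> (nat \<Rightarrow> real)) set \<Rightarrow> ennreal" where
  "tree_mass n r p B \<equiv>
     \<integral>\<^sup>+D. \<integral>\<^sup>+U. ennreal (tree_weight n r p D U) * indicator B (D, U) \<partial>H0_measure n \<partial>lborel_on {1..n}"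

abbreviation tree_event :: "nat \<Rightarrow> nat \<Rightarrow> (nat \<Rightarrow> nat) \<Rightarrow>
    ((nat \<Rightarrow> real) \<times> (nat \<Rightarrow> real)) set \<Rightarrow> (nat \<times> nat \<Rightarrow> real) \<Rightarrow> ennreal" where
  "tree_event n r p B y \<equiv> indicator {y. strict_tree n r p (curry y)} y * indicator B (tree_point n r p y)"

abbreviation unit_cube :: "nat \<Rightarrow> (nat \<times> nat \<Rightarrow> real) set" where
  "unit_cube n \<equiv> PiE (cells n) (\<lambda>_. {0..1})"

lemma prod_indicator_eq:
  "finite S \<Longrightarrow> (\<Prod>i\<in>S. indicator (A i) (f i)) = (of_bool (\<forall>i\<in>S. f i \<in> A i) :: ennreal)"
  by (induction S rule: finite_induct) (auto simp: indicator_def)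

context
  fixes n r :: nat and p :: "nat \<Rightarrow> nat" and B :: "((nat \<Rightarrow> real) \<times> (nat \<Rightarrow> real)) set"
  assumes n: "n \<ge> 1" and r: "r \<in> {1..n}" and p: "p \<in> parent_maps n r"
    and B: "B \<in> sets (ref_measure n)"
begin

text \<open>
  The integral over the entries off the diagonal and off the tree, as a function of the diagonal
  \<open>d\<close> and of \<open>n\<close> times the potential. Half-open intervals on the tree reproduce the boundary
  convention of \<open>omega\<close>.
\<close>
definition split_density :: "(nat \<Rightarrow> real) \<Rightarrow> (nat \<Rightarrow> real) \<Rightarrow> ennreal" where
  "split_density d x = (\<Prod>i\<in>{1..n}. indicator {0..1} (d i))
     * (\<Prod>i\<in>{1..n} - {r}. indicator {0..<1} (d i + (x (p i) - x i) / real n))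
     * indicator B (\<lambda>i\<in>{1..n}. real n * d i, \<lambda>i\<in>{1..n}. 1 * (x i - (\<Sum>k\<in>{1..n}. x k) / real n))
     * (\<Prod>(i, j)\<in>non_tree n p. ennreal (rho n (real n * (d i + (x j - x i) / real n))))"

lemma borel_measurable_split_density:
  "(\<lambda>w. split_density (fst w) (snd w)) \<in> borel_measurable (lborel_on {1..n} \<Otimes>\<^sub>M lborel_on {1..n})"
proof -
  let ?N = "lborel_on {1..n} \<Otimes>\<^sub>M lborel_on {1..n} :: ((nat \<Rightarrow> real) \<times> (nat \<Rightarrow> real)) measure"
  have c1: "(\<lambda>w. fst w i) \<in> borel_measurable ?N" if "i \<in> {1..n}" for i
    by (rule measurable_compose[OF measurable_fst borel_measurable_lborel_on_component[OF that]])
  have c2: "(\<lambda>w. snd w i) \<in> borel_measurable ?N" if "i \<in> {1..n}" for i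
    by (rule measurable_compose[OF measurable_snd borel_measurable_lborel_on_component[OF that]])
  have ind: "(\<lambda>w. indicator S (f w) :: ennreal) \<in> borel_measurable ?N"
    if "f \<in> borel_measurable ?N" "S \<in> sets borel" for f and S :: "real set"
    by (rule measurable_compose[OF that(1) borel_measurable_indicator[OF that(2)]])
  have diff: "(\<lambda>w. fst w i + (snd w j - snd w i) / real n) \<in> borel_measurable ?N"
    if "i \<in> {1..n}" "j \<in> {1..n}" for i j
    by (intro borel_measurable_add borel_measurable_divide borel_measurable_diff borel_measurable_const c1 c2 that)
  have pt: "(\<lambda>w. (\<lambda>i\<in>{1..n}. real n * fst w i,
      \<lambda>i\<in>{1..n}. 1 * (snd w i - (\<Sum>k\<in>{1..n}. snd w k) / real n))) \<in> measurable ?N (ref_measure n)"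
    unfolding ref_measure_def
  proof (intro measurable_Pair measurable_restrict measurable_H0_measureI)
    fix i assume i: "i \<in> {1..n}"
    have "(\<lambda>w. real n * fst w i) \<in> borel_measurable ?N"
      by (intro borel_measurable_times borel_measurable_const c1 i)
    then show "(\<lambda>w. real n * fst w i) \<in> measurable ?N lborel" by simp
    have "(\<lambda>w. 1 * (snd w i - (\<Sum>k\<in>{1..n}. snd w k) / real n)) \<in> borel_measurable ?N"
      by (intro borel_measurable_times borel_measurable_diff borel_measurable_divide borel_measurable_sum
          borel_measurable_const c2 i)
    then show "(\<lambda>w. (\<lambda>i\<in>{1..n}. 1 * (snd w i - (\<Sum>k\<in>{1..n}. snd w k) / real n)) i)
        \<in> borel_measurable ?N" using i by simp
  qed (rule centered_in_H0[OF n])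
  have f1: "(\<lambda>w. \<Prod>i\<in>{1..n}. indicator {0..1} (fst w i) :: ennreal) \<in> borel_measurable ?N"
    by (intro borel_measurable_prod_ennreal ind c1) auto
  have f2: "(\<lambda>w. \<Prod>i\<in>{1..n} - {r}. indicator {0..<1} (fst w i + (snd w (p i) - snd w i) / real n) :: ennreal)
      \<in> borel_measurable ?N"
    using parent_mapsD(2)[OF p] by (intro borel_measurable_prod_ennreal ind diff) auto
  have f3: "(\<lambda>w. indicator B (\<lambda>i\<in>{1..n}. real n * fst w i,
      \<lambda>i\<in>{1..n}. 1 * (snd w i - (\<Sum>k\<in>{1..n}. snd w k) / real n)) :: ennreal) \<in> borel_measurable ?N"
    by (rule measurable_compose[OF pt borel_measurable_indicator[OF B]])
  have f4: "(\<lambda>w. \<Prod>(i, j)\<in>non_tree n p.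
      ennreal (rho n (real n * (fst w i + (snd w j - snd w i) / real n)))) \<in> borel_measurable ?N"
    unfolding case_prod_unfold
  proof (intro borel_measurable_prod_ennreal)
    fix e assume "e \<in> non_tree n p"
    then have "fst e \<in> {1..n}" "snd e \<in> {1..n}" by (auto simp: non_tree_def)
    then have "(\<lambda>w. real n * (fst w (fst e) + (snd w (snd e) - snd w (fst e)) / real n)) \<in> borel_measurable ?N"
      by (intro borel_measurable_times borel_measurable_const diff)
    then show "(\<lambda>w. ennreal (rho n (real n * (fst w (fst e) + (snd w (snd e) - snd w (fst e)) / real n))))
        \<in> borel_measurable ?N"
      by (intro measurable_compose[OF _ measurable_ennreal] measurable_compose[OF _ borel_measurable_rho])
  qed
  show ?thesis
    unfolding split_density_def by (intro borel_measurable_times_ennreal f1 f2 f3 f4)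
qed

definition strict_region :: "(nat \<times> nat \<Rightarrow> real) set" where
  "strict_region = {y \<in> space (lborel_on (cells n)). (\<forall>e\<in>cells n. 0 \<le> y e \<and> y e \<le> 1)
     \<and> (\<forall>i\<in>{1..n} - {r}. y (i, p i) < 1) \<and> strict_tree n r p (curry y)}"

lemma sets_strict_region: "strict_region \<in> sets (lborel_on (cells n))"
proof -
  let ?L = "lborel_on (cells n) :: (nat \<times> nat \<Rightarrow> real) measure"
  have c: "(\<lambda>y. y e) \<in> borel_measurable ?L" if "e \<in> cells n" for e
    by (rule borel_measurable_lborel_on_component[OF that])
  have "(i, p i) \<in> cells n" if "i \<in> {1..n} - {r}" for i
    using that parent_mapsD(2)[OF p] by auto
  then show ?thesis
    unfolding strict_region_def
    by (intro sets.sets_Collect_conj sets.sets_Collect_finite_All finite_cartesian_product finite_Diff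
        finite_atLeastAtMost borel_measurable_le borel_measurable_less borel_measurable_const c
        sets_strict_tree p)
qed

text \<open>
  With the diagonal and the potential fixed, strictness only asks each remaining entry to exceed its own
  threshold, so the integral over these entries factorizes into the functions \<open>rho\<close>.
\<close>
lemma non_tree_integral:
  assumes d: "d \<in> space (lborel_on {1..n})" and x: "x r = 0"
  shows "(\<integral>\<^sup>+z. indicator strict_region (assemble n p (d, tree_entries n r p d x, z))
      * indicator B (tree_point n r p (assemble n p (d, tree_entries n r p d x, z))) \<partial>lborel_on (non_tree n p))
    = split_density d x"
proof -
  let ?C = "non_tree n p"
  let ?y = "\<lambda>z. assemble n p (d, tree_entries n r p d x, z)"
  define c where "c e = d (fst e) + (x (snd e) - x (fst e)) / real n" for e
  define A where "A e = {v::real. 0 \<le> v \<and> v \<le> 1 \<and> c e < v}" for e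
  define K :: ennreal where "K = (\<Prod>i\<in>{1..n}. indicator {0..1} (d i))
     * (\<Prod>i\<in>{1..n} - {r}. indicator {0..<1} (d i + (x (p i) - x i) / real n))
     * indicator B (\<lambda>i\<in>{1..n}. real n * d i, \<lambda>i\<in>{1..n}. 1 * (x i - (\<Sum>k\<in>{1..n}. x k) / real n))"
  have tp: "tree_potential n r p (curry (?y z)) i = x i / real n" if "i \<in> {1..n}" for z i
    using tree_potential_assemble[where x = x, OF r p n x that] .
  have diag: "?y z (i, i) = d i" if "i \<in> {1..n}" for z i
    using assemble_apply(1)[OF r p that] .
  have tree: "?y z (i, p i) = d i + (x (p i) - x i) / real n" if "i \<in> {1..n} - {r}" for z i
    using assemble_apply(2)[OF r p, of i] that by (simp add: tree_entries_def)
  have rest: "?y z e = z e" if "e \<in> ?C" for z e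
    using assemble_apply(3)[OF r p that] .
  have point: "tree_point n r p (?y z) = (\<lambda>i\<in>{1..n}. real n * d i,
      \<lambda>i\<in>{1..n}. 1 * (x i - (\<Sum>k\<in>{1..n}. x k) / real n))" for z
  proof -
    have "(\<Sum>k\<in>{1..n}. tree_potential n r p (curry (?y z)) k) = (\<Sum>k\<in>{1..n}. x k) / real n"
      by (simp add: tp sum_divide_distrib)
    then have "real n * (tree_potential n r p (curry (?y z)) i
          - (\<Sum>k\<in>{1..n}. tree_potential n r p (curry (?y z)) k) / real n)
        = 1 * (x i - (\<Sum>k\<in>{1..n}. x k) / real n)" if "i \<in> {1..n}" for i
      using n that by (simp add: tp right_diff_distrib)
    then show ?thesis
      unfolding tree_point_def by (simp only: prod.inject) (intro conjI restrict_ext, simp_all only: diag)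
  qed
  have strict: "strict_tree n r p (curry (?y z)) \<longleftrightarrow> (\<forall>e\<in>?C. c e < z e)" for z
  proof -
    have "(tree_potential n r p (curry (?y z)) j - tree_potential n r p (curry (?y z)) i
        < curry (?y z) i j - curry (?y z) i i) \<longleftrightarrow> c (i, j) < z (i, j)" if "(i, j) \<in> ?C" for i j
    proof -
      have ij: "i \<in> {1..n}" "j \<in> {1..n}" using that by (auto simp: non_tree_def)
      show ?thesis
        unfolding curry_conv tp[OF ij(1)] tp[OF ij(2)] diag[OF ij(1)] rest[OF that]
        by (auto simp: c_def diff_divide_distrib)
    qed
    then show ?thesis
      unfolding strict_tree_def by (auto simp: non_tree_def)
  qed
  have cube: "(\<forall>e\<in>cells n. 0 \<le> ?y z e \<and> ?y z e \<le> 1) \<longleftrightarrow>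
      (\<forall>i\<in>{1..n}. 0 \<le> d i \<and> d i \<le> 1) \<and>
      (\<forall>i\<in>{1..n} - {r}. 0 \<le> d i + (x (p i) - x i) / real n \<and> d i + (x (p i) - x i) / real n \<le> 1) \<and>
      (\<forall>e\<in>?C. 0 \<le> z e \<and> z e \<le> 1)" (is "?lhs \<longleftrightarrow> ?rhs") for z
  proof
    assume L: ?lhs
    have "0 \<le> d i \<and> d i \<le> 1" if "i \<in> {1..n}" for i
      using L[rule_format, of "(i, i)"] that diag[OF that, of z] by simp
    moreover have "0 \<le> d i + (x (p i) - x i) / real n \<and> d i + (x (p i) - x i) / real n \<le> 1"
      if "i \<in> {1..n} - {r}" for i
      using L[rule_format, of "(i, p i)"] that parent_mapsD(2)[OF p, of i] tree[OF that, of z] by simp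
    moreover have "0 \<le> z e \<and> z e \<le> 1" if "e \<in> ?C" for e
      using L[rule_format, of e] that rest[OF that, of z] by (auto simp: non_tree_def)
    ultimately show ?rhs by blast
  next
    assume R: ?rhs
    show ?lhs
    proof
      fix e assume e: "e \<in> cells n"
      obtain i j where ij: "e = (i, j)" by fastforce
      consider "j = i" | "j \<noteq> i" "j = p i" | "e \<in> ?C"
        using e by (auto simp: ij non_tree_def)
      then show "0 \<le> ?y z e \<and> ?y z e \<le> 1"
      proof cases
        case 1
        then show ?thesis using R e diag[of i z] by (simp add: ij)
      next
        case 2
        then have "i \<in> {1..n} - {r}" using e parent_mapsD(1)[OF p] by (auto simp: ij)
        then show ?thesis using R tree[of i z] 2 by (simp add: ij)
      next
        case 3
        then show ?thesis using R rest[of e z] by simp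
      qed
    qed
  qed
  have G: "indicator strict_region (?y z) * indicator B (tree_point n r p (?y z)) = K * (\<Prod>e\<in>?C. indicator (A e) (z e))"
    if z: "z \<in> space (lborel_on ?C)" for z
  proof -
    have sp: "?y z \<in> space (lborel_on (cells n))"
      by (auto simp: assemble_def space_PiM)
    have le1: "(\<forall>i\<in>{1..n} - {r}. 0 \<le> a i \<and> a i \<le> 1) \<and> (\<forall>i\<in>{1..n} - {r}. a i < 1)
        \<longleftrightarrow> (\<forall>i\<in>{1..n} - {r}. a i \<in> {0..<1})" for a :: "nat \<Rightarrow> real"
      unfolding atLeastLessThan_iff by (meson less_imp_le)
    have "(\<forall>i\<in>{1..n} - {r}. ?y z (i, p i) < 1)
        \<longleftrightarrow> (\<forall>i\<in>{1..n} - {r}. d i + (x (p i) - x i) / real n < 1)"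
      by (intro ball_cong refl) (simp only: tree)
    then have "?y z \<in> strict_region \<longleftrightarrow> (\<forall>i\<in>{1..n}. d i \<in> {0..1})
        \<and> (\<forall>i\<in>{1..n} - {r}. d i + (x (p i) - x i) / real n \<in> {0..<1}) \<and> (\<forall>e\<in>?C. z e \<in> A e)"
      unfolding strict_region_def mem_Collect_eq cube strict 
      using sp le1[of "\<lambda>i. d i + (x (p i) - x i) / real n"]
      by (simp only: A_def atLeastAtMost_iff mem_Collect_eq) blast
    then have "indicator strict_region (?y z) = ((\<Prod>i\<in>{1..n}. indicator {0..1} (d i))
        * (\<Prod>i\<in>{1..n} - {r}. indicator {0..<1} (d i + (x (p i) - x i) / real n))
        * (\<Prod>e\<in>?C. indicator (A e) (z e)) :: ennreal)"
      by (simp add: prod_indicator_eq finite_non_tree indicator_def)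
    then show ?thesis unfolding point K_def by (simp only: mult_ac)
  qed
  have A: "A e \<in> sets borel" for e unfolding A_def by measurable
  have "(\<integral>\<^sup>+z. indicator strict_region (?y z) * indicator B (tree_point n r p (?y z)) \<partial>lborel_on ?C)
      = (\<integral>\<^sup>+z. K * (\<Prod>e\<in>?C. indicator (A e) (z e)) \<partial>lborel_on ?C)"
    by (rule nn_integral_cong) (rule G)
  also have "\<dots> = K * (\<integral>\<^sup>+z. (\<Prod>e\<in>?C. indicator (A e) (z e)) \<partial>lborel_on ?C)"
    by (intro nn_integral_cmult borel_measurable_prod_ennreal
        measurable_compose[OF borel_measurable_lborel_on_component] borel_measurable_indicator A)
  also have "(\<integral>\<^sup>+z. (\<Prod>e\<in>?C. indicator (A e) (z e)) \<partial>lborel_on ?C)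
      = (\<Prod>e\<in>?C. \<integral>\<^sup>+v. indicator (A e) v \<partial>lborel)"
    using A by (intro product_sigma_finite.product_nn_integral_prod[OF product_sigma_finite_lborel finite_non_tree])
      simp
  also have "\<dots> = (\<Prod>(i, j)\<in>?C. ennreal (rho n (real n * (d i + (x j - x i) / real n))))"
    using A by (intro prod.cong refl)
      (simp add: case_prod_unfold A_def emeasure_unit_interval_above[OF n] c_def)
  finally show ?thesis unfolding split_density_def K_def .
qed


text \<open>
  On tree entries the closed and the half-open unit interval differ by a null set only.
\<close>
lemma tree_entry_neq_1:
  "AE y in lborel_on (cells n). \<forall>i\<in>{1..n} - {r}. y (i, p i) \<noteq> (1::real)"
proof (intro AE_finite_allI)
  fix i assume "i \<in> {1..n} - {r}"
  then have "(i, p i) \<in> cells n" using parent_mapsD(2)[OF p] by auto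
  then show "AE y in lborel_on (cells n). y (i, p i) \<noteq> (1::real)"
    by (intro AE_lborel_on_coordinate_neq) auto
qed simp

text \<open>
  Vectors of sum zero are already centred, and rescaling the diagonal by \<open>n\<close> recovers the weight of the
  tree.
\<close>
lemma split_density_scaled:
  assumes D: "D \<in> space (lborel_on {1..n})" and U: "U \<in> H0 n"
  shows "split_density (\<lambda>i\<in>{1..n}. 0 + 1 / real n * D i) U
    = ennreal (tree_weight n r p D U) * indicator B (D, U)"
proof -
  let ?d = "\<lambda>i\<in>{1..n}. 0 + 1 / real n * D i"
  let ?t = "\<lambda>i j. D i + U j - U i"
  have t: "?d i + (U j - U i) / real n = ?t i j / real n" if "i \<in> {1..n}" for i j
    using that by (simp add: add_divide_distrib diff_divide_distrib)
  have "sum U {1..n} = 0" and U_ext: "U \<in> extensional {1..n}"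
    using U by (auto simp: H0_def PiE_iff)
  then have "(\<lambda>i\<in>{1..n}. 1 * (U i - (\<Sum>k\<in>{1..n}. U k) / real n)) = U"
    by (simp add: extensional_restrict cong: restrict_cong)
  moreover have "(\<lambda>i\<in>{1..n}. real n * ?d i) = D"
    using D n by (auto simp: space_PiM PiE_iff extensional_def fun_eq_iff)
  moreover have "(\<Prod>i\<in>{1..n}. indicator {0..1} (?d i))
      = (of_bool (\<forall>i\<in>{1..n}. 0 \<le> D i \<and> D i \<le> real n) :: ennreal)"
  proof -
    have "?d i \<in> {0..1} \<longleftrightarrow> 0 \<le> D i \<and> D i \<le> real n" if "i \<in> {1..n}" for i
      using that n by (simp add: zero_le_divide_iff divide_le_eq_1)
    then show ?thesis by (simp only: prod_indicator_eq[OF finite_atLeastAtMost] cong: ball_cong)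
  qed
  moreover have "(\<Prod>i\<in>{1..n} - {r}. indicator {0..<1} (?d i + (U (p i) - U i) / real n))
      = ennreal (\<Prod>i\<in>{1..n} - {r}. rho n (?t i (p i)) * omega n (?t i (p i)))"
  proof (subst prod_ennreal[symmetric])
    show "0 \<le> rho n (?t i (p i)) * omega n (?t i (p i))" for i
      by (intro mult_nonneg_nonneg rho_nonneg omega_nonneg)
    show "(\<Prod>i\<in>{1..n} - {r}. indicator {0..<1} (?d i + (U (p i) - U i) / real n))
        = (\<Prod>i\<in>{1..n} - {r}. ennreal (rho n (?t i (p i)) * omega n (?t i (p i))))"
    proof (intro prod.cong refl)
      fix i assume "i \<in> {1..n} - {r}"
      then have "i \<in> {1..n}" by simp
      then show "indicator {0..<1} (?d i + (U (p i) - U i) / real n)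
          = ennreal (rho n (?t i (p i)) * omega n (?t i (p i)))"
        unfolding t[OF \<open>i \<in> {1..n}\<close>] rho_times_omega[OF n] by (simp add: indicator_def)
    qed
  qed
  moreover have "(\<Prod>(i, j)\<in>non_tree n p. ennreal (rho n (real n * (?d i + (U j - U i) / real n))))
      = ennreal (\<Prod>(i, j)\<in>non_tree n p. rho n (?t i j))"
  proof (subst prod_ennreal[symmetric])
    show "(\<Prod>(i, j)\<in>non_tree n p. ennreal (rho n (real n * (?d i + (U j - U i) / real n))))
      = (\<Prod>e\<in>non_tree n p. ennreal (case e of (i, j) \<Rightarrow> rho n (?t i j)))"
    proof (intro prod.cong refl)
      fix e assume "e \<in> non_tree n p"
      then obtain i j where e: "e = (i, j)" "i \<in> {1..n}" by (auto simp: non_tree_def)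
      show "(case e of (i, j) \<Rightarrow> ennreal (rho n (real n * (?d i + (U j - U i) / real n))))
          = ennreal (case e of (i, j) \<Rightarrow> rho n (?t i j))"
        unfolding e(1) prod.case t[OF e(2)] using n by simp
    qed
  qed (auto simp: rho_nonneg)
  ultimately have "split_density ?d U = of_bool (\<forall>i\<in>{1..n}. 0 \<le> D i \<and> D i \<le> real n)
      * ennreal (\<Prod>i\<in>{1..n} - {r}. rho n (?t i (p i)) * omega n (?t i (p i)))
      * indicator B (D, U) * ennreal (\<Prod>(i, j)\<in>non_tree n p. rho n (?t i j))"
    unfolding split_density_def by (simp only:)
  also have "\<dots> = ennreal (of_bool (\<forall>i\<in>{1..n}. 0 \<le> D i \<and> D i \<le> real n)
      * (\<Prod>i\<in>{1..n} - {r}. rho n (?t i (p i)) * omega n (?t i (p i)))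
      * (\<Prod>(i, j)\<in>non_tree n p. rho n (?t i j))) * indicator B (D, U)"
    by (simp add: ennreal_mult prod_nonneg rho_nonneg omega_nonneg case_prod_unfold mult_ac)
  also have "of_bool (\<forall>i\<in>{1..n}. 0 \<le> D i \<and> D i \<le> real n)
      * (\<Prod>i\<in>{1..n} - {r}. rho n (?t i (p i)) * omega n (?t i (p i)))
      * (\<Prod>(i, j)\<in>non_tree n p. rho n (?t i j)) = tree_weight n r p D U"
    unfolding tree_weight_def prod_off_diag_split[OF p] by (simp add: prod.distrib mult_ac)
  finally show ?thesis .
qed

text \<open>
  One tree contributes its weight. The powers of \<open>1 / n\<close> come from scaling the tree entries and the
  diagonal, and one factor \<open>n\<close> is returned by passing from potentials that vanish at the root to
  vectors of sum zero.
\<close>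
lemma nn_integral_strict_tree:
  "(\<integral>\<^sup>+y. indicator (unit_cube n) y *
      (tree_event n r p B y)
      \<partial>lborel_on (cells n))
   = ennreal ((1 / real n) ^ (2 * n - 2)) *
     (tree_mass n r p B)"
proof -
  let ?L = "lborel_on (cells n)" and ?J = "{1..n} - {r}"
  let ?g = "\<lambda>y. indicator strict_region y * indicator B (tree_point n r p y) :: ennreal"
  let ?T = "\<lambda>d t. \<integral>\<^sup>+z. ?g (assemble n p (d, t, z)) \<partial>lborel_on (non_tree n p)"
  let ?H = "\<lambda>d. \<integral>\<^sup>+U. split_density d U \<partial>H0_measure n"
  have g: "?g \<in> borel_measurable ?L"
    by (intro borel_measurable_times_ennreal borel_measurable_indicator sets_strict_region
        measurable_compose[OF measurable_tree_point[OF n p]] B)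
  note F1 = measurable_Pair2[OF borel_measurable_split_density, unfolded fst_conv snd_conv]
  have m: "(\<lambda>d. ?H d) \<in> borel_measurable (lborel_on {1..n})"
  proof -
    interpret sigma_finite_measure "H0_measure n" by (rule sigma_finite_H0_measure[OF n])
    have "sets (lborel_on {1..n}) = sets (PiM {1..n} (\<lambda>_. borel :: real measure))"
      by (intro sets_PiM_cong) auto
    then have "(\<lambda>U. U) \<in> measurable (PiM {1..n} (\<lambda>_. borel :: real measure)) (lborel_on {1..n})"
      by (intro measurable_ident_sets) simp
    then have "(\<lambda>U. U) \<in> measurable (H0_measure n) (lborel_on {1..n})"
      by (rule measurable_H0_measure_embed)
    then have "(\<lambda>w. (fst w, snd w)) \<in>
        measurable (lborel_on {1..n} \<Otimes>\<^sub>M H0_measure n) (lborel_on {1..n} \<Otimes>\<^sub>M lborel_on {1..n})"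
      by (intro measurable_Pair measurable_fst measurable_compose[OF measurable_snd])
    from measurable_compose[OF this borel_measurable_split_density]
    have "(\<lambda>w. split_density (fst w) (snd w)) \<in> borel_measurable (lborel_on {1..n} \<Otimes>\<^sub>M H0_measure n)"
      by simp
    from borel_measurable_nn_integral_fst[OF this]
    show "(\<lambda>d. ?H d) \<in> borel_measurable (lborel_on {1..n})"
      by simp
  qed
  have "(\<integral>\<^sup>+y. indicator (unit_cube n) y *
      (tree_event n r p B y) \<partial>?L)
    = (\<integral>\<^sup>+y. ?g y \<partial>?L)"
  proof (rule nn_integral_cong_AE, rule AE_mp[OF tree_entry_neq_1], intro AE_I2 impI)
    fix y :: "nat \<times> nat \<Rightarrow> real"
    assume y: "y \<in> space ?L" and neq: "\<forall>i\<in>?J. y (i, p i) \<noteq> 1"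
    have "y (i, p i) < 1" if "i \<in> ?J" "\<forall>e\<in>cells n. 0 \<le> y e \<and> y e \<le> 1" for i
    proof -
      have "(i, p i) \<in> cells n" using that(1) parent_mapsD(2)[OF p] by auto
      then have "y (i, p i) \<le> 1" using that(2) by blast
      then show ?thesis using neq that(1) by fastforce
    qed
    moreover have "y \<in> unit_cube n \<longleftrightarrow>
        (\<forall>e\<in>cells n. 0 \<le> y e \<and> y e \<le> 1)"
      using y by (auto simp: space_PiM PiE_iff)
    ultimately have "y \<in> strict_region \<longleftrightarrow>
        y \<in> unit_cube n \<and> y \<in> {y. strict_tree n r p (curry y)}"
      using y unfolding strict_region_def by blast
    then show "indicator (unit_cube n) y *
        (tree_event n r p B y) = ?g y"
      by (auto simp: indicator_def)
  qed
  also have "\<dots> = (\<integral>\<^sup>+d. \<integral>\<^sup>+t. ?T d t \<partial>lborel_on ?J \<partial>lborel_on {1..n})"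
    by (rule nn_integral_assemble(1)[OF r p g])
  also have "\<dots> = (\<integral>\<^sup>+d. ennreal ((1 / real n) ^ (n - 1) * real n) * (?H d)
      \<partial>lborel_on {1..n})"
  proof (rule nn_integral_cong)
    fix d :: "nat \<Rightarrow> real" assume d: "d \<in> space (lborel_on {1..n})"
    have "(\<integral>\<^sup>+t. ?T d t \<partial>lborel_on ?J)
      = ennreal ((1 / real n) ^ (n - 1)) * (\<integral>\<^sup>+x. ?T d (tree_entries n r p d (x(r := 0))) \<partial>lborel_on ?J)"
      by (rule nn_integral_tree_entries[OF r p n nn_integral_assemble(2)[OF r p g d]])
    also have "(\<integral>\<^sup>+x. ?T d (tree_entries n r p d (x(r := 0))) \<partial>lborel_on ?J) = (\<integral>\<^sup>+x. split_density d (x(r := 0)) \<partial>lborel_on ?J)"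
      by (intro nn_integral_cong non_tree_integral[OF d]) simp
    also have "\<dots> = ennreal (real n) * (?H d)"
    proof (rule nn_integral_change_of_transversal[OF n r F1[OF d]])
      fix x :: "nat \<Rightarrow> real" and s :: real
      let ?x = "\<lambda>i\<in>{1..n}. x i + s" and ?base = "\<lambda>i\<in>{1..n}. x i"
      have diff: "?x j - ?x i = ?base j - ?base i" if "i \<in> {1..n}" "j \<in> {1..n}" for i j
        using that by simp
      have "real n * s / real n = s" using n by simp
      moreover have "(\<Sum>k\<in>{1..n}. ?x k) = (\<Sum>k\<in>{1..n}. ?base k) + real n * s"
        by (simp add: sum.distrib)
      ultimately have "(\<Sum>k\<in>{1..n}. ?x k) / real n = (\<Sum>k\<in>{1..n}. ?base k) / real n + s"
        by (simp only: add_divide_distrib)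
      then have cen: "1 * (?x i - (\<Sum>k\<in>{1..n}. ?x k) / real n) = 1 * (?base i - (\<Sum>k\<in>{1..n}. ?base k) / real n)"
        if "i \<in> {1..n}" for i using that by simp
      have tree: "?x (p i) - ?x i = ?base (p i) - ?base i" if "i \<in> ?J" for i
        using that parent_mapsD(2)[OF p, of i] by (intro diff) auto
      have 1: "(\<Prod>i\<in>?J. indicator {0..<1} (d i + (?x (p i) - ?x i) / real n) :: ennreal)
          = (\<Prod>i\<in>?J. indicator {0..<1} (d i + (?base (p i) - ?base i) / real n))"
        by (intro prod.cong refl) (simp only: tree)
      have 2: "(\<lambda>i\<in>{1..n}. 1 * (?x i - (\<Sum>k\<in>{1..n}. ?x k) / real n))
          = (\<lambda>i\<in>{1..n}. 1 * (?base i - (\<Sum>k\<in>{1..n}. ?base k) / real n))"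
        by (intro restrict_ext cen)
      have 3: "(\<Prod>(i, j)\<in>non_tree n p. ennreal (rho n (real n * (d i + (?x j - ?x i) / real n))))
          = (\<Prod>(i, j)\<in>non_tree n p. ennreal (rho n (real n * (d i + (?base j - ?base i) / real n))))"
        by (intro prod.cong refl) (auto simp: non_tree_def)
      show "split_density d ?x = split_density d ?base"
        unfolding split_density_def 1 2 3 ..
    qed
    finally show "(\<integral>\<^sup>+t. ?T d t \<partial>lborel_on ?J)
      = ennreal ((1 / real n) ^ (n - 1) * real n) * (?H d)"
      by (simp add: ennreal_mult mult.assoc)
  qed
  also have "\<dots> = ennreal ((1 / real n) ^ (n - 1) * real n) *
      (\<integral>\<^sup>+d. ?H d \<partial>lborel_on {1..n})"
    by (rule nn_integral_cmult[OF m])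
  also have "(\<integral>\<^sup>+d. ?H d \<partial>lborel_on {1..n})
      = ennreal (\<bar>1 / real n\<bar> ^ card {1..n}) *
        (\<integral>\<^sup>+D. ?H (\<lambda>i\<in>{1..n}. 0 + 1 / real n * D i) \<partial>lborel_on {1..n})"
    using n by (intro nn_integral_lborel_on_affine m) auto
  also have "(\<integral>\<^sup>+D. ?H (\<lambda>i\<in>{1..n}. 0 + 1 / real n * D i) \<partial>lborel_on {1..n})
      = (tree_mass n r p B)"
    by (intro nn_integral_cong split_density_scaled) (simp_all only: space_H0_measure)
  also have "ennreal ((1 / real n) ^ (n - 1) * real n) * (ennreal (\<bar>1 / real n\<bar> ^ card {1..n}) * I)
      = ennreal ((1 / real n) ^ (2 * n - 2)) * I" for I
  proof -
    obtain m where m: "n = Suc m" using n by (cases n) auto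
    have "(1 / real n) ^ (n - 1) * real n * \<bar>1 / real n\<bar> ^ card {1..n} = (1 / real n) ^ (2 * n - 2)"
      by (simp add: m power_add[symmetric] mult_2[symmetric] power_divide)
    then show ?thesis by (simp add: mult.assoc[symmetric] ennreal_mult[symmetric])
  qed
  finally show ?thesis .
qed

end

section \<open>The law of the matrix\<close>

lemma density_cube_eq_PiM_uniform:
  assumes J: "finite J"
  shows "density (lborel_on J) (indicator (PiE J (\<lambda>_. {0..1}))) = PiM J (\<lambda>_. uniform_measure lborel {0..1::real})"
proof (rule product_sigma_finite.PiM_eqI[OF _ J])
  let ?u = "uniform_measure lborel {0..1::real}"
  interpret prob_space ?u by (rule prob_space_uniform_measure) simp_all
  show "product_sigma_finite (\<lambda>_. ?u)"
    by standard
  show "sets (density (lborel_on J) (indicator (PiE J (\<lambda>_. {0..1})))) = sets (PiM J (\<lambda>_. ?u))"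
    by (simp cong: sets_PiM_cong)
  fix A assume A: "\<And>i. i \<in> J \<Longrightarrow> A i \<in> sets ?u"
  have A': "A i \<in> sets borel" if "i \<in> J" for i using A[OF that] by simp
  have cube: "PiE J (\<lambda>_. {0..1::real}) \<in> sets (lborel_on J)"
    by (intro sets_PiM_I_finite J) simp
  have box: "PiE J A \<in> sets (lborel_on J)"
    using A' by (intro sets_PiM_I_finite J) simp
  have "emeasure (density (lborel_on J) (indicator (PiE J (\<lambda>_. {0..1})))) (PiE J A)
      = (\<integral>\<^sup>+x. indicator (PiE J (\<lambda>_. {0..1})) x * indicator (PiE J A) x \<partial>lborel_on J)"
    using cube box by (subst emeasure_density) simp_all
  also have "\<dots> = (\<integral>\<^sup>+x. indicator (PiE J (\<lambda>i. {0..1} \<inter> A i)) x \<partial>lborel_on J)"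
    by (intro nn_integral_cong) (auto simp: indicator_def PiE_iff)
  also have "\<dots> = emeasure (lborel_on J) (PiE J (\<lambda>i. {0..1} \<inter> A i))"
    using A' by (intro nn_integral_indicator sets_PiM_I_finite J) simp
  also have "\<dots> = (\<Prod>i\<in>J. emeasure lborel ({0..1} \<inter> A i))"
    using A' by (intro product_sigma_finite.emeasure_PiM[OF product_sigma_finite_lborel J]) simp
  also have "\<dots> = (\<Prod>i\<in>J. emeasure ?u (A i))"
    using A' by (intro prod.cong refl) (simp add: divide_ennreal_def)
  finally show "emeasure (density (lborel_on J) (indicator (PiE J (\<lambda>_. {0..1})))) (PiE J A)
      = (\<Prod>i\<in>J. emeasure ?u (A i))" .
qed

lemma measurable_matrix:
  fixes n :: nat and Y :: "nat \<Rightarrow> nat \<Rightarrow> 'a \<Rightarrow> real"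
  assumes "\<And>i j. i \<in> {1..n} \<Longrightarrow> j \<in> {1..n} \<Longrightarrow> Y i j \<in> borel_measurable M"
  shows "(\<lambda>\<omega>. \<lambda>(i, j)\<in>cells n. Y i j \<omega>) \<in> measurable M (PiM (cells n) (\<lambda>_. borel))"
proof (rule measurable_restrict)
  fix e assume "e \<in> cells n"
  then show "(\<lambda>\<omega>. case e of (i, j) \<Rightarrow> Y i j \<omega>) \<in> borel_measurable M"
    using assms by (cases e) simp
qed

lemma sets_lborel_on: "sets (lborel_on J) = sets (PiM J (\<lambda>_. borel))"
  by (intro sets_PiM_cong) simp_all

abbreviation uniform_matrix :: "nat \<Rightarrow> (nat \<times> nat \<Rightarrow> real) measure" where
  "uniform_matrix n \<equiv> density (lborel_on (cells n)) (indicator (unit_cube n))"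

lemma distr_uniform_matrix:
  fixes n :: nat and Y :: "nat \<Rightarrow> nat \<Rightarrow> 'a \<Rightarrow> real"
  assumes n: "n \<ge> 1" and M: "prob_space M"
    and indep: "prob_space.indep_vars M (\<lambda>_. borel) (\<lambda>(i, j). Y i j) (cells n)"
    and unif: "\<And>i j. i \<in> {1..n} \<Longrightarrow> j \<in> {1..n} \<Longrightarrow> distr M borel (Y i j) = uniform_measure lborel {0..1}"
  shows "distr M (PiM (cells n) (\<lambda>_. borel)) (\<lambda>\<omega>. \<lambda>(i, j)\<in>cells n. Y i j \<omega>)
    = uniform_matrix n"
proof -
  interpret prob_space M by fact
  let ?I = "cells n"
  have "(\<lambda>(i, j). Y i j) e \<in> borel_measurable M" if "e \<in> ?I" for e
    using indep that unfolding indep_vars_def by blast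
  moreover have "?I \<noteq> {}" 
  proof -
    have "(1, 1) \<in> ?I" using n by simp
    then show ?thesis by blast
  qed
  ultimately have "distr M (PiM ?I (\<lambda>_. borel)) (\<lambda>\<omega>. \<lambda>e\<in>?I. (\<lambda>(i, j). Y i j) e \<omega>)
      = PiM ?I (\<lambda>e. distr M borel ((\<lambda>(i, j). Y i j) e))"
    using indep by (subst (asm) indep_vars_iff_distr_eq_PiM') auto
  also have "\<dots> = PiM ?I (\<lambda>_. uniform_measure lborel {0..1})"
    using unif by (intro PiM_cong refl) auto
  finally have "distr M (PiM ?I (\<lambda>_. borel)) (\<lambda>\<omega>. \<lambda>e\<in>?I. (\<lambda>(i, j). Y i j) e \<omega>) = \<dots>" .
  then show ?thesis
    unfolding density_cube_eq_PiM_uniform[OF finite_cartesian_product[OF finite_atLeastAtMost finite_atLeastAtMost]]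
    by (simp add: case_prod_unfold)
qed

section \<open>The law of the canonical pair\<close>

text \<open>
  For almost every matrix exactly one pair of a permutation and a tree passes the strictness test, namely
  the optimal permutation and the shortest-path tree. The sum is then the indicator that the pair
  \<open>(D, U)\<close> for the root \<open>r\<close> lies in \<open>B\<close>.
\<close>
definition tree_sum :: "nat \<Rightarrow> nat \<Rightarrow> ((nat \<Rightarrow> real) \<times> (nat \<Rightarrow> real)) set \<Rightarrow> (nat \<times> nat \<Rightarrow> real) \<Rightarrow> ennreal" where
  "tree_sum n r B y = (\<Sum>(\<sigma>, p)\<in>{\<sigma>. \<sigma> permutes {1..n}} \<times> parent_maps n r.
     tree_event n r p B (relabel n \<sigma> y))"

lemma borel_measurable_tree_term:
  assumes n: "n \<ge> 1" and p: "p \<in> parent_maps n r" and B: "B \<in> sets (ref_measure n)"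
  shows "(\<lambda>y. tree_event n r p B y :: ennreal)
    \<in> borel_measurable (lborel_on (cells n))"
proof (intro borel_measurable_times_ennreal)
  let ?L = "lborel_on (cells n)"
  have "(\<lambda>y. indicator {y \<in> space ?L. strict_tree n r p (curry y)} y :: ennreal) \<in> borel_measurable ?L"
    by (intro borel_measurable_indicator sets_strict_tree p)
  moreover have "(\<lambda>y. indicator {y \<in> space ?L. strict_tree n r p (curry y)} y :: ennreal) \<in> borel_measurable ?L
      \<longleftrightarrow> (\<lambda>y. indicator {y. strict_tree n r p (curry y)} y :: ennreal) \<in> borel_measurable ?L"
    by (intro measurable_cong) (simp add: indicator_def)
  ultimately show "(\<lambda>y. indicator {y. strict_tree n r p (curry y)} y :: ennreal) \<in> borel_measurable ?L" by simp
  show "(\<lambda>y. indicator B (tree_point n r p y) :: ennreal) \<in> borel_measurable ?L"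
    by (rule measurable_compose[OF measurable_tree_point[OF n p] borel_measurable_indicator[OF B]])
qed

lemma borel_measurable_tree_sum:
  assumes n: "n \<ge> 1" and B: "B \<in> sets (ref_measure n)"
  shows "tree_sum n r B \<in> borel_measurable (lborel_on (cells n))"
  unfolding tree_sum_def[abs_def] case_prod_unfold
proof (rule borel_measurable_sum)
  fix w assume w: "w \<in> {\<sigma>. \<sigma> permutes {1..n}} \<times> parent_maps n r"
  then have "fst w permutes {1..n}" "snd w \<in> parent_maps n r" by auto
  from measurable_compose[OF measurable_relabel[OF this(1)] borel_measurable_tree_term[OF n this(2) B]]
  show "(\<lambda>y. tree_event n r (snd w) B (relabel n (fst w) y) :: ennreal)
      \<in> borel_measurable (lborel_on (cells n))" .
qed

lemma relabel_in_cube: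
  assumes \<sigma>: "\<sigma> permutes {1..n}"
  shows "relabel n \<sigma> y \<in> unit_cube n \<longleftrightarrow>
    (\<forall>e\<in>cells n. y e \<in> {0..1})"
proof -
  have "(\<forall>e\<in>cells n. y (map_prod id \<sigma> e) \<in> {0..1}) \<longleftrightarrow>
      (\<forall>e\<in>map_prod id \<sigma> ` (cells n). y e \<in> {0..1})"
    by (simp only: Ball_image_comp comp_def)
  also have "map_prod id \<sigma> ` (cells n) = cells n"
    using bij_betw_columns[OF \<sigma>] by (rule bij_betw_imp_surj_on)
  finally show ?thesis unfolding relabel_alt by (simp only: PiE_iff restrict_extensional restrict_apply simp_thms cong: ball_cong) simp
qed

text \<open>
  Relabelling columns preserves the uniform law, so every permutation contributes the same amount and the
  sum over permutations becomes the factor \<open>fact n\<close>.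
\<close>
lemma nn_integral_cube_tree_sum:
  assumes n: "n \<ge> 1" and r: "r \<in> {1..n}" and B: "B \<in> sets (ref_measure n)"
  shows "(\<integral>\<^sup>+y. indicator (unit_cube n) y * tree_sum n r B y
      \<partial>lborel_on (cells n))
    = ennreal (fact n * (1 / real n) ^ (2 * n - 2)) * (\<Sum>p\<in>parent_maps n r.
      tree_mass n r p B)"
proof -
  let ?I = "cells n" and ?P = "{\<sigma>. \<sigma> permutes {1..n}}"
  let ?L = "lborel_on ?I"
  let ?cube = "unit_cube n"
  define g :: "(nat \<Rightarrow> nat) \<Rightarrow> (nat \<times> nat \<Rightarrow> real) \<Rightarrow> ennreal" where
    "g p y = tree_event n r p B y" for p y
  have cube: "indicator ?cube \<in> borel_measurable ?L"
    by (intro borel_measurable_indicator sets_PiM_I_finite) auto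
  have g: "(\<lambda>y. indicator ?cube y * g p y) \<in> borel_measurable ?L" if "p \<in> parent_maps n r" for p
    unfolding g_def by (intro borel_measurable_times_ennreal[OF cube] borel_measurable_tree_term n that B)
  have relabel_term: "(\<integral>\<^sup>+y. indicator ?cube y * g p (relabel n \<sigma> y) \<partial>?L) = (\<integral>\<^sup>+y. indicator ?cube y * g p y \<partial>?L)"
    if \<sigma>: "\<sigma> permutes {1..n}" and p: "p \<in> parent_maps n r" for \<sigma> p
  proof -
    have "(\<integral>\<^sup>+y. indicator ?cube y * g p (relabel n \<sigma> y) \<partial>?L)
        = (\<integral>\<^sup>+y. indicator ?cube (relabel n \<sigma> y) * g p (relabel n \<sigma> y) \<partial>?L)"
    proof (intro nn_integral_cong arg_cong2[where f = "(*)"] refl)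
      fix y assume "y \<in> space ?L"
      then have "y \<in> ?cube \<longleftrightarrow> relabel n \<sigma> y \<in> ?cube"
        unfolding relabel_in_cube[OF \<sigma>] by (auto simp: space_PiM PiE_iff)
      then show "indicator ?cube y = (indicator ?cube (relabel n \<sigma> y) :: ennreal)"
        by (simp only: indicator_def)
    qed
    also have "\<dots> = (\<integral>\<^sup>+y. indicator ?cube y * g p y \<partial>distr ?L ?L (relabel n \<sigma>))"
      using g[OF p] by (intro nn_integral_distr[symmetric] measurable_relabel[OF \<sigma>]) simp
    finally show ?thesis unfolding distr_relabel[OF \<sigma>] .
  qed
  have m: "(\<lambda>y. indicator ?cube y * g p (relabel n \<sigma> y)) \<in> borel_measurable ?L"
    if \<sigma>: "\<sigma> permutes {1..n}" and p: "p \<in> parent_maps n r" for \<sigma> p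
    unfolding g_def
    by (intro borel_measurable_times_ennreal[OF cube]
        measurable_compose[OF measurable_relabel[OF \<sigma>] borel_measurable_tree_term[OF n p B]])
  have "(\<integral>\<^sup>+y. indicator ?cube y * tree_sum n r B y \<partial>?L)
      = (\<integral>\<^sup>+y. (\<Sum>w\<in>?P \<times> parent_maps n r. indicator ?cube y * g (snd w) (relabel n (fst w) y)) \<partial>?L)"
    unfolding tree_sum_def g_def case_prod_unfold sum_distrib_left ..
  also have "\<dots> = (\<Sum>w\<in>?P \<times> parent_maps n r. \<integral>\<^sup>+y. indicator ?cube y * g (snd w) (relabel n (fst w) y) \<partial>?L)"
    by (intro nn_integral_sum m) auto
  also have "\<dots> = (\<Sum>w\<in>?P \<times> parent_maps n r. ennreal ((1 / real n) ^ (2 * n - 2)) * tree_mass n r (snd w) B)"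
  proof (intro sum.cong refl)
    fix w assume "w \<in> ?P \<times> parent_maps n r"
    then have w: "fst w permutes {1..n}" "snd w \<in> parent_maps n r" by auto
    show "(\<integral>\<^sup>+y. indicator ?cube y * g (snd w) (relabel n (fst w) y) \<partial>?L)
        = ennreal ((1 / real n) ^ (2 * n - 2)) * tree_mass n r (snd w) B"
      unfolding relabel_term[OF w] unfolding g_def by (rule nn_integral_strict_tree[OF n r w(2) B])
  qed
  also have "\<dots> = (\<Sum>\<sigma>\<in>?P. \<Sum>p\<in>parent_maps n r. ennreal ((1 / real n) ^ (2 * n - 2)) * tree_mass n r p B)"
    by (subst sum.cartesian_product) (simp add: case_prod_unfold)
  also have "\<dots> = of_nat (card ?P) * (ennreal ((1 / real n) ^ (2 * n - 2)) * (\<Sum>p\<in>parent_maps n r. tree_mass n r p B))"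
    by (simp add: sum_distrib_left)
  also have "card ?P = fact n"
    by (rule card_permutations) simp_all
  also have "of_nat (fact n) * (ennreal ((1 / real n) ^ (2 * n - 2)) * (\<Sum>p\<in>parent_maps n r. tree_mass n r p B))
      = ennreal (fact n * (1 / real n) ^ (2 * n - 2)) * (\<Sum>p\<in>parent_maps n r. tree_mass n r p B)"
    by (subst ennreal_mult) (simp_all add: mult.assoc ennreal_of_nat_eq_real_of_nat)
  finally show ?thesis .
qed

text \<open>The shortest-path data are those of the tree that the optimal relabelling makes strict.\<close>
lemma strict_tree_D_U:
  assumes r: "r \<in> {1..n}" and \<sigma>: "\<sigma> permutes {1..n}" and p: "p \<in> parent_maps n r"
    and y: "\<And>i j. i \<in> {1..n} \<Longrightarrow> j \<in> {1..n} \<Longrightarrow> x (i, j) = y i j"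
    and s: "strict_tree n r p (curry (relabel n \<sigma> x))"
  shows "opt_perm n y = \<sigma>"
    and "tree_point n r p (relabel n \<sigma> x) = (D_vec n y, U_vec n y r)"
    and "strict_tree n r p (aligned n y)"
    and "\<And>i. i \<in> {1..n} \<Longrightarrow> potential n y r i = tree_potential n r p (aligned n y) i"
proof -
  have eq: "curry (relabel n \<sigma> x) i j = y i (\<sigma> j)" if "i \<in> {1..n}" "j \<in> {1..n}" for i j
    using that y[of i "\<sigma> j"] permutes_in_image[OF \<sigma>, of j] by (simp add: relabel_def)
  have s': "strict_tree n r p (\<lambda>i j. y i (\<sigma> j))"
  proof -
    have "strict_tree n r p (curry (relabel n \<sigma> x)) \<longleftrightarrow> strict_tree n r p (\<lambda>i j. y i (\<sigma> j))"
      by (rule strict_tree_cong[OF p eq])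
    then show ?thesis using s by blast
  qed
  show opt: "opt_perm n y = \<sigma>" by (rule strict_tree_opt_perm[OF \<sigma> r p s'])
  have al: "aligned n y = (\<lambda>i j. y i (\<sigma> j))" by (simp add: aligned_def[abs_def] opt)
  show "strict_tree n r p (aligned n y)" using s' al by simp
  show pot: "potential n y r i = tree_potential n r p (aligned n y) i" if "i \<in> {1..n}" for i
    using strict_tree_potential[OF \<sigma> r p s' that] al by simp
  have pot': "tree_potential n r p (curry (relabel n \<sigma> x)) i = potential n y r i" if "i \<in> {1..n}" for i
  proof -
    have "tree_potential n r p (curry (relabel n \<sigma> x)) i = tree_potential n r p (\<lambda>i j. y i (\<sigma> j)) i"
      by (rule tree_potential_cong[OF p that eq])
    then show ?thesis using pot[OF that] al by simp
  qed
  have D: "(\<lambda>i\<in>{1..n}. real n * relabel n \<sigma> x (i, i)) = D_vec n y"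
    unfolding D_vec_def al using eq by (intro restrict_ext) simp
  have "(\<Sum>k\<in>{1..n}. tree_potential n r p (curry (relabel n \<sigma> x)) k) = (\<Sum>k\<in>{1..n}. potential n y r k)"
    by (intro sum.cong refl pot')
  then have "(\<lambda>i\<in>{1..n}. real n * (tree_potential n r p (curry (relabel n \<sigma> x)) i
       - (\<Sum>k\<in>{1..n}. tree_potential n r p (curry (relabel n \<sigma> x)) k) / real n)) = U_vec n y r"
    unfolding U_vec_def by (intro restrict_ext) (simp only: pot')
  then show "tree_point n r p (relabel n \<sigma> x) = (D_vec n y, U_vec n y r)"
    unfolding tree_point_def D by simp
qed

lemma tree_sum_eq_indicator:
  assumes r: "r \<in> {1..n}" and y: "\<And>i j. i \<in> {1..n} \<Longrightarrow> j \<in> {1..n} \<Longrightarrow> x (i, j) = y i j"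
    and ex: "has_strict_tree n r x"
  shows "tree_sum n r B x = indicator B (D_vec n y, U_vec n y r)"
proof -
  let ?W = "{\<sigma>. \<sigma> permutes {1..n}} \<times> parent_maps n r"
  let ?f = "\<lambda>(\<sigma>, p). tree_event n r p B (relabel n \<sigma> x) :: ennreal"
  obtain \<sigma> p where \<sigma>: "\<sigma> permutes {1..n}" and p: "p \<in> parent_maps n r"
    and s: "strict_tree n r p (curry (relabel n \<sigma> x))" using ex by blast
  have "tree_sum n r B x = (\<Sum>w\<in>{(\<sigma>, p)}. ?f w)"
    unfolding tree_sum_def
  proof (rule sum.mono_neutral_right)
    show "finite ?W" by (intro finite_cartesian_product finite_permutations finite_parent_maps) simp
    show "{(\<sigma>, p)} \<subseteq> ?W" using \<sigma> p by simp
    show "\<forall>w\<in>?W - {(\<sigma>, p)}. ?f w = 0"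
    proof
      fix w assume w: "w \<in> ?W - {(\<sigma>, p)}"
      obtain \<sigma>' p' where w': "w = (\<sigma>', p')" by fastforce
      have "\<not> strict_tree n r p' (curry (relabel n \<sigma>' x))"
      proof
        assume s': "strict_tree n r p' (curry (relabel n \<sigma>' x))"
        have "\<sigma>' = \<sigma>"
          using strict_tree_D_U(1)[where x = x and y = y, OF r \<sigma> p y s]
            strict_tree_D_U(1)[where x = x and y = y, OF r _ _ y s'] w w' by auto
        moreover from this have "p' = p"
          using strict_tree_unique[OF r _ p _ s] s' w w' by auto
        ultimately show False using w w' by simp
      qed
      then show "?f w = 0" by (simp add: w')
    qed
  qed
  also have "\<dots> = indicator B (tree_point n r p (relabel n \<sigma> x))"
    using s by simp
  also have "tree_point n r p (relabel n \<sigma> x) = (D_vec n y, U_vec n y r)"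
    using r \<sigma> p y s by (rule strict_tree_D_U(2))
  finally show ?thesis .
qed

lemma AE_ex_strict_tree_uniform:
  assumes n: "n \<ge> 1" and M: "prob_space M"
    and X: "X \<in> measurable M (PiM (cells n) (\<lambda>_. borel))"
    and law: "distr M (PiM (cells n) (\<lambda>_. borel)) X
      = uniform_matrix n"
    and r: "r \<in> {1..n}"
  shows "AE \<omega> in M. has_strict_tree n r (X \<omega>)"
proof -
  let ?I = "cells n"
  have "indicator (unit_cube n) \<in> borel_measurable (lborel_on ?I)"
    by (intro borel_measurable_indicator sets_PiM_I_finite) auto
  then have "AE y in uniform_matrix n.
      has_strict_tree n r y"
  proof (subst AE_density)
    show "AE y in lborel_on ?I. 0 < (indicator (unit_cube n) y :: ennreal) \<longrightarrow>
      (has_strict_tree n r y)"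
      using AE_ex_strict_tree[OF r] by eventually_elim blast
  qed
  then show ?thesis unfolding law[symmetric] by (rule AE_distrD[OF X])
qed

text \<open>
  The first part identifies the tree sum with the indicator of the event \<open>(D, U) \<in> B\<close>, so that the
  second part is the probability of this event for the root \<open>r\<close>.
\<close>
lemma tree_sum_fixed_root:
  fixes n :: nat and Y :: "nat \<Rightarrow> nat \<Rightarrow> 'a \<Rightarrow> real"
  defines "X \<equiv> \<lambda>\<omega>. \<lambda>(i, j)\<in>cells n. Y i j \<omega>"
  assumes n: "n \<ge> 1" and M: "prob_space M"
    and X: "X \<in> measurable M (PiM (cells n) (\<lambda>_. borel))"
    and law: "distr M (PiM (cells n) (\<lambda>_. borel)) X
      = uniform_matrix n"
    and r: "r \<in> {1..n}" and B: "B \<in> sets (ref_measure n)"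
  shows "AE \<omega> in M. tree_sum n r B (X \<omega>) = indicator B (D_vec n (\<lambda>i j. Y i j \<omega>), U_vec n (\<lambda>i j. Y i j \<omega>) r)"
    and "(\<integral>\<^sup>+\<omega>. tree_sum n r B (X \<omega>) \<partial>M)
    = ennreal (fact n * (1 / real n) ^ (2 * n - 2)) * (\<Sum>p\<in>parent_maps n r.
      tree_mass n r p B)"
proof -
  let ?I = "cells n"
  have ts: "tree_sum n r B \<in> borel_measurable (lborel_on ?I)"
    by (rule borel_measurable_tree_sum[OF n B])
  have cube: "indicator (unit_cube n) \<in> borel_measurable (lborel_on ?I)"
    by (intro borel_measurable_indicator sets_PiM_I_finite) auto
  show "AE \<omega> in M. tree_sum n r B (X \<omega>) = indicator B (D_vec n (\<lambda>i j. Y i j \<omega>), U_vec n (\<lambda>i j. Y i j \<omega>) r)"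
    using AE_ex_strict_tree_uniform[OF n M X law r]
  proof (rule AE_mp, intro AE_I2 impI)
    fix \<omega> assume ex: "has_strict_tree n r (X \<omega>)"
    have "X \<omega> (i, j) = Y i j \<omega>" if "i \<in> {1..n}" "j \<in> {1..n}" for i j
      using that by (simp add: X_def)
    then show "tree_sum n r B (X \<omega>) = indicator B (D_vec n (\<lambda>i j. Y i j \<omega>), U_vec n (\<lambda>i j. Y i j \<omega>) r)"
      by (rule tree_sum_eq_indicator[OF r _ ex])
  qed
  have ts': "tree_sum n r B \<in> borel_measurable (PiM ?I (\<lambda>_. borel))"
    using ts unfolding measurable_cong_sets[OF sets_lborel_on refl] .
  have "(\<integral>\<^sup>+\<omega>. tree_sum n r B (X \<omega>) \<partial>M) = (\<integral>\<^sup>+y. tree_sum n r B y \<partial>distr M (PiM ?I (\<lambda>_. borel)) X)"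
    using ts' by (intro nn_integral_distr[symmetric] X) simp
  also have "\<dots> = (\<integral>\<^sup>+y. indicator (unit_cube n) y * tree_sum n r B y \<partial>lborel_on ?I)"
    unfolding law by (rule nn_integral_density[OF cube ts])
  also note nn_integral_cube_tree_sum[OF n r B]
  finally show "(\<integral>\<^sup>+\<omega>. tree_sum n r B (X \<omega>) \<partial>M)
    = ennreal (fact n * (1 / real n) ^ (2 * n - 2)) * (\<Sum>p\<in>parent_maps n r.
      tree_mass n r p B)" .
qed

section \<open>The density\<close>

text \<open>
  Expanding the tree polynomial over roots and parent maps. A vertex other than the root is never its own
  parent, so every tree edge picks a weight off the diagonal.
\<close>
lemma tree_poly_weight:
  "of_bool (\<forall>i\<in>{1..n}. 0 \<le> D i \<and> D i \<le> real n)
     * (\<Prod>(i, j)\<in>off_diag n. rho n (D i + U j - U i))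
     * tree_poly n (\<lambda>i j. if i \<noteq> j then omega n (D i + U j - U i) else 0)
   = (\<Sum>r\<in>{1..n}. \<Sum>p\<in>parent_maps n r. tree_weight n r p D U)"
proof -
  let ?w = "\<lambda>i j. if i \<noteq> j then omega n (D i + U j - U i) else 0"
  have "tree_poly n ?w = (\<Sum>r\<in>{1..n}. \<Sum>p\<in>parent_maps n r. \<Prod>i\<in>{1..n} - {r}. omega n (D i + U (p i) - U i))"
    unfolding tree_poly_def
  proof (intro sum.cong refl)
    fix r assume r: "r \<in> {1..n}"
    have "(\<Prod>i\<in>{1..n} - {r}. ?w i (p i)) = (\<Prod>i\<in>{1..n} - {r}. omega n (D i + U (p i) - U i))"
      if "p \<in> parent_maps n r" for p
    proof (intro prod.cong refl)
      fix i assume "i \<in> {1..n} - {r}"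
      then have "i \<noteq> p i" using parent_neq[OF that, of i] by auto
      then show "?w i (p i) = omega n (D i + U (p i) - U i)" by simp
    qed
    then show "tree_poly_at n r ?w = (\<Sum>p\<in>parent_maps n r. \<Prod>i\<in>{1..n} - {r}. omega n (D i + U (p i) - U i))"
      unfolding tree_poly_at_parent_maps[OF r] by (intro sum.cong refl)
  qed
  then show ?thesis unfolding tree_weight_def by (simp only: sum_distrib_left)
qed

lemma measurable_fst_ref: "i \<in> {1..n} \<Longrightarrow> (\<lambda>w. fst w i) \<in> borel_measurable (ref_measure n)"
  unfolding ref_measure_def
  by (rule measurable_compose[OF measurable_fst borel_measurable_lborel_on_component])

lemma measurable_snd_ref: "i \<in> {1..n} \<Longrightarrow> (\<lambda>w. snd w i) \<in> borel_measurable (ref_measure n)"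
  unfolding ref_measure_def
  by (rule measurable_compose[OF measurable_snd
        measurable_H0_measure_embed[OF measurable_component_singleton]])

lemma borel_measurable_tree_weight:
  assumes p: "p \<in> parent_maps n r"
  shows "(\<lambda>w. tree_weight n r p (fst w) (snd w)) \<in> borel_measurable (ref_measure n)"
proof -
  let ?R = "ref_measure n"
  have t: "(\<lambda>w. fst w i + snd w j - snd w i) \<in> borel_measurable ?R" if "i \<in> {1..n}" "j \<in> {1..n}" for i j
    by (intro borel_measurable_add borel_measurable_diff measurable_fst_ref measurable_snd_ref that)
  have "{w \<in> space ?R. \<forall>i\<in>{1..n}. 0 \<le> fst w i \<and> fst w i \<le> real n} \<in> sets ?R"
    by (intro sets.sets_Collect_finite_All sets.sets_Collect_conj borel_measurable_le borel_measurable_const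
        measurable_fst_ref) auto
  then have "(\<lambda>w. indicator {w \<in> space ?R. \<forall>i\<in>{1..n}. 0 \<le> fst w i \<and> fst w i \<le> real n} w :: real) \<in> borel_measurable ?R"
    by (rule borel_measurable_indicator)
  moreover have "(\<lambda>w. indicator {w \<in> space ?R. \<forall>i\<in>{1..n}. 0 \<le> fst w i \<and> fst w i \<le> real n} w :: real) \<in> borel_measurable ?R
      \<longleftrightarrow> (\<lambda>w. of_bool (\<forall>i\<in>{1..n}. 0 \<le> fst w i \<and> fst w i \<le> real n) :: real) \<in> borel_measurable ?R"
    by (intro measurable_cong) (simp add: indicator_def)
  ultimately have b: "(\<lambda>w. of_bool (\<forall>i\<in>{1..n}. 0 \<le> fst w i \<and> fst w i \<le> real n) :: real) \<in> borel_measurable ?R"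
    by blast
  have f1: "(\<lambda>w. \<Prod>(i, j)\<in>off_diag n. rho n (fst w i + snd w j - snd w i)) \<in> borel_measurable ?R"
    unfolding case_prod_unfold
  proof (rule borel_measurable_prod)
    fix e assume "e \<in> off_diag n"
    then have "fst e \<in> {1..n}" "snd e \<in> {1..n}" by (auto simp: off_diag_def)
    from measurable_compose[OF t[OF this] borel_measurable_rho]
    show "(\<lambda>w. rho n (fst w (fst e) + snd w (snd e) - snd w (fst e))) \<in> borel_measurable ?R" .
  qed
  have f2: "(\<lambda>w. \<Prod>i\<in>{1..n} - {r}. omega n (fst w i + snd w (p i) - snd w i)) \<in> borel_measurable ?R"
  proof (rule borel_measurable_prod)
    fix i assume "i \<in> {1..n} - {r}"
    then have "i \<in> {1..n}" "p i \<in> {1..n}" using parent_mapsD(2)[OF p, of i] by auto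
    from measurable_compose[OF t[OF this] borel_measurable_omega]
    show "(\<lambda>w. omega n (fst w i + snd w (p i) - snd w i)) \<in> borel_measurable ?R" .
  qed
  show ?thesis unfolding tree_weight_def by (intro borel_measurable_times b f1 f2)
qed

text \<open>
  The integrand of the partition function, written as a sum over rooted trees so that it matches the
  contributions of the single trees.
\<close>
definition tree_density :: "nat \<Rightarrow> (nat \<Rightarrow> real) \<times> (nat \<Rightarrow> real) \<Rightarrow> real" where
  "tree_density n w = (\<Sum>r\<in>{1..n}. \<Sum>p\<in>parent_maps n r. tree_weight n r p (fst w) (snd w))"

lemma tree_density_nonneg: "0 \<le> tree_density n w"
  unfolding tree_density_def by (intro sum_nonneg tree_weight_nonneg)

lemma borel_measurable_tree_density: "tree_density n \<in> borel_measurable (ref_measure n)"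
  unfolding tree_density_def[abs_def] by (intro borel_measurable_sum borel_measurable_tree_weight)

lemma nn_integral_ref_measure:
  assumes n: "n \<ge> 1" and f: "f \<in> borel_measurable (ref_measure n)"
  shows "(\<integral>\<^sup>+w. f w \<partial>ref_measure n) = (\<integral>\<^sup>+D. \<integral>\<^sup>+U. f (D, U) \<partial>H0_measure n \<partial>lborel_on {1..n})"
    and "(\<integral>\<^sup>+w. f w \<partial>ref_measure n) = (\<integral>\<^sup>+U. \<integral>\<^sup>+D. f (D, U) \<partial>lborel_on {1..n} \<partial>H0_measure n)"
proof -
  interpret pair_sigma_finite "lborel_on {1..n}" "H0_measure n"
    unfolding pair_sigma_finite_def using sigma_finite_lborel_on sigma_finite_H0_measure[OF n] by blast
  show 1: "(\<integral>\<^sup>+w. f w \<partial>ref_measure n) = (\<integral>\<^sup>+D. \<integral>\<^sup>+U. f (D, U) \<partial>H0_measure n \<partial>lborel_on {1..n})"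
    using f unfolding ref_measure_def by (rule M2.nn_integral_fst[symmetric])
  show "(\<integral>\<^sup>+w. f w \<partial>ref_measure n) = (\<integral>\<^sup>+U. \<integral>\<^sup>+D. f (D, U) \<partial>lborel_on {1..n} \<partial>H0_measure n)"
    using f unfolding ref_measure_def by (rule nn_integral_snd[symmetric, unfolded case_prod_eta])
qed

text \<open>
  Averaging over the root turns the sum over trees with a fixed root into the sum over all rooted
  trees, at the price of another factor \<open>1 / n\<close>.
\<close>
lemma distributed_D_U:
  fixes n :: nat and Y :: "nat \<Rightarrow> nat \<Rightarrow> 'a \<Rightarrow> real" and R :: "'a \<Rightarrow> nat"
  defines "X \<equiv> \<lambda>\<omega>. \<lambda>(i, j)\<in>cells n. Y i j \<omega>"
  assumes n: "n \<ge> 1" and M: "prob_space M"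
    and Y: "\<And>i j. i \<in> {1..n} \<Longrightarrow> j \<in> {1..n} \<Longrightarrow> Y i j \<in> borel_measurable M"
    and law: "distr M (PiM (cells n) (\<lambda>_. borel)) X
      = uniform_matrix n"
    and R: "R \<in> measurable M (count_space {1..n})"
    and R_unif: "distr M (count_space {1..n}) R = uniform_count_measure {1..n}"
    and R_indep: "prob_space.indep_set M
      (sets (vimage_algebra (space M) X (PiM (cells n) (\<lambda>_. borel))))
      (sets (vimage_algebra (space M) R (count_space {1..n})))"
  shows "distributed M (ref_measure n)
    (\<lambda>\<omega>. (D_vec n (\<lambda>i j. Y i j \<omega>), U_vec n (\<lambda>i j. Y i j \<omega>) (R \<omega>)))
    (\<lambda>w. ennreal (fact n / real n ^ (2 * n - 1) * tree_density n w))"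
  unfolding distributed_def
proof (intro conjI)
  interpret prob_space M by fact
  let ?I = "cells n"
  let ?Z = "\<lambda>\<omega> r. (D_vec n (\<lambda>i j. Y i j \<omega>), U_vec n (\<lambda>i j. Y i j \<omega>) r)"
  let ?c = "fact n / real n ^ (2 * n - 1) :: real"
  let ?f = "\<lambda>w. ennreal (?c * tree_density n w)"
  have X: "X \<in> measurable M (PiM ?I (\<lambda>_. borel))"
    unfolding X_def by (rule measurable_matrix[OF Y])
  have Zr: "(\<lambda>\<omega>. ?Z \<omega> r) \<in> measurable M (ref_measure n)" for r
    by (rule measurable_D_U[OF Y n])
  show Z: "(\<lambda>\<omega>. ?Z \<omega> (R \<omega>)) \<in> measurable M (ref_measure n)"
    by (rule measurable_compose_countable'[OF Zr R]) simp
  show f: "?f \<in> borel_measurable (ref_measure n)"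
    by (intro measurable_compose[OF _ measurable_ennreal] borel_measurable_times borel_measurable_const
        borel_measurable_tree_density)
  show "distr M (ref_measure n) (\<lambda>\<omega>. ?Z \<omega> (R \<omega>)) = density (ref_measure n) ?f"
  proof (rule measure_eqI)
    fix B assume "B \<in> sets (distr M (ref_measure n) (\<lambda>\<omega>. ?Z \<omega> (R \<omega>)))"
    then have B: "B \<in> sets (ref_measure n)" by simp
    let ?W = "\<lambda>r p w. ennreal (tree_weight n r p (fst w) (snd w))"
    define S where "S r = {y \<in> space (PiM ?I (\<lambda>_. borel)). tree_sum n r B y = 1}" for r
    \<comment> \<open>up to a null set, \<open>E r\<close> is the event for the root \<open>r\<close>; it is a function of the matrix alone, as independence requires\<close>
    define E where "E r = X -` S r \<inter> space M" for r
    define T where "T r = R -` {r} \<inter> space M" for r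
    have S: "S r \<in> sets (PiM ?I (\<lambda>_. borel))" for r
    proof -
      have "tree_sum n r B \<in> borel_measurable (PiM ?I (\<lambda>_. borel))"
        using borel_measurable_tree_sum[OF n B] unfolding measurable_cong_sets[OF sets_lborel_on refl] .
      then show ?thesis
        unfolding S_def by (intro borel_measurable_eq borel_measurable_const)
    qed
    have E: "E r \<in> sets M" for r unfolding E_def by (rule measurable_sets[OF X S])
    have T: "T r \<in> sets M" if "r \<in> {1..n}" for r
      unfolding T_def using that by (intro measurable_sets[OF R]) simp
    have AE_ts: "AE \<omega> in M. tree_sum n r B (X \<omega>) = indicator B (?Z \<omega> r)" if "r \<in> {1..n}" for r
      using tree_sum_fixed_root(1)[OF n M X[unfolded X_def] law[unfolded X_def] that B] unfolding X_def .
    have Xs: "X \<omega> \<in> space (PiM ?I (\<lambda>_. borel))" for \<omega>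
      by (auto simp: X_def space_PiM)
    have E_prob: "emeasure M (E r) = ennreal (fact n * (1 / real n) ^ (2 * n - 2)) * (\<Sum>p\<in>parent_maps n r. tree_mass n r p B)"
      if r: "r \<in> {1..n}" for r
    proof -
      have "emeasure M (E r) = (\<integral>\<^sup>+\<omega>. indicator (E r) \<omega> \<partial>M)" using E by simp
      also have "\<dots> = (\<integral>\<^sup>+\<omega>. tree_sum n r B (X \<omega>) \<partial>M)"
        using AE_ts[OF r] Xs
        by (intro nn_integral_cong_AE, elim AE_mp) (auto intro!: AE_I2 simp: E_def S_def indicator_def)
      also have "\<dots> = ennreal (fact n * (1 / real n) ^ (2 * n - 2)) * (\<Sum>p\<in>parent_maps n r. tree_mass n r p B)"
        using tree_sum_fixed_root(2)[OF n M X[unfolded X_def] law[unfolded X_def] r B]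
        unfolding X_def .
      finally show ?thesis .
    qed
    have T_prob: "emeasure M (T r) = ennreal (1 / real n)" if r: "r \<in> {1..n}" for r
    proof -
      have "emeasure M (T r) = emeasure (distr M (count_space {1..n}) R) {r}"
        unfolding T_def using r by (intro emeasure_distr[symmetric] R) simp
      also have "\<dots> = ennreal (1 / real n)"
        unfolding R_unif using r by (subst emeasure_uniform_count_measure) auto
      finally show ?thesis .
    qed
    have ET: "emeasure M (E r \<inter> T r) = emeasure M (E r) * emeasure M (T r)" if r: "r \<in> {1..n}" for r
    proof -
      have "E r \<in> sets (vimage_algebra (space M) X (PiM ?I (\<lambda>_. borel)))"
        unfolding E_def by (rule in_vimage_algebra[OF S])
      moreover have "T r \<in> sets (vimage_algebra (space M) R (count_space {1..n}))"
        unfolding T_def using r by (intro in_vimage_algebra) simp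
      ultimately have "prob (E r \<inter> T r) = prob (E r) * prob (T r)"
        by (rule indep_setD[OF R_indep])
      then show ?thesis by (simp add: emeasure_eq_measure ennreal_mult)
    qed
    have "emeasure (distr M (ref_measure n) (\<lambda>\<omega>. ?Z \<omega> (R \<omega>))) B
        = emeasure M ((\<lambda>\<omega>. ?Z \<omega> (R \<omega>)) -` B \<inter> space M)"
      by (rule emeasure_distr[OF Z B])
    also have "\<dots> = emeasure M (\<Union>r\<in>{1..n}. E r \<inter> T r)"
    proof (rule emeasure_eq_AE)
      have "AE \<omega> in M. \<forall>r\<in>{1..n}. tree_sum n r B (X \<omega>) = indicator B (?Z \<omega> r)"
        using AE_ts by (intro AE_finite_allI) auto
      then show "AE \<omega> in M. \<omega> \<in> (\<lambda>\<omega>. ?Z \<omega> (R \<omega>)) -` B \<inter> space M \<longleftrightarrow> \<omega> \<in> (\<Union>r\<in>{1..n}. E r \<inter> T r)"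
      proof (rule AE_mp, intro AE_I2 impI)
        fix \<omega> assume \<omega>: "\<omega> \<in> space M" and ts: "\<forall>r\<in>{1..n}. tree_sum n r B (X \<omega>) = indicator B (?Z \<omega> r)"
        have R\<omega>: "R \<omega> \<in> {1..n}" using measurable_space[OF R \<omega>] by simp
        have "\<omega> \<in> E r \<longleftrightarrow> ?Z \<omega> r \<in> B" if "r \<in> {1..n}" for r
          using ts that Xs \<omega> by (simp add: E_def S_def indicator_def)
        then show "\<omega> \<in> (\<lambda>\<omega>. ?Z \<omega> (R \<omega>)) -` B \<inter> space M \<longleftrightarrow> \<omega> \<in> (\<Union>r\<in>{1..n}. E r \<inter> T r)"
          using R\<omega> \<omega> unfolding T_def by blast
      qed
      show "(\<lambda>\<omega>. ?Z \<omega> (R \<omega>)) -` B \<inter> space M \<in> sets M" by (rule measurable_sets[OF Z B])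
      show "(\<Union>r\<in>{1..n}. E r \<inter> T r) \<in> sets M" using E T by (intro sets.finite_UN) auto
    qed
    also have "\<dots> = (\<Sum>r\<in>{1..n}. emeasure M (E r \<inter> T r))"
      using E T by (intro sum_emeasure[symmetric]) (auto simp: disjoint_family_on_def T_def)
    also have "\<dots> = (\<Sum>r\<in>{1..n}. ennreal (?c) * (\<Sum>p\<in>parent_maps n r. tree_mass n r p B))"
    proof (intro sum.cong refl)
      fix r assume r: "r \<in> {1..n}"
      have "2 * n - 1 = Suc (2 * n - 2)" using n by simp
      then have c: "fact n * (1 / real n) ^ (2 * n - 2) * (1 / real n) = ?c"
        by (simp add: power_divide)
      show "emeasure M (E r \<inter> T r) = ennreal (?c) * (\<Sum>p\<in>parent_maps n r. tree_mass n r p B)"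
        unfolding ET[OF r] E_prob[OF r] T_prob[OF r] c[symmetric]
        by (subst ennreal_mult) (simp_all add: mult_ac)
    qed
    also have "\<dots> = (\<Sum>r\<in>{1..n}. \<Sum>p\<in>parent_maps n r.
        (\<integral>\<^sup>+w. ennreal (?c) * (?W r p w * indicator B w)
          \<partial>ref_measure n))"
      unfolding sum_distrib_left
    proof (intro sum.cong refl)
      fix r p assume p: "p \<in> parent_maps n r"
      have m: "(\<lambda>w. ?W r p w * indicator B w) \<in> borel_measurable (ref_measure n)"
        by (intro borel_measurable_times_ennreal measurable_compose[OF borel_measurable_tree_weight[OF p] measurable_ennreal]
            borel_measurable_indicator B)
      show "ennreal (?c) * tree_mass n r p B = (\<integral>\<^sup>+w. ennreal (?c) *
          (?W r p w * indicator B w) \<partial>ref_measure n)"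
        unfolding nn_integral_cmult[OF m] nn_integral_ref_measure(1)[OF n m] by simp
    qed
    also have "\<dots> = (\<integral>\<^sup>+w. (\<Sum>r\<in>{1..n}. \<Sum>p\<in>parent_maps n r. ennreal (?c) *
        (?W r p w * indicator B w)) \<partial>ref_measure n)"
    proof -
      have m: "(\<lambda>w. ennreal (?c) * (?W r p w * indicator B w))
          \<in> borel_measurable (ref_measure n)" if "p \<in> parent_maps n r" for r p
        by (intro borel_measurable_times_ennreal borel_measurable_const borel_measurable_indicator B
            measurable_compose[OF borel_measurable_tree_weight[OF that] measurable_ennreal])
      show ?thesis
        by (subst nn_integral_sum, intro borel_measurable_sum m, assumption,
            intro sum.cong refl, subst nn_integral_sum, intro m, assumption, rule refl)
    qed
    also have "\<dots> = (\<integral>\<^sup>+w. ?f w * indicator B w \<partial>ref_measure n)"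
    proof (rule nn_integral_cong)
      fix w
      have "?f w = ennreal (?c) *
          (\<Sum>r\<in>{1..n}. \<Sum>p\<in>parent_maps n r. ?W r p w)"
      proof -
        have "?f w = ennreal (?c) * ennreal (tree_density n w)"
          by (rule ennreal_mult') simp
        also have "ennreal (tree_density n w) =
            (\<Sum>r\<in>{1..n}. \<Sum>p\<in>parent_maps n r. ?W r p w)"
          unfolding tree_density_def by (simp add: sum_ennreal sum_nonneg tree_weight_nonneg)
        finally show ?thesis .
      qed
      then show "(\<Sum>r\<in>{1..n}. \<Sum>p\<in>parent_maps n r. ennreal (?c) *
          (?W r p w * indicator B w)) = ?f w * indicator B w"
        by (simp only: sum_distrib_left sum_distrib_right mult.assoc)
    qed
    also have "\<dots> = emeasure (density (ref_measure n) ?f) B"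
      by (rule emeasure_density[OF f B, symmetric])
    finally show "emeasure (distr M (ref_measure n) (\<lambda>\<omega>. ?Z \<omega> (R \<omega>))) B
        = emeasure (density (ref_measure n) ?f) B" .
  qed simp
qed

text \<open>
  The partition function is the reciprocal of the constant in front of the density, because the density
  has total mass one.
\<close>
lemma Z_can_eq:
  assumes n: "n \<ge> 1"
    and total: "(\<integral>\<^sup>+w. ennreal (fact n / real n ^ (2 * n - 1) * tree_density n w) \<partial>ref_measure n) = 1"
  shows "Z_can n = ennreal (real n ^ (2 * n - 2) / fact (n - 1))"
proof -
  let ?c = "fact n / real n ^ (2 * n - 1) :: real"
  have c: "?c > 0" using n by simp
  have m: "(\<lambda>w. ennreal (tree_density n w)) \<in> borel_measurable (ref_measure n)"
    by (intro measurable_compose[OF borel_measurable_tree_density measurable_ennreal])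
  have "Z_can n = (\<integral>\<^sup>+U. \<integral>\<^sup>+D. ennreal (tree_density n (D, U)) \<partial>lborel_on {1..n} \<partial>H0_measure n)"
    unfolding Z_can_def
  proof (intro nn_integral_cong)
    fix U D assume D: "D \<in> space (lborel_on {1..n})"
    have "D \<in> PiE {1..n} (\<lambda>_. {0..real n}) \<longleftrightarrow> (\<forall>i\<in>{1..n}. 0 \<le> D i \<and> D i \<le> real n)"
      using D by (auto simp: space_PiM PiE_iff)
    then have ind: "indicator (PiE {1..n} (\<lambda>_. {0..real n})) D
        = ennreal (of_bool (\<forall>i\<in>{1..n}. 0 \<le> D i \<and> D i \<le> real n))"
      by (simp add: indicator_def)
    let ?P = "(\<Prod>(i, j)\<in>off_diag n. rho n (D i + U j - U i)) *
        tree_poly n (\<lambda>i j. if i \<noteq> j then omega n (D i + U j - U i) else 0)"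
    have "ennreal (tree_density n (D, U))
        = ennreal (of_bool (\<forall>i\<in>{1..n}. 0 \<le> D i \<and> D i \<le> real n) * ?P)"
      unfolding tree_density_def fst_conv snd_conv tree_poly_weight[symmetric] mult.assoc ..
    also have "\<dots> = ennreal (of_bool (\<forall>i\<in>{1..n}. 0 \<le> D i \<and> D i \<le> real n)) * ennreal ?P"
      by (rule ennreal_mult') simp
    finally show "ennreal ?P * indicator (PiE {1..n} (\<lambda>_. {0..real n})) D = ennreal (tree_density n (D, U))"
      unfolding ind by (simp only: mult.commute)
  qed
  also have "\<dots> = (\<integral>\<^sup>+w. ennreal (tree_density n w) \<partial>ref_measure n)"
    by (rule nn_integral_ref_measure(2)[OF n m, symmetric])
  finally have Z: "Z_can n = (\<integral>\<^sup>+w. ennreal (tree_density n w) \<partial>ref_measure n)" .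
  have "ennreal ?c * Z_can n = 1"
    unfolding Z nn_integral_cmult[OF m, symmetric] using c total
    by (simp add: ennreal_mult[symmetric] tree_density_nonneg)
  then have "ennreal (1 / ?c) * (ennreal ?c * Z_can n) = ennreal (1 / ?c)" by simp
  moreover have "ennreal (1 / ?c) * ennreal ?c = 1"
    using c by (subst ennreal_mult[symmetric]) auto
  ultimately have "Z_can n = ennreal (1 / ?c)" by (simp add: mult.assoc[symmetric])
  also have "1 / ?c = real n ^ (2 * n - 2) / fact (n - 1)"
  proof -
    obtain m where "n = Suc m" using n by (cases n) auto
    then show ?thesis by (simp add: divide_simps del: of_nat_Suc)
  qed
  finally show ?thesis .
qed

section \<open>The change of variables from \<open>A\<close> to \<open>D\<close>\<close>

lemma measurable_shift_ref:
  "(\<lambda>w. (\<lambda>i\<in>{1..n}. fst w i + c * snd w i, snd w)) \<in> measurable (ref_measure n) (ref_measure n)"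
proof -
  have "(\<lambda>w. \<lambda>i\<in>{1..n}. fst w i + c * snd w i) \<in> measurable (ref_measure n) (lborel_on {1..n})"
  proof (rule measurable_restrict)
    fix i assume "i \<in> {1..n}"
    then have "(\<lambda>w. fst w i + c * snd w i) \<in> borel_measurable (ref_measure n)"
      by (intro borel_measurable_add borel_measurable_times borel_measurable_const
          measurable_fst_ref measurable_snd_ref)
    then show "(\<lambda>w. fst w i + c * snd w i) \<in> measurable (ref_measure n) lborel" by simp
  qed
  moreover have "snd \<in> measurable (ref_measure n) (H0_measure n)"
    unfolding ref_measure_def by (rule measurable_snd)
  ultimately show ?thesis
    unfolding ref_measure_def[of n] by (intro measurable_Pair) (simp_all only: ref_measure_def[of n])
qed

lemma translation_eq: "translation n = (\<lambda>w. (\<lambda>i\<in>{1..n}. fst w i + 1 * snd w i, snd w))"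
  by (simp add: translation_def case_prod_unfold)

lemma measurable_translation: "translation n \<in> measurable (ref_measure n) (ref_measure n)"
  unfolding translation_eq by (rule measurable_shift_ref)

text \<open>
  For fixed \<open>U\<close> the map is a translation of the first component.
\<close>
lemma distr_translation:
  assumes n: "n \<ge> 1"
  shows "distr (ref_measure n) (ref_measure n) (translation n) = ref_measure n"
proof (rule measure_eqI)
  fix B assume "B \<in> sets (distr (ref_measure n) (ref_measure n) (translation n))"
  then have B: "B \<in> sets (ref_measure n)" by simp
  have ind: "(indicator B :: _ \<Rightarrow> ennreal) \<in> borel_measurable (ref_measure n)"
    by (rule borel_measurable_indicator[OF B])
  have "emeasure (distr (ref_measure n) (ref_measure n) (translation n)) B
      = (\<integral>\<^sup>+w. indicator B w \<partial>distr (ref_measure n) (ref_measure n) (translation n))"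
    using B by simp
  also have "\<dots> = (\<integral>\<^sup>+w. indicator B (translation n w) \<partial>ref_measure n)"
    using ind by (intro nn_integral_distr measurable_translation) simp
  also have "\<dots> = (\<integral>\<^sup>+U. \<integral>\<^sup>+D. indicator B (translation n (D, U)) \<partial>lborel_on {1..n} \<partial>H0_measure n)"
    by (rule nn_integral_ref_measure(2)[OF n measurable_compose[OF measurable_translation ind]])
  also have "\<dots> = (\<integral>\<^sup>+U. \<integral>\<^sup>+D. indicator B (D, U) \<partial>lborel_on {1..n} \<partial>H0_measure n)"
  proof (rule nn_integral_cong)
    fix U assume "U \<in> space (H0_measure n)"
    then have "(\<lambda>D. indicator B (D, U) :: ennreal) \<in> borel_measurable (lborel_on {1..n})"
      using ind unfolding ref_measure_def by (intro measurable_Pair1)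
    from nn_integral_lborel_on_translate[OF finite_atLeastAtMost this, of U]
    show "(\<integral>\<^sup>+D. indicator B (translation n (D, U)) \<partial>lborel_on {1..n})
        = (\<integral>\<^sup>+D. indicator B (D, U) \<partial>lborel_on {1..n})"
      by (simp only: translation_def prod.case)
  qed
  also have "\<dots> = (\<integral>\<^sup>+w. indicator B w \<partial>ref_measure n)"
    by (rule nn_integral_ref_measure(2)[OF n ind, symmetric])
  also have "\<dots> = emeasure (ref_measure n) B" using B by simp
  finally show "emeasure (distr (ref_measure n) (ref_measure n) (translation n)) B = emeasure (ref_measure n) B" .
qed simp

text \<open>
  Since the reference measure is invariant, the density of the translated pair is the density composed
  with the translation, without a Jacobian factor.
\<close>
lemma distributed_untranslate:
  assumes n: "n \<ge> 1" and Z: "distributed M (ref_measure n) Z f"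
  shows "distributed M (ref_measure n) (\<lambda>\<omega>. (\<lambda>i\<in>{1..n}. fst (Z \<omega>) i - snd (Z \<omega>) i, snd (Z \<omega>)))
    (\<lambda>w. f (translation n w))"
proof -
  let ?R = "ref_measure n"
  \<comment> \<open>the inverse of the translation\<close>
  define S where "S = (\<lambda>w :: (nat \<Rightarrow> real) \<times> (nat \<Rightarrow> real). (\<lambda>i\<in>{1..n}. fst w i + (- 1) * snd w i, snd w))"
  have S: "S \<in> measurable ?R ?R" unfolding S_def by (rule measurable_shift_ref)
  have ST: "S (translation n w) = w" if "w \<in> space ?R" for w
    using that by (cases w) (auto simp: S_def translation_def ref_measure_def space_pair_measure space_PiM
        PiE_iff extensional_def fun_eq_iff)
  have f: "f \<in> borel_measurable ?R" and Zm: "Z \<in> measurable M ?R" and law: "distr M ?R Z = density ?R f"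
    using Z by (simp_all add: distributed_def)
  have fT: "(\<lambda>w. f (translation n w)) \<in> borel_measurable ?R"
    by (rule measurable_compose[OF measurable_translation f])
  have "distributed M ?R (\<lambda>\<omega>. S (Z \<omega>)) (\<lambda>w. f (translation n w))"
    unfolding distributed_def
  proof (intro conjI fT measurable_compose[OF Zm S])
    show "distr M ?R (\<lambda>\<omega>. S (Z \<omega>)) = density ?R (\<lambda>w. f (translation n w))"
    proof (rule measure_eqI)
      fix B assume "B \<in> sets (distr M ?R (\<lambda>\<omega>. S (Z \<omega>)))"
      then have B: "B \<in> sets ?R" by simp
      have ind: "(indicator B :: _ \<Rightarrow> ennreal) \<in> borel_measurable ?R"
        by (rule borel_measurable_indicator[OF B])
      have indS: "(\<lambda>w. indicator B (S w) :: ennreal) \<in> borel_measurable ?R"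
        by (rule measurable_compose[OF S ind])
      have "emeasure (distr M ?R (\<lambda>\<omega>. S (Z \<omega>))) B = (\<integral>\<^sup>+w. indicator B w \<partial>distr M ?R (\<lambda>\<omega>. S (Z \<omega>)))"
        using B by simp
      also have "\<dots> = (\<integral>\<^sup>+\<omega>. indicator B (S (Z \<omega>)) \<partial>M)"
        using ind by (intro nn_integral_distr measurable_compose[OF Zm S]) simp
      also have "\<dots> = (\<integral>\<^sup>+w. indicator B (S w) \<partial>distr M ?R Z)"
        using indS by (intro nn_integral_distr[symmetric] Zm) simp
      also have "\<dots> = (\<integral>\<^sup>+w. f w * indicator B (S w) \<partial>?R)"
        unfolding law by (rule nn_integral_density[OF f indS])
      also have "\<dots> = (\<integral>\<^sup>+w. f w * indicator B (S w) \<partial>distr ?R ?R (translation n))"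
        unfolding distr_translation[OF n] ..
      also have "\<dots> = (\<integral>\<^sup>+w. f (translation n w) * indicator B (S (translation n w)) \<partial>?R)"
        using f indS by (intro nn_integral_distr measurable_translation) simp
      also have "\<dots> = (\<integral>\<^sup>+w. f (translation n w) * indicator B w \<partial>?R)"
        by (intro nn_integral_cong) (simp only: ST)
      also have "\<dots> = emeasure (density ?R (\<lambda>w. f (translation n w))) B"
        by (rule emeasure_density[OF fT B, symmetric])
      finally show "emeasure (distr M ?R (\<lambda>\<omega>. S (Z \<omega>))) B = emeasure (density ?R (\<lambda>w. f (translation n w))) B" .
    qed simp
  qed
  then show ?thesis by (simp add: S_def)
qed

text \<open>
  In the coordinates that order \<open>A\<close> before \<open>U\<close> the Jacobian is upper triangular: \<open>A\<close> is added to
  itself with coefficient one, \<open>U\<close> is left alone, and only \<open>U\<close> enters the new first block.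
\<close>
lemma det_jacobian_translation:
  assumes n: "n \<ge> 1"
  shows "det (jacobian_matrix (2 * n - 1) (\<lambda>x. to_coords n (translation n (from_coords n x))) x) = 1"
proof -
  define N where "N = 2 * n - 1"
  define F where "F x = to_coords n (translation n (from_coords n x))" for x
  let ?J = "jacobian_matrix N F x"
  have F_first: "F x k = x k + H0_param n (\<lambda>i. x (n + i - 1)) (k + 1)" if "k < n" for x k
    using that by (simp add: F_def to_coords_def translation_def from_coords_def)
  have F_second: "F x k = x k" if "n \<le> k" "k < N" for x k
  proof -
    have "k - n + 1 < n" using that unfolding N_def by linarith
    then show ?thesis
      using that by (simp add: F_def to_coords_def translation_def from_coords_def H0_param_def)
  qed
  have U_indep: "H0_param n (\<lambda>i. (x(l := t)) (n + i - 1)) (k + 1) = H0_param n (\<lambda>i. x (n + i - 1)) (k + 1)"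
    if "l < n" "k < n" for x :: "nat \<Rightarrow> real" and l k t
  proof -
    have "(x(l := t)) (n + i - 1) = x (n + i - 1)" if "i \<in> {1..n}" for i
      using that \<open>l < n\<close> by auto
    then have "H0_param n (\<lambda>i. (x(l := t)) (n + i - 1)) = H0_param n (\<lambda>i. x (n + i - 1))"
      unfolding H0_param_def by (intro restrict_ext if_cong arg_cong[where f = uminus] sum.cong refl) auto
    then show ?thesis by (rule fun_cong)
  qed
  have entry: "?J $$ (k, l) = (if l = k then 1 else 0)" if kl: "l \<le> k" "k < N" for k l
  proof -
    have "?J $$ (k, l) = deriv (\<lambda>t. F (x(l := t)) k) (x l)"
      using kl by (simp add: jacobian_matrix_def)
    also have "\<dots> = (if l = k then 1 else 0)"
    proof (cases "k < n")
      case True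
      then have F: "(\<lambda>t. F (x(l := t)) k) = (\<lambda>t. (x(l := t)) k + H0_param n (\<lambda>i. x (n + i - 1)) (k + 1))"
        using kl by (simp only: F_first U_indep[of l k] le_less_trans[OF kl(1) True] True)
      show ?thesis
        unfolding F by (rule DERIV_imp_deriv) (auto intro!: derivative_eq_intros)
    next
      case False
      then have F: "(\<lambda>t. F (x(l := t)) k) = (\<lambda>t. (x(l := t)) k)"
        using kl by (simp only: F_second not_less)
      show ?thesis
        unfolding F by (rule DERIV_imp_deriv) (auto intro!: derivative_eq_intros)
    qed
    finally show ?thesis .
  qed
  have carrier: "?J \<in> carrier_mat N N" by (simp add: jacobian_matrix_def)
  have "upper_triangular ?J"
    using carrier entry by (intro upper_triangularI) auto
  then have "det ?J = prod_list (diag_mat ?J)" using carrier by (rule det_upper_triangular)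
  also have "diag_mat ?J = map (\<lambda>_. 1) [0..<N]"
    using carrier entry by (auto simp: diag_mat_def)
  also have "prod_list \<dots> = (1 :: real)" by (simp add: map_replicate_const)
  finally show ?thesis unfolding N_def F_def .
qed

section \<open>Complementary slackness\<close>

lemma assignment_cost_eq: "assignment_cost n y = (\<Sum>i\<in>{1..n}. aligned n y i i)"
proof -
  have "assignment_cost n y = perm_cost n y (opt_perm n y)"
    unfolding assignment_cost_def
    using opt_perm_permutes opt_perm_le
    by (intro Min_eqI finite_imageI finite_permutations finite_atLeastAtMost) auto
  then show ?thesis by (simp add: perm_cost_def aligned_def)
qed

lemma assignment_cost_D_A:
  assumes n: "n \<ge> 1"
  shows "assignment_cost n y = (1 / real n) * (\<Sum>i\<in>{1..n}. D_vec n y i)"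
    and "assignment_cost n y = (1 / real n) * (\<Sum>i\<in>{1..n}. A_vec n y r i)"
proof -
  show D: "assignment_cost n y = (1 / real n) * (\<Sum>i\<in>{1..n}. D_vec n y i)"
    using n by (simp add: assignment_cost_eq D_vec_def sum_distrib_left[symmetric])
  have "(\<Sum>i\<in>{1..n}. A_vec n y r i) = (\<Sum>i\<in>{1..n}. D_vec n y i) - (\<Sum>i\<in>{1..n}. U_vec n y r i)"
    by (simp add: A_vec_def sum_subtractf)
  then show "assignment_cost n y = (1 / real n) * (\<Sum>i\<in>{1..n}. A_vec n y r i)"
    using D sum_U_vec[OF n, of y r] by simp
qed

text \<open>
  The inequalities are feasibility of the potential, \<open>A i + U j \<le> n * aligned i j\<close>, and the minima are
  attained on the diagonal.
\<close>
lemma complementary_slackness: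
  assumes n: "n \<ge> 1"
    and feas: "\<And>i j. i \<in> {1..n} \<Longrightarrow> j \<in> {1..n} \<Longrightarrow>
      potential n y r j - potential n y r i \<le> aligned n y i j - aligned n y i i"
  shows "i \<in> {1..n} \<Longrightarrow> A_vec n y r i = Min ((\<lambda>j. real n * aligned n y i j - U_vec n y r j) ` {1..n})"
    and "j \<in> {1..n} \<Longrightarrow> U_vec n y r j = Min ((\<lambda>i. real n * aligned n y i j - A_vec n y r i) ` {1..n})"
proof -
  have le: "A_vec n y r i + U_vec n y r j \<le> real n * aligned n y i j" if "i \<in> {1..n}" "j \<in> {1..n}" for i j
  proof -
    have "A_vec n y r i + U_vec n y r j
        = real n * (aligned n y i i + (potential n y r j - potential n y r i))"
      using that by (simp add: A_vec_def D_vec_def U_vec_def algebra_simps)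
    also have "\<dots> \<le> real n * aligned n y i j"
      using feas[OF that] by (intro mult_left_mono) auto
    finally show ?thesis .
  qed
  have eq: "A_vec n y r i + U_vec n y r i = real n * aligned n y i i" if "i \<in> {1..n}" for i
    using that by (simp add: A_vec_def D_vec_def)
  show "A_vec n y r i = Min ((\<lambda>j. real n * aligned n y i j - U_vec n y r j) ` {1..n})" if i: "i \<in> {1..n}"
  proof (rule Min_eqI[symmetric])
    show "A_vec n y r i \<in> (\<lambda>j. real n * aligned n y i j - U_vec n y r j) ` {1..n}"
      using eq[OF i] i by (intro image_eqI[where x = i]) auto
    show "A_vec n y r i \<le> v" if "v \<in> (\<lambda>j. real n * aligned n y i j - U_vec n y r j) ` {1..n}" for v
      using that le[OF i] by force
  qed simp
  show "U_vec n y r j = Min ((\<lambda>i. real n * aligned n y i j - A_vec n y r i) ` {1..n})" if j: "j \<in> {1..n}"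
  proof (rule Min_eqI[symmetric])
    show "U_vec n y r j \<in> (\<lambda>i. real n * aligned n y i j - A_vec n y r i) ` {1..n}"
      using eq[OF j] j by (intro image_eqI[where x = j]) auto
    show "U_vec n y r j \<le> v" if "v \<in> (\<lambda>i. real n * aligned n y i j - A_vec n y r i) ` {1..n}" for v
      using that le[OF _ j] by force
  qed simp
qed

section \<open>The laws in both coordinate systems\<close>

theorem proposition2p3:
  fixes n :: nat
    and M :: "'a measure"
    and Y :: "nat \<Rightarrow> nat \<Rightarrow> 'a \<Rightarrow> real"
    and R :: "'a \<Rightarrow> nat"
  assumes n: "n \<ge> 1"
    and M: "prob_space M"
    and Y_indep: "prob_space.indep_vars M (\<lambda>_. borel) (\<lambda>(i, j). Y i j) ({1..n} \<times> {1..n})"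
    and Y_unif: "\<And>i j. i \<in> {1..n} \<Longrightarrow> j \<in> {1..n} \<Longrightarrow>
                   distr M borel (Y i j) = uniform_measure lborel {0..1}"
    and R_meas: "R \<in> measurable M (count_space {1..n})"
    and R_unif: "distr M (count_space {1..n}) R = uniform_count_measure {1..n}"
    and R_indep: "prob_space.indep_set M
                    (sets (vimage_algebra (space M)
                       (\<lambda>\<omega>. \<lambda>(i, j)\<in>{1..n} \<times> {1..n}. Y i j \<omega>) (PiM ({1..n} \<times> {1..n}) (\<lambda>_. borel))))
                    (sets (vimage_algebra (space M) R (count_space {1..n})))"
  shows
    "\<comment> \<open>(1)\<close>
     distributed M (ref_measure n)
       (\<lambda>\<omega>. (D_vec n (\<lambda>i j. Y i j \<omega>), U_vec n (\<lambda>i j. Y i j \<omega>) (R \<omega>)))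
       (\<lambda>(D, U). ennreal (fact n / real n ^ (2 * n - 1)
          * of_bool (\<forall>i\<in>{1..n}. 0 \<le> D i \<and> D i \<le> real n)
          * (\<Prod>(i, j)\<in>off_diag n. rho n (D i + U j - U i))
          * tree_poly n (\<lambda>i j. if i \<noteq> j then omega n (D i + U j - U i) else 0)))
     \<and> Z_can n = ennreal (real n ^ (2 * n - 2) / fact (n - 1))
     \<comment> \<open>(2)\<close>
     \<and> (\<forall>x. det (jacobian_matrix (2 * n - 1) (\<lambda>x. to_coords n (translation n (from_coords n x))) x) = 1)
     \<and> translation n \<in> measurable (ref_measure n) (ref_measure n)
     \<and> distr (ref_measure n) (ref_measure n) (translation n) = ref_measure n
     \<and> distributed M (ref_measure n)
       (\<lambda>\<omega>. (A_vec n (\<lambda>i j. Y i j \<omega>) (R \<omega>), U_vec n (\<lambda>i j. Y i j \<omega>) (R \<omega>)))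
       (\<lambda>(A, U). ennreal (fact n / real n ^ (2 * n - 1)
          * of_bool (\<forall>i\<in>{1..n}. 0 \<le> A i + U i \<and> A i + U i \<le> real n)
          * (\<Prod>(i, j)\<in>off_diag n. rho n (A i + U j))
          * tree_poly n (\<lambda>i j. if i \<noteq> j then omega n (A i + U j) else 0)))
     \<comment> \<open>(3)\<close>
     \<and> (AE \<omega> in M.
       let y = (\<lambda>i j. Y i j \<omega>); D = D_vec n y; U = U_vec n y (R \<omega>); A = A_vec n y (R \<omega>) in
         (\<forall>i\<in>{1..n}. A i = Min ((\<lambda>j. real n * aligned n y i j - U j) ` {1..n}))
         \<and> (\<forall>j\<in>{1..n}. U j = Min ((\<lambda>i. real n * aligned n y i j - A i) ` {1..n}))
         \<and> (\<forall>i\<in>{1..n}. D i = A i + U i)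
         \<and> assignment_cost n y = (1 / real n) * (\<Sum>i\<in>{1..n}. D i)
         \<and> assignment_cost n y = (1 / real n) * (\<Sum>i\<in>{1..n}. A i))"
proof -
  interpret prob_space M by fact
  let ?I = "cells n"
  let ?y = "\<lambda>\<omega> i j. Y i j \<omega>"
  let ?X = "\<lambda>\<omega>. \<lambda>(i, j)\<in>?I. Y i j \<omega>"
  have Y: "Y i j \<in> borel_measurable M" if "i \<in> {1..n}" "j \<in> {1..n}" for i j
  proof -
    have "(\<lambda>(i, j). Y i j) (i, j) \<in> borel_measurable M"
      using Y_indep that unfolding indep_vars_def by blast
    then show ?thesis by simp
  qed
  have X: "?X \<in> measurable M (PiM ?I (\<lambda>_. borel))" by (rule measurable_matrix[OF Y])
  note law = distr_uniform_matrix[OF n M Y_indep Y_unif]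
  let ?f = "\<lambda>w. ennreal (fact n / real n ^ (2 * n - 1) * tree_density n w)"
  have DU: "distributed M (ref_measure n) (\<lambda>\<omega>. (D_vec n (?y \<omega>), U_vec n (?y \<omega>) (R \<omega>))) ?f"
    by (rule distributed_D_U[OF n M Y law R_meas R_unif R_indep])
  have f_eq: "?f (D, U) = ennreal (fact n / real n ^ (2 * n - 1)
      * of_bool (\<forall>i\<in>{1..n}. 0 \<le> D i \<and> D i \<le> real n)
      * (\<Prod>(i, j)\<in>off_diag n. rho n (D i + U j - U i))
      * tree_poly n (\<lambda>i j. if i \<noteq> j then omega n (D i + U j - U i) else 0))" for D U
    unfolding tree_density_def fst_conv snd_conv tree_poly_weight[symmetric] by (simp only: mult.assoc)
  have "(\<integral>\<^sup>+w. ?f w \<partial>ref_measure n) = emeasure (density (ref_measure n) ?f) (space (ref_measure n))"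
    using DU by (subst emeasure_density) (auto simp: distributed_def intro!: nn_integral_cong)
  also have "\<dots> = emeasure (distr M (ref_measure n) (\<lambda>\<omega>. (D_vec n (?y \<omega>), U_vec n (?y \<omega>) (R \<omega>))))
      (space (ref_measure n))"
    using DU by (simp only: distributed_def)
  also have "\<dots> = 1"
    using prob_space.emeasure_space_1[OF prob_space_distr[OF distributed_measurable[OF DU]]] by simp
  finally have total: "(\<integral>\<^sup>+w. ?f w \<partial>ref_measure n) = 1" .
  have AU: "distributed M (ref_measure n) (\<lambda>\<omega>. (A_vec n (?y \<omega>) (R \<omega>), U_vec n (?y \<omega>) (R \<omega>)))
      (\<lambda>w. ?f (translation n w))"
    using distributed_untranslate[OF n DU] by (simp add: A_vec_def)
  have f_translation: "?f (translation n (A, U)) = ennreal (fact n / real n ^ (2 * n - 1)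
      * of_bool (\<forall>i\<in>{1..n}. 0 \<le> A i + U i \<and> A i + U i \<le> real n)
      * (\<Prod>(i, j)\<in>off_diag n. rho n (A i + U j))
      * tree_poly n (\<lambda>i j. if i \<noteq> j then omega n (A i + U j) else 0))" for A U
  proof -
    let ?D = "\<lambda>i\<in>{1..n}. A i + U i"
    have tp: "tree_poly n z = tree_poly n z'"
      if "\<And>i j. i \<in> {1..n} \<Longrightarrow> j \<in> {1..n} \<Longrightarrow> z i j = z' i j" for z z'
      unfolding tree_poly_def tree_poly_at_def
    proof (intro sum.cong refl prod.cong)
      fix r T e assume "T \<in> in_arborescences n r" "e \<in> T"
      then have "e \<in> ?I" by (auto simp: in_arborescences_def)
      then show "(case e of (i, j) \<Rightarrow> z i j) = (case e of (i, j) \<Rightarrow> z' i j)"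
        using that by (cases e) simp
    qed
    have "tree_poly n (\<lambda>i j. if i \<noteq> j then omega n (?D i + U j - U i) else 0)
        = tree_poly n (\<lambda>i j. if i \<noteq> j then omega n (A i + U j) else 0)"
      by (rule tp) (simp add: algebra_simps)
    moreover have "(\<Prod>(i, j)\<in>off_diag n. rho n (?D i + U j - U i)) = (\<Prod>(i, j)\<in>off_diag n. rho n (A i + U j))"
      by (intro prod.cong refl) (auto simp: off_diag_def algebra_simps)
    moreover have "(\<forall>i\<in>{1..n}. 0 \<le> ?D i \<and> ?D i \<le> real n) \<longleftrightarrow> (\<forall>i\<in>{1..n}. 0 \<le> A i + U i \<and> A i + U i \<le> real n)"
      by (intro ball_cong refl) simp
    ultimately show ?thesis
      unfolding translation_def prod.case f_eq by (simp only:)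
  qed
  have "AE \<omega> in M. \<forall>r\<in>{1..n}. has_strict_tree n r (?X \<omega>)"
    using AE_ex_strict_tree_uniform[OF n M X law] by (intro AE_finite_allI) auto
  then have slack: "AE \<omega> in M.
       let y = (\<lambda>i j. Y i j \<omega>); D = D_vec n y; U = U_vec n y (R \<omega>); A = A_vec n y (R \<omega>) in
         (\<forall>i\<in>{1..n}. A i = Min ((\<lambda>j. real n * aligned n y i j - U j) ` {1..n}))
         \<and> (\<forall>j\<in>{1..n}. U j = Min ((\<lambda>i. real n * aligned n y i j - A i) ` {1..n}))
         \<and> (\<forall>i\<in>{1..n}. D i = A i + U i)
         \<and> assignment_cost n y = (1 / real n) * (\<Sum>i\<in>{1..n}. D i)
         \<and> assignment_cost n y = (1 / real n) * (\<Sum>i\<in>{1..n}. A i)" (is "AE \<omega> in M. ?slackness \<omega>")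
  proof (rule AE_mp, intro AE_I2 impI)
    fix \<omega> assume \<omega>: "\<omega> \<in> space M" and ex: "\<forall>r\<in>{1..n}. has_strict_tree n r (?X \<omega>)"
    let ?r = "R \<omega>" and ?q = "potential n (?y \<omega>) (R \<omega>)"
    have r: "?r \<in> {1..n}" using measurable_space[OF R_meas \<omega>] by simp
    then obtain \<sigma> p where \<sigma>: "\<sigma> permutes {1..n}" and p: "p \<in> parent_maps n ?r"
      and s: "strict_tree n ?r p (curry (relabel n \<sigma> (?X \<omega>)))" using ex by blast
    have X_apply: "?X \<omega> (i, j) = ?y \<omega> i j" if "i \<in> {1..n}" "j \<in> {1..n}" for i j
      using that by simp
    note tree = strict_tree_D_U(3,4)[where x = "?X \<omega>" and y = "?y \<omega>", OF r \<sigma> p X_apply s]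
    have feas: "?q j - ?q i \<le> aligned n (?y \<omega>) i j - aligned n (?y \<omega>) i i"
      if "i \<in> {1..n}" "j \<in> {1..n}" for i j
      using strict_tree_feasible[OF p tree(1)] that tree(2) unfolding feasible_def by simp
    have "D_vec n (?y \<omega>) i = A_vec n (?y \<omega>) ?r i + U_vec n (?y \<omega>) ?r i" if "i \<in> {1..n}" for i
      using that by (simp add: A_vec_def)
    then show "?slackness \<omega>"
      unfolding Let_def
      using complementary_slackness[OF n feas] assignment_cost_D_A[OF n, of "?y \<omega>"]
      by (intro conjI ballI) blast+
  qed
  have pairs: "(\<lambda>(D, U). ?f (D, U)) = ?f" "(\<lambda>(A, U). ?f (translation n (A, U))) = (\<lambda>w. ?f (translation n w))"
    by auto
  show ?thesis
    using DU AU Z_can_eq[OF n total] det_jacobian_translation[OF n] measurable_translation[of n]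
      distr_translation[OF n] slack
    unfolding f_eq[symmetric] f_translation[symmetric]
    by (intro conjI allI) (simp_all only: pairs)
qed

end
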